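(* Let $\Gamma$ be a non elementary word hyperbolic group and $\rho:\Gamma\to G=\mathrm{PSO}(p,q)$ a projective Anosov representation. The geodesic flow of $\rho$ on $\mathrm{U}_\rho\Gamma$ is topologically weakly-mixing, i.e. there is no constant $a>0$ such that the periods of all its periodic orbits are integer multiples of $a$.
   Context: Fix integers $p,q\ge1$ with $d:=p+q>2$. $G=\mathrm{PSO}(p,q)\subset\mathrm{PSL}(d,\mathbb{R})$ is the group of projectivized matrices in $\mathrm{SL}(d,\mathbb{R})$ preserving $\langle x,y\rangle_{p,q}=\sum_{i\le p}x_iy_i-\sum_{i>p}x_iy_i$ on $\mathbb{R}^d$. Let $a_1(g)\ge\dots\ge a_d(g)$ be the logarithms of the singular values of $g\in\mathrm{PSL}(d,\mathbb{R})$ for a fixed inner product on $\mathbb{R}^d$ and $|\cdot|_\Gamma$ the word length for a finite symmetric generating set of $\Gamma$. $\rho:\Gamma\to\mathrm{PSL}(d,\mathbb{R})$ is projective Anosov if there are $C,\alpha>0$ with $a_1(\rho(\gamma))-a_2(\rho(\gamma))\ge\alpha|\gamma|_\Gamma-C$ for all $\gamma\in\Gamma$. Let $\partial_\infty\Gamma$ be the Gromov boundary and $\partial^2_\infty\Gamma$ the set of pairs of distinct points in it. A projective Anosov representation has continuous equivariant limit maps $\xi:\partial_\infty\Gamma\to\mathbb{P}(\mathbb{R}^d)$ and $\eta:\partial_\infty\Gamma\to\mathsf{Gr}_{d-1}(\mathbb{R}^d)$ with $\xi(x)\oplus\eta(y)=\mathbb{R}^d$ for $x\ne y$, such that for every infinite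 order $\gamma$ with attractive fixed point $\gamma_+\in\partial_\infty\Gamma$, $\xi(\gamma_+)$ is the attractive fixed line of $\rho(\gamma)$ and $\eta(\gamma_+)$ the repelling hyperplane of $\rho(\gamma^{-1})$. Identify a hyperplane with the line in $(\mathbb{R}^d)^*$ of functionals vanishing on it. For $(x,y)\in\partial^2_\infty\Gamma$ let $\mathrm{M}(x,y):=\{(\theta,v)\in\eta(x)\times\xi(y):\theta(v)=1\}/\sim$ with $(\theta,v)\sim(-\theta,-v)$, and let $F_\rho:=\{(x,y,\theta,v):(x,y)\in\partial^2_\infty\Gamma,\ (\theta,v)\in\mathrm{M}(x,y)\}$. $\Gamma$ acts properly and co-compactly on $F_\rho$ by $\gamma\cdot(x,y,\theta,v)=(\gamma x,\gamma y,\theta\circ\rho(\gamma)^{-1},\rho(\gamma)v)$; the quotient is $\mathrm{U}_\rho\Gamma$. The flow $\phi_t(x,y,\theta,v):=(x,y,e^{-t}\theta,e^tv)$ descends to $\mathrm{U}_\rho\Gamma$; this is the geodesic flow of $\rho$. Its periodic orbits correspond one-to-one to conjugacy classes of primitive elements $\gamma\in\Gamma$ (elements that are not a positive power of another element), the period being $\lambda_1(\rho(\gamma))$, the logarithm of the spectral radius of $\rho(\gamma)$. *)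

theory Defs
  imports
    "HOL-Analysis.Analysis"
    "HOL-Library.Multiset"
    "HOL-Algebra.Generated_Groups"
    "HOL-Algebra.Multiplicative_Group"
begin

section \<open>Word metrics, hyperbolicity and the Gromov boundary\<close>

definition finite_symmetric_generating_set :: "('g, 'm) monoid_scheme \<Rightarrow> 'g set \<Rightarrow> bool" where
  "finite_symmetric_generating_set G S \<longleftrightarrow>
     finite S \<and> S \<subseteq> carrier G \<and> (\<forall>s\<in>S. inv\<^bsub>G\<^esub> s \<in> S) \<and> generate G S = carrier G"

definition word_length :: "('g, 'm) monoid_scheme \<Rightarrow> 'g set \<Rightarrow> 'g \<Rightarrow> nat" where
  "word_length G S g =
     (LEAST n. \<exists>ws. length ws = n \<and> set ws \<subseteq> S \<and> foldr (\<otimes>\<^bsub>G\<^esub>) ws \<one>\<^bsub>G\<^esub> = g)"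

definition word_dist :: "('g, 'm) monoid_scheme \<Rightarrow> 'g set \<Rightarrow> 'g \<Rightarrow> 'g \<Rightarrow> real" where
  "word_dist G S g h = real (word_length G S (inv\<^bsub>G\<^esub> g \<otimes>\<^bsub>G\<^esub> h))"

definition gromov_product ::
    "('g, 'm) monoid_scheme \<Rightarrow> 'g set \<Rightarrow> 'g \<Rightarrow> 'g \<Rightarrow> 'g \<Rightarrow> real" where
  "gromov_product G S w g h =
     (word_dist G S w g + word_dist G S w h - word_dist G S g h) / 2"

definition word_hyperbolic :: "('g, 'm) monoid_scheme \<Rightarrow> 'g set \<Rightarrow> bool" where
  "word_hyperbolic G S \<longleftrightarrow>
     (\<exists>\<delta>. \<forall>w\<in>carrier G. \<forall>x\<in>carrier G. \<forall>y\<in>carrier G. \<forall>z\<in>carrier G.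
        gromov_product G S w x y \<ge>
          min (gromov_product G S w x z) (gromov_product G S w z y) - \<delta>)"

text \<open>Elementary means virtually cyclic; the case \<open>g = \<one>\<close> covers finite groups.\<close>

definition elementary_group :: "('g, 'm) monoid_scheme \<Rightarrow> bool" where
  "elementary_group G \<longleftrightarrow> (\<exists>g\<in>carrier G. finite (rcosets\<^bsub>G\<^esub> (generate G {g})))"

text \<open>Points of the Gromov boundary are classes of sequences in the group that converge to
  infinity, i.e. with \<open>(s\<^sub>i | s\<^sub>j) \<rightarrow> \<infinity>\<close> as \<open>i, j \<rightarrow> \<infinity>\<close>; two such sequences are identified when
  \<open>(s\<^sub>i | t\<^sub>j) \<rightarrow> \<infinity>\<close>.\<close>

definition asymptotic :: "('g, 'm) monoid_scheme \<Rightarrow> 'g set \<Rightarrow> (nat \<Rightarrow> 'g) \<Rightarrow> (nat \<Rightarrow> 'g) \<Rightarrow> bool" where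
  "asymptotic G S s t \<longleftrightarrow>
     filterlim (\<lambda>(i, j). gromov_product G S \<one>\<^bsub>G\<^esub> (s i) (t j)) at_top (sequentially \<times>\<^sub>F sequentially)"

definition sequences_to_infinity :: "('g, 'm) monoid_scheme \<Rightarrow> 'g set \<Rightarrow> (nat \<Rightarrow> 'g) set" where
  "sequences_to_infinity G S = {s. range s \<subseteq> carrier G \<and> asymptotic G S s s}"

definition gromov_boundary :: "('g, 'm) monoid_scheme \<Rightarrow> 'g set \<Rightarrow> (nat \<Rightarrow> 'g) set set" where
  "gromov_boundary G S =
     sequences_to_infinity G S //
       {(s, t). s \<in> sequences_to_infinity G S \<and> t \<in> sequences_to_infinity G S \<and> asymptotic G S s t}"

text \<open>\<open>boundary_nbhd G S x r\<close> is the set of \<open>y\<close> with \<open>(x | y) \<ge> r\<close>; these sets form a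
  neighbourhood basis at \<open>x\<close>, though they need not be open themselves.\<close>

definition boundary_nbhd ::
    "('g, 'm) monoid_scheme \<Rightarrow> 'g set \<Rightarrow> (nat \<Rightarrow> 'g) set \<Rightarrow> real \<Rightarrow> (nat \<Rightarrow> 'g) set set" where
  "boundary_nbhd G S x r =
     {y \<in> gromov_boundary G S. \<exists>s\<in>x. \<exists>t\<in>y. \<exists>N. \<forall>i\<ge>N. \<forall>j\<ge>N.
        gromov_product G S \<one>\<^bsub>G\<^esub> (s i) (t j) \<ge> r}"

definition boundary_topology ::
    "('g, 'm) monoid_scheme \<Rightarrow> 'g set \<Rightarrow> (nat \<Rightarrow> 'g) set topology" where
  "boundary_topology G S =
     topology (\<lambda>U. U \<subseteq> gromov_boundary G S \<and> (\<forall>x\<in>U. \<exists>r. boundary_nbhd G S x r \<subseteq> U))"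

lemma openin_boundary_topology:
  "openin (boundary_topology G S) U \<longleftrightarrow>
     U \<subseteq> gromov_boundary G S \<and> (\<forall>x\<in>U. \<exists>r. boundary_nbhd G S x r \<subseteq> U)"
proof -
  let ?P = "\<lambda>U. U \<subseteq> gromov_boundary G S \<and> (\<forall>x\<in>U. \<exists>r. boundary_nbhd G S x r \<subseteq> U)"
  have mono: "boundary_nbhd G S x r' \<subseteq> boundary_nbhd G S x r" if "r \<le> r'" for x r r'
    unfolding boundary_nbhd_def using that by (blast intro: order_trans)
  have "?P (U \<inter> V)" if U: "?P U" and V: "?P V" for U V
  proof (intro conjI ballI)
    show "U \<inter> V \<subseteq> gromov_boundary G S" using U by blast
    fix x assume "x \<in> U \<inter> V"
    then obtain r r' where "boundary_nbhd G S x r \<subseteq> U" "boundary_nbhd G S x r' \<subseteq> V"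
      using U V by blast
    then have "boundary_nbhd G S x (max r r') \<subseteq> U \<inter> V"
      using mono[of r "max r r'" x] mono[of r' "max r r'" x] by auto
    then show "\<exists>r. boundary_nbhd G S x r \<subseteq> U \<inter> V" by blast
  qed
  moreover have "?P (\<Union>K)" if "\<forall>U\<in>K. ?P U" for K
    using that by (meson Sup_least UnionE Union_upper order_trans)
  ultimately have "istopology ?P"
    unfolding istopology_def by blast
  then show ?thesis
    unfolding boundary_topology_def by (simp add: topology_inverse')
qed

definition boundary_act :: "('g, 'm) monoid_scheme \<Rightarrow> 'g \<Rightarrow> (nat \<Rightarrow> 'g) set \<Rightarrow> (nat \<Rightarrow> 'g) set" where
  "boundary_act G \<gamma> x = (\<lambda>s n. \<gamma> \<otimes>\<^bsub>G\<^esub> s n) ` x"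

text \<open>The attractive fixed point of an infinite order element is the limit of its powers.\<close>

definition attractive_fixed_point ::
    "('g, 'm) monoid_scheme \<Rightarrow> 'g set \<Rightarrow> 'g \<Rightarrow> (nat \<Rightarrow> 'g) set \<Rightarrow> bool" where
  "attractive_fixed_point G S \<gamma> x \<longleftrightarrow> x \<in> gromov_boundary G S \<and> (\<lambda>n. \<gamma> [^]\<^bsub>G\<^esub> (n::nat)) \<in> x"


section \<open>\<open>PSL(d,\<real>)\<close> and \<open>PSO(p,q)\<close>\<close>

definition SL :: "(real^'n^'n) monoid" where
  "SL = \<lparr>carrier = {A. det A = 1}, mult = (**), one = mat 1\<rparr>"

definition SL_scalars :: "(real^'n^'n) set" where
  "SL_scalars = {A \<in> carrier SL. \<exists>c. A = mat c}"

text \<open>Elements of \<open>PSL\<close> are the cosets of \<open>SL_scalars\<close>, i.e. sets \<open>{A, - A}\<close> for even \<open>d\<close> and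
  \<open>{A}\<close> for odd \<open>d\<close>.\<close>

definition PSL :: "(real^'n^'n) set monoid" where
  "PSL = SL Mod SL_scalars"

text \<open>The index type \<open>'p + 'q\<close> gives \<open>\<real>\<^sup>d\<close> with \<open>p = CARD('p)\<close>, \<open>q = CARD('q)\<close> and
  \<open>d = p + q\<close>; the left summand indexes the positive directions.\<close>

definition form_pq :: "real^('p::finite + 'q::finite) \<Rightarrow> real^('p + 'q) \<Rightarrow> real" where
  "form_pq x y = (\<Sum>i\<in>UNIV. x $ Inl i * y $ Inl i) - (\<Sum>j\<in>UNIV. x $ Inr j * y $ Inr j)"

definition PSO :: "(real^('p::finite + 'q::finite)^('p + 'q)) set monoid" where
  "PSO = PSL\<lparr>carrier := {SL_scalars #>\<^bsub>SL\<^esub> A | A.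
     A \<in> carrier SL \<and> (\<forall>x y. form_pq (A *v x) (A *v y) = form_pq x y)}\<rparr>"


section \<open>Singular values and projective Anosov representations\<close>

definition singular_values :: "real^'n^'n \<Rightarrow> real set" where
  "singular_values A = {s. s \<ge> 0 \<and> (\<exists>x\<noteq>0. (transpose A ** A) *v x = s\<^sup>2 *\<^sub>R x)}"

definition singular_value_mset :: "real^'n^'n \<Rightarrow> real multiset" where
  "singular_value_mset A =
     (\<Sum>s\<in>singular_values A. replicate_mset (dim {x. (transpose A ** A) *v x = s\<^sup>2 *\<^sub>R x}) s)"

text \<open>\<open>log_singular_value k A\<close> is \<open>a\<^sub>k(A)\<close>, with \<open>k\<close> starting at 1 and singular values in
  decreasing order.\<close>

definition log_singular_value :: "nat \<Rightarrow> real^'n^'n \<Rightarrow> real" where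
  "log_singular_value k A = ln (rev (sorted_list_of_multiset (singular_value_mset A)) ! (k - 1))"

text \<open>Here and below, \<open>A \<in> \<rho> \<gamma>\<close> ranges over the matrices representing an element of \<open>PSL\<close>;
  the conditions do not depend on the sign of \<open>A\<close>.\<close>

definition projective_anosov ::
    "('g, 'm) monoid_scheme \<Rightarrow> 'g set \<Rightarrow> ('g \<Rightarrow> (real^'n^'n) set) \<Rightarrow> bool" where
  "projective_anosov G S \<rho> \<longleftrightarrow>
     (\<exists>C \<alpha>. C > 0 \<and> \<alpha> > 0 \<and> (\<forall>\<gamma>\<in>carrier G. \<forall>A\<in>\<rho> \<gamma>.
        log_singular_value 1 A - log_singular_value 2 A \<ge> \<alpha> * real (word_length G S \<gamma>) - C))"


section \<open>Projective spaces and limit maps\<close>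

definition lines :: "'v::real_normed_vector set set" where
  "lines = {span {v} | v. v \<noteq> 0}"

text \<open>The quotient topology from the nonzero vectors.\<close>

definition projective_topology :: "'v::real_normed_vector set topology" where
  "projective_topology = topology (\<lambda>U. U \<subseteq> lines \<and> open {v. v \<noteq> 0 \<and> span {v} \<in> U})"

lemma openin_projective_topology:
  "openin projective_topology U \<longleftrightarrow> U \<subseteq> lines \<and> open {v. v \<noteq> 0 \<and> span {v} \<in> U}"
proof -
  let ?S = "\<lambda>U. {v :: 'a. v \<noteq> 0 \<and> span {v} \<in> U}"
  have "?S (U \<inter> V) = ?S U \<inter> ?S V" for U V by auto
  moreover have "?S (\<Union>K) = (\<Union>U\<in>K. ?S U)" for K by auto
  ultimately have "istopology (\<lambda>U. U \<subseteq> lines \<and> open (?S U))"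
    unfolding istopology_def by (auto intro!: open_UN)
  then show ?thesis
    unfolding projective_topology_def by (simp add: topology_inverse')
qed

definition hyperplanes :: "(real^'n) set set" where
  "hyperplanes = {H. subspace H \<and> dim H + 1 = CARD('n)}"

text \<open>The annihilator identifies a hyperplane with a line in the dual space; this also gives the
  topology on the Grassmannian of hyperplanes.\<close>

definition annihilator :: "(real^'n) set \<Rightarrow> ((real^'n) \<Rightarrow>\<^sub>L real) set" where
  "annihilator H = {\<theta>. \<forall>v\<in>H. blinfun_apply \<theta> v = 0}"

definition hyperplane_topology :: "(real^'n) set topology" where
  "hyperplane_topology = pullback_topology hyperplanes annihilator projective_topology"

definition attracting_repelling :: "real^'n^'n \<Rightarrow> (real^'n) set \<Rightarrow> (real^'n) set \<Rightarrow> bool" where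
  "attracting_repelling A L H \<longleftrightarrow>
     L \<in> lines \<and> H \<in> hyperplanes \<and> L \<inter> H = {0} \<and> (*v) A ` L = L \<and> (*v) A ` H = H \<and>
     (\<forall>v. v \<notin> H \<longrightarrow>
        limitin projective_topology (\<lambda>n. span {(((*v) A) ^^ n) v}) L sequentially)"

definition limit_maps ::
    "('g, 'm) monoid_scheme \<Rightarrow> 'g set \<Rightarrow> ('g \<Rightarrow> (real^'n^'n) set) \<Rightarrow>
     ((nat \<Rightarrow> 'g) set \<Rightarrow> (real^'n) set) \<Rightarrow> ((nat \<Rightarrow> 'g) set \<Rightarrow> (real^'n) set) \<Rightarrow> bool" where
  "limit_maps G S \<rho> \<xi> \<eta> \<longleftrightarrow>
     continuous_map (boundary_topology G S) projective_topology \<xi> \<and>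
     continuous_map (boundary_topology G S) hyperplane_topology \<eta> \<and>
     (\<forall>\<gamma>\<in>carrier G. \<forall>A\<in>\<rho> \<gamma>. \<forall>x\<in>gromov_boundary G S.
        \<xi> (boundary_act G \<gamma> x) = (*v) A ` \<xi> x \<and> \<eta> (boundary_act G \<gamma> x) = (*v) A ` \<eta> x) \<and>
     (\<forall>x\<in>gromov_boundary G S. \<forall>y\<in>gromov_boundary G S. x \<noteq> y \<longrightarrow>
        \<xi> x \<inter> \<eta> y = {0} \<and> (\<forall>v. \<exists>u\<in>\<xi> x. \<exists>w\<in>\<eta> y. v = u + w)) \<and>
     (\<forall>\<gamma>\<in>carrier G. group.ord G \<gamma> = 0 \<longrightarrow> (\<forall>x. attractive_fixed_point G S \<gamma> x \<longrightarrow>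
        (\<forall>A\<in>\<rho> \<gamma>. \<exists>H. attracting_repelling A (\<xi> x) H) \<and>
        (\<forall>B\<in>\<rho> (inv\<^bsub>G\<^esub> \<gamma>). \<exists>L. attracting_repelling B L (\<eta> x))))"


section \<open>The geodesic flow\<close>

type_synonym ('g, 'n) flow_point =
  "(nat \<Rightarrow> 'g) set \<times> (nat \<Rightarrow> 'g) set \<times> (((real^'n) \<Rightarrow>\<^sub>L real) \<times> (real^'n)) set"

text \<open>An element of \<open>fibre \<xi> \<eta> x y\<close> is a class \<open>{(\<theta>, v), (- \<theta>, - v)}\<close>.\<close>

definition fibre ::
    "('b \<Rightarrow> (real^'n) set) \<Rightarrow> ('b \<Rightarrow> (real^'n) set) \<Rightarrow> 'b \<Rightarrow> 'b \<Rightarrow>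
     (((real^'n) \<Rightarrow>\<^sub>L real) \<times> (real^'n)) set set" where
  "fibre \<xi> \<eta> x y =
     {{(\<theta>, v), (- \<theta>, - v)} | \<theta> v. \<theta> \<in> annihilator (\<eta> x) \<and> v \<in> \<xi> y \<and> blinfun_apply \<theta> v = 1}"

definition flow_cover ::
    "('g, 'm) monoid_scheme \<Rightarrow> 'g set \<Rightarrow> ((nat \<Rightarrow> 'g) set \<Rightarrow> (real^'n) set) \<Rightarrow>
     ((nat \<Rightarrow> 'g) set \<Rightarrow> (real^'n) set) \<Rightarrow> ('g, 'n) flow_point set" where
  "flow_cover G S \<xi> \<eta> =
     {(x, y, c). x \<in> gromov_boundary G S \<and> y \<in> gromov_boundary G S \<and> x \<noteq> y \<and> c \<in> fibre \<xi> \<eta> x y}"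

text \<open>Acting with all representatives of \<open>\<rho> \<gamma>\<close> on a class \<open>{(\<theta>, v), (- \<theta>, - v)}\<close> yields again
  a single such class.\<close>

definition cover_act ::
    "('g, 'm) monoid_scheme \<Rightarrow> ('g \<Rightarrow> (real^'n^'n) set) \<Rightarrow> 'g \<Rightarrow>
     ('g, 'n::finite) flow_point \<Rightarrow> ('g, 'n) flow_point" where
  "cover_act G \<rho> \<gamma> = (\<lambda>(x, y, c).
     (boundary_act G \<gamma> x, boundary_act G \<gamma> y,
      {(Blinfun (\<lambda>w. blinfun_apply \<theta> (matrix_inv A *v w)), A *v v) | A \<theta> v.
         A \<in> \<rho> \<gamma> \<and> (\<theta>, v) \<in> c}))"

definition cover_flow :: "real \<Rightarrow> ('g, 'n::finite) flow_point \<Rightarrow> ('g, 'n) flow_point" where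
  "cover_flow t = (\<lambda>(x, y, c). (x, y, (\<lambda>(\<theta>, v). (exp (- t) *\<^sub>R \<theta>, exp t *\<^sub>R v)) ` c))"

definition flow_space ::
    "('g, 'm) monoid_scheme \<Rightarrow> 'g set \<Rightarrow> ('g \<Rightarrow> (real^'n^'n) set) \<Rightarrow>
     ((nat \<Rightarrow> 'g) set \<Rightarrow> (real^'n) set) \<Rightarrow> ((nat \<Rightarrow> 'g) set \<Rightarrow> (real^'n) set) \<Rightarrow>
     ('g, 'n::finite) flow_point set set" where
  "flow_space G S \<rho> \<xi> \<eta> =
     flow_cover G S \<xi> \<eta> //
       {(z, z'). z \<in> flow_cover G S \<xi> \<eta> \<and> (\<exists>\<gamma>\<in>carrier G. z' = cover_act G \<rho> \<gamma> z)}"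

definition geodesic_flow ::
    "real \<Rightarrow> ('g, 'n::finite) flow_point set \<Rightarrow> ('g, 'n) flow_point set" where
  "geodesic_flow t u = cover_flow t ` u"

text \<open>\<open>T\<close> is the (minimal) period of a periodic orbit of the flow \<open>\<phi>\<close> on \<open>X\<close>.\<close>

definition is_orbit_period :: "'x set \<Rightarrow> (real \<Rightarrow> 'x \<Rightarrow> 'x) \<Rightarrow> real \<Rightarrow> bool" where
  "is_orbit_period X \<phi> T \<longleftrightarrow>
     (\<exists>u\<in>X. T > 0 \<and> \<phi> T u = u \<and> (\<forall>s. 0 < s \<and> s < T \<longrightarrow> \<phi> s u \<noteq> u))"

definition topologically_weakly_mixing :: "'x set \<Rightarrow> (real \<Rightarrow> 'x \<Rightarrow> 'x) \<Rightarrow> bool" where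
  "topologically_weakly_mixing X \<phi> \<longleftrightarrow>
     \<not> (\<exists>a>0. \<forall>T. is_orbit_period X \<phi> T \<longrightarrow> (\<exists>k::int. T = of_int k * a))"

end

theory Submission
  imports Defs
begin

text \<open>Suppose all periods lie in \<open>a\<int>\<close>. Let \<open>g\<close> be an element whose powers form a quasi-geodesic, with
  \<open>A\<close> representing \<open>\<rho>(g)\<close>; then \<open>m\<^sup>-\<^sup>n A\<^sup>n\<close> converges to the projection \<open>w \<mapsto> b(w) v\<close> onto the line
  \<open>\<xi>(g\<^sub>+)\<close> along \<open>\<eta>(g\<^sub>-)\<close>. If \<open>H\<close> represents \<open>\<rho>(h)\<close> with \<open>b(H v) \<noteq> 0\<close>, the top eigenvalue of
  \<open>H A\<^sup>n\<close>, divided by \<open>m\<^sup>n\<close>, tends to \<open>b(H v)\<close>; hence \<open>ln |b(H v)|\<close> lies in the discrete set \<open>a\<int>\<close>.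
  Applied to \<open>h g\<^sup>n h'\<close> this shows that \<open>m\<^sup>-\<^sup>n b(H A\<^sup>n H' v)\<close>, which converges, is eventually constant.
  A sequence \<open>\<phi>(A\<^sup>n u)\<close> that vanishes for all large \<open>n\<close> vanishes for all integers \<open>n\<close>, and letting
  \<open>n \<rightarrow> -\<infinity>\<close> gives \<open>b'(H' v) b(H v') = 0\<close>, where \<open>b'\<close> and \<open>v'\<close> belong to \<open>g\<^sup>-\<^sup>1\<close>. By transversality this
  fails as soon as \<open>h' g\<^sub>+\<close> is not in \<open>{g\<^sub>+, g\<^sub>-}\<close> and neither \<open>h g\<^sub>+\<close> nor \<open>h g\<^sub>-\<close> equals \<open>g\<^sub>-\<close>,
  and such \<open>h, h'\<close> exist in a non-elementary group.\<close>


section \<open>Quasi-geodesic powers in hyperbolic groups\<close>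

text \<open>\<open>limit_maps\<close> controls \<open>\<rho>\<close> only at elements whose powers
  converge to a boundary point, so every product \<open>h \<otimes> g [^] n\<close> whose eigenvalue
  is used must first be shown to be of this kind. This is what \<open>good\<close> is for: by a
  local-to-global argument \<open>h \<otimes> g [^] n\<close> is again \<open>good\<close> for large
  \<open>n\<close> as soon as \<open>h\<close> does not send \<open>g\<^sub>+\<close> to
  \<open>g\<^sub>-\<close>; and \<open>b(H v) \<noteq> 0\<close> excludes the latter, because
  \<open>b\<close> vanishes on \<open>\<xi>(g\<^sub>-)\<close>. The second obstacle is that the
  hypothesis speaks of minimal periods, while \<open>g\<close> may fail to be primitive and its
  orbit may close up earlier than \<open>ln |m|\<close>. Instead of extracting roots in the group,
  the proof studies return times: the stabilizer of \<open>g\<^sub>+\<close> is covered by finitely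
  many cosets of the powers of \<open>g\<close>, so the return times are discrete and the minimal
  one divides \<open>ln |m|\<close>. The same finiteness shows that in a non-elementary group some
  element moves \<open>g\<^sub>+\<close> away from both fixed points of \<open>g\<close>.\<close>

locale word_metric_group = group G for G (structure) +
  fixes S
  assumes gen: "finite_symmetric_generating_set G S"
begin

abbreviation len where "len g \<equiv> word_length G S g"

lemma S_carrier: "S \<subseteq> carrier G" and finite_S: "finite S"
  and S_inv: "s \<in> S \<Longrightarrow> inv s \<in> S" and S_gen: "generate G S = carrier G"
  using gen unfolding finite_symmetric_generating_set_def by auto

abbreviation wprod where "wprod ws \<equiv> foldr (\<otimes>) ws \<one>"

lemma wprod_closed [simp]: "set ws \<subseteq> carrier G \<Longrightarrow> wprod ws \<in> carrier G"
  by (induction ws) auto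

lemma wprod_append: "set us \<subseteq> carrier G \<Longrightarrow> set vs \<subseteq> carrier G \<Longrightarrow>
    wprod (us @ vs) = wprod us \<otimes> wprod vs"
  by (induction us) (auto simp: m_assoc)

lemma wprod_exists:
  assumes "g \<in> carrier G"
  shows "\<exists>ws. set ws \<subseteq> S \<and> wprod ws = g"
proof -
  have "g \<in> generate G S" using assms S_gen by simp
  then show ?thesis
  proof (induction rule: generate.induct)
    case one
    show ?case by (rule exI[of _ "[]"]) simp
  next
    case (incl h)
    then show ?case using S_carrier by (intro exI[of _ "[h]"]) auto
  next
    case (inv h)
    then show ?case using S_carrier S_inv[OF inv] by (intro exI[of _ "[inv h]"]) auto
  next
    case (eng h1 h2)
    then obtain us vs where "set us \<subseteq> S" "wprod us = h1" "set vs \<subseteq> S" "wprod vs = h2" by auto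
    then show ?case using S_carrier by (intro exI[of _ "us @ vs"]) (auto simp del: foldr_append simp: wprod_append)
  qed
qed

lemma len_word:
  assumes "g \<in> carrier G"
  shows "\<exists>ws. length ws = len g \<and> set ws \<subseteq> S \<and> wprod ws = g"
proof -
  obtain ws where "set ws \<subseteq> S" "wprod ws = g" using wprod_exists[OF assms] by auto
  then have "\<exists>n. \<exists>ws. length ws = n \<and> set ws \<subseteq> S \<and> wprod ws = g" by auto
  then show ?thesis unfolding word_length_def by (rule LeastI_ex)
qed

lemma len_le: "set ws \<subseteq> S \<Longrightarrow> len (wprod ws) \<le> length ws"
  unfolding word_length_def by (rule Least_le) auto

lemma len_one [simp]: "len \<one> = 0"
  using len_le[of "[]"] by simp

lemma len_eq_0: "g \<in> carrier G \<Longrightarrow> len g = 0 \<Longrightarrow> g = \<one>"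
  using len_word[of g] by auto

lemma len_mult:
  assumes "g \<in> carrier G" "h \<in> carrier G"
  shows "len (g \<otimes> h) \<le> len g + len h"
proof -
  obtain us where us: "length us = len g" "set us \<subseteq> S" "wprod us = g" using len_word assms by blast
  obtain vs where vs: "length vs = len h" "set vs \<subseteq> S" "wprod vs = h" using len_word assms by blast
  have "wprod (us @ vs) = g \<otimes> h" using us vs S_carrier by (subst wprod_append) auto
  then show ?thesis using len_le[of "us @ vs"] us vs by simp
qed

lemma len_inv_le:
  assumes "g \<in> carrier G"
  shows "len (inv g) \<le> len g"
proof -
  have "set ws \<subseteq> S \<Longrightarrow> len (inv (wprod ws)) \<le> length ws" for ws
  proof (induction ws)
    case (Cons s ws)
    have c: "s \<in> carrier G" "wprod ws \<in> carrier G" using Cons.prems S_carrier by auto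
    have "len (inv s) \<le> 1" using len_le[of "[inv s]"] S_inv[of s] Cons.prems S_carrier by auto
    moreover have "inv (wprod (s # ws)) = inv (wprod ws) \<otimes> inv s" using c by (simp add: inv_mult_group)
    moreover have "len (inv (wprod ws) \<otimes> inv s) \<le> len (inv (wprod ws)) + len (inv s)"
      using c by (intro len_mult) auto
    ultimately show ?case using Cons by simp
  qed simp
  then show ?thesis using len_word[OF assms] by metis
qed

lemma len_inv [simp]: "g \<in> carrier G \<Longrightarrow> len (inv g) = len g"
  using len_inv_le[of g] len_inv_le[of "inv g"] by simp

text \<open>A shortest word is cut after \<open>m\<close> letters. Neither part can be replaced by a
  shorter word, since their lengths add up to \<open>len g\<close>.\<close>

lemma len_split:
  assumes "g \<in> carrier G" "len g = m + n"
  shows "\<exists>a\<in>carrier G. \<exists>b\<in>carrier G. g = a \<otimes> b \<and> len a = m \<and> len b = n"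
proof -
  obtain ws where ws: "length ws = len g" "set ws \<subseteq> S" "wprod ws = g" using len_word assms by blast
  define us where "us = take m ws"
  define vs where "vs = drop m ws"
  have s: "ws = us @ vs" "length us = m" "length vs = n" using ws assms by (auto simp: us_def vs_def)
  have S: "set us \<subseteq> S" "set vs \<subseteq> S" using s(1) ws(2) by auto
  then have c: "set us \<subseteq> carrier G" "set vs \<subseteq> carrier G" using S_carrier by auto
  have p: "g = wprod us \<otimes> wprod vs" using wprod_append[OF c] ws(3) s(1) by simp
  have "len g \<le> len (wprod us) + len (wprod vs)" using len_mult c p by simp
  then have "len (wprod us) = m" "len (wprod vs) = n"
    using len_le[OF S(1)] len_le[OF S(2)] s assms(2) by auto
  then show ?thesis using p c wprod_closed by blast
qed

lemma finite_ball: "finite {g \<in> carrier G. len g \<le> N}"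
proof (rule finite_subset)
  show "finite (wprod ` {ws. set ws \<subseteq> S \<and> length ws \<le> N})"
    using finite_lists_length_le[OF finite_S] by simp
  show "{g \<in> carrier G. len g \<le> N} \<subseteq> wprod ` {ws. set ws \<subseteq> S \<and> length ws \<le> N}"
    using len_word by (smt (verit, best) image_eqI mem_Collect_eq subsetI)
qed

lemma long_elements:
  assumes "infinite (carrier G)"
  shows "\<exists>g\<in>carrier G. len g = n"
proof -
  have "\<not> carrier G \<subseteq> {g \<in> carrier G. len g \<le> n}" using assms finite_ball finite_subset by blast
  then obtain g where g: "g \<in> carrier G" "len g > n" using not_le by blast
  then show ?thesis using len_split[of g n "len g - n"] by auto
qed

section \<open>Gromov products based at the identity\<close>

abbreviation gp where "gp x y \<equiv> gromov_product G S \<one> x y"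

lemma gp_eq: "x \<in> carrier G \<Longrightarrow> y \<in> carrier G \<Longrightarrow>
    gp x y = (real (len x) + real (len y) - real (len (inv x \<otimes> y))) / 2"
  unfolding gromov_product_def word_dist_def by simp

lemma gp_commute:
  assumes "x \<in> carrier G" "y \<in> carrier G"
  shows "gp x y = gp y x"
proof -
  have "inv (inv x \<otimes> y) = inv y \<otimes> x" using assms by (simp add: inv_mult_group)
  then have "len (inv y \<otimes> x) = len (inv x \<otimes> y)" using assms len_inv[of "inv x \<otimes> y"] by simp
  then show ?thesis using assms by (simp add: gp_eq)
qed

lemma len_inv_mult_ge:
  assumes "x \<in> carrier G" "y \<in> carrier G"
  shows "len x \<le> len (inv x \<otimes> y) + len y" "len y \<le> len (inv x \<otimes> y) + len x"
proof -
  have e: "x = y \<otimes> inv (inv x \<otimes> y)" "y = x \<otimes> (inv x \<otimes> y)"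
    using assms by (simp_all add: inv_mult_group m_assoc[symmetric])
  show "len x \<le> len (inv x \<otimes> y) + len y"
    using len_mult[of y "inv (inv x \<otimes> y)"] assms by (metis add.commute e(1) inv_closed len_inv m_closed)
  show "len y \<le> len (inv x \<otimes> y) + len x"
    using len_mult[of x "inv x \<otimes> y"] assms e(2) by (simp add: m_assoc[symmetric])
qed

lemma mult_inv_cancel [simp]:
  assumes "a \<in> carrier G" "b \<in> carrier G"
  shows "a \<otimes> (inv a \<otimes> b) = b" "inv a \<otimes> (a \<otimes> b) = b"
  using assms by (simp_all add: m_assoc[symmetric])

lemma gp_le:
  assumes "x \<in> carrier G" "y \<in> carrier G"
  shows "gp x y \<le> len x" "gp x y \<le> len y"
  using len_inv_mult_ge[OF assms] gp_eq[OF assms] by auto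

text \<open>Translation by \<open>h\<close> is an isometry that moves the base point by
  \<open>len h\<close>, so each of the two distances to the base point drops by at most that
  much.\<close>

lemma gp_translate:
  assumes "h \<in> carrier G" "x \<in> carrier G" "y \<in> carrier G"
  shows "gp (h \<otimes> x) (h \<otimes> y) \<ge> gp x y - len h"
proof -
  have "inv (h \<otimes> x) \<otimes> (h \<otimes> y) = inv x \<otimes> y"
    using assms by (simp add: inv_mult_group m_assoc)
  moreover have "len x \<le> len h + len (h \<otimes> x)" "len y \<le> len h + len (h \<otimes> y)"
    using len_mult[of "inv h" "h \<otimes> x"] len_mult[of "inv h" "h \<otimes> y"] assms
    by (simp_all add: m_assoc[symmetric])
  ultimately show ?thesis using assms by (simp add: gp_eq field_simps)
qed

lemma gp_mult_right_le:
  assumes "h \<in> carrier G" "x \<in> carrier G" "y \<in> carrier G"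
  shows "gp (x \<otimes> h) y \<le> gp x y + len h"
proof -
  have e: "inv (x \<otimes> h) \<otimes> y = inv h \<otimes> (inv x \<otimes> y)"
    using assms by (simp add: inv_mult_group m_assoc)
  have "inv x \<otimes> y = h \<otimes> (inv h \<otimes> (inv x \<otimes> y))"
    using assms by (simp add: m_assoc[symmetric])
  then have "len (inv x \<otimes> y) \<le> len h + len (inv h \<otimes> (inv x \<otimes> y))"
    using len_mult[of h "inv h \<otimes> (inv x \<otimes> y)"] assms by simp
  moreover have "len (x \<otimes> h) \<le> len x + len h" using len_mult assms by simp
  ultimately show ?thesis
    using assms e by (simp add: gp_eq field_simps)
qed

lemma inv_pow_mult_pow:
  assumes "f \<in> carrier G" "i \<le> j"
  shows "inv (f [^] (i::nat)) \<otimes> f [^] j = f [^] (j - i)"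
proof -
  have "f [^] j = f [^] i \<otimes> f [^] (j - i)" using assms by (simp add: nat_pow_mult)
  then show ?thesis using assms by (simp add: m_assoc[symmetric])
qed

end

locale hyperbolic_group = word_metric_group +
  fixes \<delta> :: real
  assumes delta_nonneg: "\<delta> \<ge> 0"
    and hyp: "\<And>x y z. x \<in> carrier G \<Longrightarrow> y \<in> carrier G \<Longrightarrow> z \<in> carrier G \<Longrightarrow>
      gp x y \<ge> min (gp x z) (gp z y) - \<delta>"
begin

section \<open>Cone types and an element with geodesic powers\<close>

definition cone where "cone g = {h \<in> carrier G. len (g \<otimes> h) = len g + len h}"

text \<open>Cannon's argument: the differences \<open>|g t| - |g|\<close> on a ball of radius \<open>1 + 2 \<delta>\<close> determine the
  cone type, so a long geodesic word has two prefixes of the same cone type, and the subword \<open>s\<close>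
  between them can be repeated arbitrarily often.\<close>

lemma cone_subset_cone:
  assumes g: "g \<in> carrier G" "g' \<in> carrier G"
    and type: "\<And>t. t \<in> carrier G \<Longrightarrow> real (len t) \<le> 1 + 2 * \<delta> \<Longrightarrow>
      int (len (g \<otimes> t)) - int (len g) = int (len (g' \<otimes> t)) - int (len g')"
  shows "cone g \<subseteq> cone g'"
proof -
  have "h \<in> carrier G \<Longrightarrow> len h = n \<Longrightarrow> h \<in> cone g \<Longrightarrow> h \<in> cone g'" for h n
  proof (induction n arbitrary: h)
    case 0
    then show ?case using g len_eq_0[of h] by (simp add: cone_def)
  next
    case (Suc n k)
    obtain h s where k: "k = h \<otimes> s" and hs: "h \<in> carrier G" "s \<in> carrier G" "len h = n" "len s = 1"
      using len_split[of k n 1] Suc.prems by auto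
    have "len (g \<otimes> k) \<le> len (g \<otimes> h) + 1"
      using len_mult[of "g \<otimes> h" s] hs g k by (simp add: m_assoc)
    moreover have "len (g \<otimes> h) \<le> len g + len h" using len_mult[OF g(1) hs(1)] .
    ultimately have "h \<in> cone g" using Suc.prems hs by (simp add: cone_def)
    then have h': "len (g' \<otimes> h) = len g' + n" using Suc.IH[of h] hs by (simp add: cone_def)
    have "\<not> len (g' \<otimes> k) \<le> len g' + n"
    proof
      assume le: "len (g' \<otimes> k) \<le> len g' + n"
      have ge: "len g' + n \<le> len (g' \<otimes> k) + 1"
        using len_mult[of "g' \<otimes> k" "inv s"] hs g k h' by (simp add: m_assoc)
      have pos: "len g' \<ge> 1"
      proof (rule ccontr)
        assume "\<not> len g' \<ge> 1"
        then have "g' = \<one>" using len_eq_0 g by simp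
        then show False using le Suc.prems by simp
      qed
      \<comment> \<open>\<open>u\<close> is the point at distance \<open>len g' - 1\<close> from
        \<open>\<one>\<close> on a geodesic to \<open>g' \<otimes> k\<close>. Because that product
        is too short, hyperbolicity forces \<open>u\<close> to lie within
        \<open>1 + 2 * \<delta>\<close> of \<open>g'\<close>, so the displacement \<open>t\<close>
        is seen by the type.\<close>
      obtain u v where u: "u \<in> carrier G" "v \<in> carrier G" "g' \<otimes> k = u \<otimes> v" "len u = len g' - 1"
          "len v = len (g' \<otimes> k) - (len g' - 1)"
        using len_split[of "g' \<otimes> k" "len g' - 1" "len (g' \<otimes> k) - (len g' - 1)"] g hs k ge by force
      define t where "t = inv g' \<otimes> u"
      have tc: "t \<in> carrier G" using u g t_def by simp
      have kc: "k \<in> carrier G" using hs k by simp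
      have "gp g' (g' \<otimes> k) \<ge> real (len g') - 1"
        using gp_eq[of g' "g' \<otimes> k"] g kc ge Suc.prems by (simp add: m_assoc[symmetric])
      moreover have "gp (g' \<otimes> k) u = len u"
      proof -
        have "inv u \<otimes> (g' \<otimes> k) = v" using u by (simp add: m_assoc[symmetric])
        moreover have "len v + len u = len (g' \<otimes> k)" using u ge by auto
        ultimately show ?thesis using gp_eq[of u "g' \<otimes> k"] gp_commute[of u "g' \<otimes> k"] u g kc by simp
      qed
      moreover have "real (len u) = real (len g') - 1" using u pos by simp
      ultimately have "gp g' u \<ge> real (len g') - 1 - \<delta>"
        using hyp[of g' u "g' \<otimes> k"] g u kc by auto
      then have "real (len t) \<le> 1 + 2 * \<delta>"
        using gp_eq[of g' u] g u \<open>real (len u) = real (len g') - 1\<close> by (simp add: t_def)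
      \<comment> \<open>The drop in length is copied to \<open>g\<close>: now
        \<open>g \<otimes> t\<close> has length \<open>len g - 1\<close> and \<open>v\<close> has
        length at most \<open>n + 1\<close>, so \<open>g \<otimes> k\<close> falls short of
        \<open>len g + len k\<close>.\<close>
      from type[OF tc this] have "int (len (g \<otimes> t)) = int (len g) - 1"
        using u g pos by (simp add: t_def m_assoc[symmetric])
      moreover have "g \<otimes> k = (g \<otimes> t) \<otimes> v"
      proof -
        have "k = inv g' \<otimes> (g' \<otimes> k)" using g kc by (simp add: m_assoc[symmetric])
        also have "\<dots> = t \<otimes> v" using u g by (simp add: t_def m_assoc)
        finally show ?thesis using g tc u by (simp add: m_assoc)
      qed
      ultimately have "int (len (g \<otimes> k)) \<le> int (len g) - 1 + int (len v)"
        using len_mult[of "g \<otimes> t" v] g tc u by simp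
      then show False using Suc.prems u le pos by (simp add: cone_def)
    qed
    moreover have "len (g' \<otimes> k) \<le> len g' + len k" using len_mult[OF g(2) Suc.prems(1)] .
    ultimately show ?case using Suc.prems by (simp add: cone_def)
  qed
  then show ?thesis by (auto simp: cone_def)
qed

lemma exists_periodic_geodesic:
  assumes inf: "infinite (carrier G)"
  shows "\<exists>s\<in>carrier G. len s \<ge> 1 \<and> (\<forall>k::nat. len (s [^] k) = k * len s)"
proof -
  define N where "N = nat \<lfloor>1 + 2 * \<delta>\<rfloor>"
  define B where "B = {t \<in> carrier G. len t \<le> N}"
  have BI: "t \<in> B" if "t \<in> carrier G" "real (len t) \<le> 1 + 2 * \<delta>" for t
    using that le_nat_floor[of "len t" "1 + 2 * \<delta>"] unfolding B_def N_def by blast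
  define T where "T = B \<rightarrow>\<^sub>E {- int N..int N}"
  define type where "type g = restrict (\<lambda>t. int (len (g \<otimes> t)) - int (len g)) B" for g
  have "finite T" unfolding T_def using finite_ball by (intro finite_PiE) (auto simp: B_def)
  have typeT: "type g \<in> T" if g: "g \<in> carrier G" for g
  proof -
    have "int (len (g \<otimes> t)) - int (len g) \<in> {- int N..int N}" if "t \<in> B" for t
    proof -
      have t: "t \<in> carrier G" "len t \<le> N" using that by (auto simp: B_def)
      show ?thesis using len_mult[of g t] len_mult[of "g \<otimes> t" "inv t"] t g by (simp add: m_assoc)
    qed
    then show ?thesis by (auto simp: T_def type_def)
  qed
  \<comment> \<open>Prefixes of lengths \<open>0\<close> to \<open>M\<close> outnumber the types in
    \<open>T\<close>, so two of them share a type.\<close>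
  define M where "M = card T + 1"
  obtain g where g: "g \<in> carrier G" "len g = M" using long_elements[OF inf] by blast
  obtain ws where ws: "length ws = M" "set ws \<subseteq> S" "wprod ws = g" using len_word[OF g(1)] g by auto
  define pre where "pre i = wprod (take i ws)" for i
  have tc: "set (take i ws) \<subseteq> S" "set (drop i ws) \<subseteq> S" for i
    using ws(2) set_take_subset set_drop_subset by fast+
  have prec: "pre i \<in> carrier G" for i unfolding pre_def using tc S_carrier by (metis order_trans wprod_closed)
  have len_pre: "len (pre i) = i" if "i \<le> M" for i
  proof -
    have "g = pre i \<otimes> wprod (drop i ws)"
      using wprod_append[of "take i ws" "drop i ws"] tc S_carrier ws(3) unfolding pre_def
      by (metis append_take_drop_id order_trans)
    moreover have "wprod (drop i ws) \<in> carrier G" using tc S_carrier by (metis order_trans wprod_closed)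
    ultimately have "M \<le> len (pre i) + len (wprod (drop i ws))" using len_mult prec g by metis
    then show ?thesis using len_le[OF tc(1)[of i]] len_le[OF tc(2)[of i]] that ws(1) by (simp add: pre_def)
  qed
  have "\<not> inj_on (\<lambda>i. type (pre i)) {..M}"
  proof
    assume "inj_on (\<lambda>i. type (pre i)) {..M}"
    then have "card {..M} \<le> card T"
      using \<open>finite T\<close> prec typeT by (intro card_inj_on_le[of "\<lambda>i. type (pre i)"]) auto
    then show False by (simp add: M_def)
  qed
  then obtain i j where ij: "i < j" "j \<le> M" "type (pre i) = type (pre j)"
    by (metis (no_types, lifting) atMost_iff inj_onI linorder_neqE_nat)
  define s where "s = inv (pre i) \<otimes> pre j"
  have sc: "s \<in> carrier G" using prec by (simp add: s_def)
  have pj: "pre j = pre i \<otimes> s" using prec by (simp add: s_def m_assoc[symmetric])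
  have ls: "len s \<le> j - i"
  proof -
    define mid where "mid = drop i (take j ws)"
    have "take j ws = take i ws @ mid" using ij by (metis append_take_drop_id less_imp_le mid_def min.absorb1 take_take)
    moreover have mS: "set mid \<subseteq> S" using tc(1)[of j] set_drop_subset unfolding mid_def by fast
    ultimately have "pre j = pre i \<otimes> wprod mid"
      using wprod_append[of "take i ws" mid] tc(1)[of i] S_carrier unfolding pre_def by auto
    then have "s = wprod mid" using prec mS S_carrier by (simp add: s_def m_assoc[symmetric] subset_trans)
    then show ?thesis using len_le[OF mS] ij ws(1) by (simp add: mid_def)
  qed
  have lsj: "len s = j - i"
    using ls len_mult[OF prec[of i] sc] pj len_pre[of i] len_pre[of j] ij by simp
  have cones: "cone (pre i) \<subseteq> cone (pre j)"
  proof (rule cone_subset_cone[OF prec prec])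
    fix t assume "t \<in> carrier G" "real (len t) \<le> 1 + 2 * \<delta>"
    then show "int (len (pre i \<otimes> t)) - int (len (pre i)) = int (len (pre j \<otimes> t)) - int (len (pre j))"
      using BI[of t] fun_cong[OF ij(3), of t] by (simp add: type_def)
  qed
  \<comment> \<open>Membership passes from the cone of \<open>pre i\<close> to that of
    \<open>pre j = pre i \<otimes> s\<close>, so \<open>pre i \<otimes> s [^] Suc k\<close> has
    length \<open>j + k * len s\<close>. Removing \<open>pre i\<close> costs at most
    \<open>i\<close>, which leaves the full length \<open>Suc k * len s\<close>.\<close>
  have "s [^] k \<in> cone (pre i) \<and> len (s [^] k) = k * len s" for k :: nat
  proof (induction k)
    case 0
    then show ?case using prec by (simp add: cone_def)
  next
    case (Suc k)
    have kc: "s [^] k \<in> carrier G" using sc by simp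
    have e: "s [^] Suc k = s \<otimes> s [^] k" using sc nat_pow_mult[of s 1 k] by simp
    have "s [^] k \<in> cone (pre j)" using Suc cones by auto
    then have a: "len (pre i \<otimes> (s \<otimes> s [^] k)) = j + k * len s"
      using Suc len_pre[of j] ij pj prec sc kc by (simp add: cone_def m_assoc)
    moreover have "len (pre i \<otimes> (s \<otimes> s [^] k)) \<le> i + len (s \<otimes> s [^] k)"
      using len_mult[of "pre i" "s \<otimes> s [^] k"] len_pre[of i] ij prec sc kc by simp
    moreover have "len (s \<otimes> s [^] k) \<le> len s + k * len s"
      using len_mult[OF sc kc] Suc by simp
    ultimately have "len (s \<otimes> s [^] k) = len s + k * len s" using lsj ij by simp
    then show ?case using a e lsj ij len_pre[of i] sc kc unfolding cone_def by simp
  qed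
  moreover have "len s \<ge> 1" using lsj ij by simp
  ultimately show ?thesis using sc by blast
qed

text \<open>For \<open>good f K\<close> the powers of \<open>f\<close> form a quasi-geodesic:
  \<open>(1 | f\<^sup>j)\<close> based at \<open>f\<^sup>i\<close> is at most \<open>K / 2\<close>.\<close>

definition good :: "'a \<Rightarrow> real \<Rightarrow> bool" where
  "good f K \<longleftrightarrow> f \<in> carrier G \<and>
     (\<forall>i j. i \<le> j \<longrightarrow> real (len (f [^] (i::nat))) + len (f [^] (j - i)) \<le> real (len (f [^] j)) + K) \<and>
     (\<forall>C. \<exists>i::nat. real (len (f [^] i)) \<ge> C)"

lemma good_periodic_geodesic:
  assumes "s \<in> carrier G" "len s \<ge> 1" "\<And>k::nat. len (s [^] k) = k * len s"
  shows "good s 0"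
proof -
  have "\<exists>i::nat. real (i * len s) \<ge> C" for C
  proof -
    obtain i :: nat where "C \<le> i" using real_arch_simple by blast
    moreover have "i \<le> i * len s" using assms(2) by simp
    ultimately have "C \<le> real (i * len s)" using of_nat_mono[of i "i * len s", where 'a=real] by linarith
    then show ?thesis by blast
  qed
  moreover have "i * len s + (j - i) * len s = j * len s" if "i \<le> j" for i j :: nat
    using that by (simp add: add_mult_distrib[symmetric])
  ultimately show ?thesis using assms unfolding good_def
    by (metis add.right_neutral of_nat_add order_refl)
qed

text \<open>A local-to-global principle: the path through the powers of \<open>f\<close> has the
  same corner at every point, measured by \<open>gp (inv f) f\<close>. When the step
  \<open>len f\<close> is long compared with this corner, the four-point inequality carries the
  bound from one corner to arbitrarily long pieces.\<close>

lemma good_local: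
  assumes f: "f \<in> carrier G" and a: "gp (inv f) f \<le> a" and big: "real (len f) > 2 * a + 3 * \<delta>"
  shows "good f (2 * a + 4 * \<delta>)"
proof -
  have a0: "a \<ge> 0"
  proof -
    have "gp (inv f) f = (2 * real (len f) - real (len (f \<otimes> f))) / 2" using gp_eq[of "inv f" f] f by simp
    moreover have "real (len (f \<otimes> f)) \<le> 2 * real (len f)" using len_mult[OF f f] by simp
    ultimately have "gp (inv f) f \<ge> 0" by simp
    then show ?thesis using a by (rule order_trans)
  qed
  define l where "l n = real (len (f [^] (n::nat)))" for n
  have P1: "gp (inv (f [^] n)) f = (l n + real (len f) - l (Suc n)) / 2" for n
    using gp_eq[of "inv (f [^] n)" f] f by (simp add: l_def)
  have P2: "gp (inv f) (inv (f [^] Suc n)) = (real (len f) + l (Suc n) - l n) / 2" for n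
  proof -
    have "f \<otimes> inv (f [^] Suc n) = inv (f [^] n)"
    proof -
      have e: "f [^] Suc n = f [^] n \<otimes> f" by simp
      show ?thesis unfolding e using f by (subst inv_mult_group) (auto simp: m_assoc[symmetric])
    qed
    then show ?thesis using gp_eq[of "inv f" "inv (f [^] Suc n)"] f by (simp add: l_def del: nat_pow_Suc)
  qed
  \<comment> \<open>By induction \<open>inv f\<close> and \<open>inv (f [^] Suc n)\<close> have a
    product above \<open>a + \<delta>\<close>. As \<open>gp (inv f) f\<close> is at most
    \<open>a\<close>, the corner between \<open>inv (f [^] Suc n)\<close> and \<open>f\<close> is at
    most \<open>a + \<delta>\<close>.\<close>
  have step: "l (Suc n) \<ge> l n + len f - 2 * (a + \<delta>)" for n
  proof (induction n)
    case 0
    show ?case using a0 delta_nonneg f by (simp add: l_def)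
  next
    case (Suc n)
    have "gp (inv f) f \<ge> min (gp (inv f) (inv (f [^] Suc n))) (gp (inv (f [^] Suc n)) f) - \<delta>"
      using f by (intro hyp) auto
    moreover have "gp (inv f) (inv (f [^] Suc n)) > a + \<delta>" unfolding P2 using Suc.IH big delta_nonneg by (simp add: field_simps)
    ultimately have "gp (inv (f [^] Suc n)) f \<le> a + \<delta>" using a by linarith
    then show ?case using P1[of "Suc n"] by simp
  qed
  have main: "l i + l (j - i) \<le> l j + (2 * a + 4 * \<delta>)" if ij: "i \<le> j" for i j
  proof (cases "i = j")
    case True
    then show ?thesis using a0 delta_nonneg by (simp add: l_def)
  next
    case False
    define r where "r = j - i - 1"
    have r: "j - i = Suc r" "j = i + Suc r" using False ij by (auto simp: r_def)
    have c: "inv (f [^] i) \<in> carrier G" "f [^] Suc r \<in> carrier G" using f by (auto simp del: nat_pow_Suc)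
    \<comment> \<open>\<open>f [^] Suc r\<close> starts along \<open>f\<close> with a product above
      \<open>a + 2 * \<delta>\<close>; this uses the \<open>3 * \<delta>\<close> in
      \<open>big\<close>. So the other term of the minimum is at most
      \<open>a + 2 * \<delta>\<close>, and twice this bound is the constant in the claim.\<close>
    have "gp (inv (f [^] i)) f \<ge> min (gp (inv (f [^] i)) (f [^] Suc r)) (gp (f [^] Suc r) f) - \<delta>"
      using f by (intro hyp) auto
    moreover have "gp (inv (f [^] i)) f \<le> a + \<delta>" using P1[of i] step[of i] by simp
    moreover have "gp (f [^] Suc r) f = (real (len f) + l (Suc r) - l r) / 2"
    proof -
      have "inv f \<otimes> f [^] Suc r = f [^] r" using inv_pow_mult_pow[OF f, of 1 "Suc r"] f by simp
      then show ?thesis using gp_commute[OF c(2) f] gp_eq[OF f c(2)] by (simp add: l_def)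
    qed
    ultimately have "gp (inv (f [^] i)) (f [^] Suc r) \<le> a + 2 * \<delta>"
      using step[of r] big by (simp add: min_def split: if_splits)
    moreover have "gp (inv (f [^] i)) (f [^] Suc r) = (l i + l (Suc r) - l j) / 2"
      using gp_eq[OF c] f nat_pow_mult[OF f, of i "Suc r"] by (simp add: l_def r(2))
    ultimately show ?thesis using r by simp
  qed
  have "\<exists>i. l i \<ge> C" for C
  proof -
    define e where "e = len f - 2 * (a + \<delta>)"
    have e: "e > 0" using big a0 delta_nonneg by (simp add: e_def)
    have ge: "l n \<ge> n * e" for n
    proof (induction n)
      case (Suc n)
      then show ?case using step[of n] by (simp add: e_def algebra_simps)
    qed (simp add: l_def)
    obtain n :: nat where "C / e \<le> n" using real_arch_simple by blast
    then have "C \<le> n * e" using e by (simp add: field_simps)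
    then show ?thesis using ge[of n] by (intro exI[of _ n]) simp
  qed
  then show ?thesis using main f unfolding good_def l_def by blast
qed

lemma good_carrier: "good f K \<Longrightarrow> f \<in> carrier G"
  by (simp add: good_def)

lemma inv_nat_pow: "f \<in> carrier G \<Longrightarrow> inv f [^] (n::nat) = inv (f [^] n)"
  by (simp add: nat_pow_inv)

lemma good_inv: "good f K \<Longrightarrow> good (inv f) K"
  unfolding good_def by (simp add: inv_nat_pow)

lemma good_gp:
  assumes "good f K" "i \<le> j"
  shows "gp (f [^] (i::nat)) (f [^] j) \<ge> len (f [^] i) - K / 2"
proof -
  have f: "f \<in> carrier G" using assms good_carrier by blast
  have "real (len (f [^] i)) + len (f [^] (j - i)) \<le> len (f [^] j) + K" using assms unfolding good_def by blast
  then show ?thesis using gp_eq[of "f [^] i" "f [^] j"] inv_pow_mult_pow[OF f assms(2)] f by (simp add: field_simps)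
qed

lemma good_K_nonneg: assumes "good f K" shows "K \<ge> 0"
proof -
  have "\<And>i j. i \<le> j \<Longrightarrow> real (len (f [^] (i::nat))) + len (f [^] (j - i)) \<le> len (f [^] j) + K"
    using assms unfolding good_def by blast
  from this[of 0 0] show ?thesis by simp
qed

lemma good_len_tendsto:
  assumes "good f K"
  shows "\<exists>N::nat. \<forall>n\<ge>N. real (len (f [^] n)) \<ge> C"
proof -
  obtain N :: nat where N: "real (len (f [^] N)) \<ge> C + K" using assms unfolding good_def by blast
  have "real (len (f [^] n)) \<ge> C" if "n \<ge> N" for n
  proof -
    have "real (len (f [^] N)) + len (f [^] (n - N)) \<le> len (f [^] n) + K"
      using assms that unfolding good_def by blast
    then show ?thesis using N by linarith
  qed
  then show ?thesis by blast
qed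

lemma good_opposite_gp:
  assumes "good f K"
  shows "gp (inv (f [^] (i::nat))) (f [^] (j::nat)) \<le> K / 2"
proof -
  have f: "f \<in> carrier G" using assms good_carrier by blast
  have "real (len (f [^] i)) + len (f [^] (i + j - i)) \<le> len (f [^] (i + j)) + K"
    using assms unfolding good_def by (meson le_add1)
  then show ?thesis using gp_eq[of "inv (f [^] i)" "f [^] j"] f by (simp add: nat_pow_mult)
qed


subsection \<open>The action on the boundary\<close>

lemma asymptotic_iff:
  "asymptotic G S s t \<longleftrightarrow> (\<forall>C. \<exists>N. \<forall>i\<ge>N. \<forall>j\<ge>N. gp (s i) (t j) \<ge> C)"
  unfolding asymptotic_def filterlim_at_top eventually_prod_sequentially by (auto; blast)

lemma asymptotic_sym:
  assumes "range s \<subseteq> carrier G" "range t \<subseteq> carrier G" "asymptotic G S s t"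
  shows "asymptotic G S t s"
proof -
  have "gp (s i) (t j) = gp (t j) (s i)" for i j using assms gp_commute by (simp add: range_subsetD)
  then show ?thesis using assms(3) unfolding asymptotic_iff by metis
qed

lemma asymptotic_trans:
  assumes r: "range s \<subseteq> carrier G" "range t \<subseteq> carrier G" "range u \<subseteq> carrier G"
    and a: "asymptotic G S s t" "asymptotic G S t u"
  shows "asymptotic G S s u"
  unfolding asymptotic_iff
proof
  fix C :: real
  obtain N where N: "\<And>i j. i \<ge> N \<Longrightarrow> j \<ge> N \<Longrightarrow> gp (s i) (t j) \<ge> C + \<delta>"
    using a(1) unfolding asymptotic_iff by blast
  obtain M where M: "\<And>i j. i \<ge> M \<Longrightarrow> j \<ge> M \<Longrightarrow> gp (t i) (u j) \<ge> C + \<delta>"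
    using a(2) unfolding asymptotic_iff by blast
  have "gp (s i) (u j) \<ge> C" if "i \<ge> max N M" "j \<ge> max N M" for i j
  proof -
    have "gp (s i) (u j) \<ge> min (gp (s i) (t (max N M))) (gp (t (max N M)) (u j)) - \<delta>"
      using r by (intro hyp) auto
    then show ?thesis using N[of i "max N M"] M[of "max N M" j] that by auto
  qed
  then show "\<exists>N. \<forall>i\<ge>N. \<forall>j\<ge>N. gp (s i) (u j) \<ge> C" by blast
qed

abbreviation "seqs \<equiv> sequences_to_infinity G S"
abbreviation "bd \<equiv> gromov_boundary G S"

definition cls where
  "cls s = {(s, t). s \<in> seqs \<and> t \<in> seqs \<and> asymptotic G S s t} `` {s}"

lemma seqs_range: "s \<in> seqs \<Longrightarrow> range s \<subseteq> carrier G" and seqs_carrier: "s \<in> seqs \<Longrightarrow> s n \<in> carrier G"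
  by (auto simp: sequences_to_infinity_def)

lemma cls_iff: "s \<in> seqs \<Longrightarrow> t \<in> cls s \<longleftrightarrow> t \<in> seqs \<and> asymptotic G S s t"
  by (auto simp: cls_def)

lemma cls_self: "s \<in> seqs \<Longrightarrow> s \<in> cls s"
  by (simp add: cls_iff sequences_to_infinity_def)

lemma bd_iff: "x \<in> bd \<longleftrightarrow> (\<exists>s\<in>seqs. x = cls s)"
  unfolding gromov_boundary_def cls_def by (auto simp: quotient_def)

lemma cls_eq_iff:
  assumes "s \<in> seqs" "t \<in> seqs"
  shows "cls s = cls t \<longleftrightarrow> asymptotic G S s t"
proof
  assume "cls s = cls t"
  then show "asymptotic G S s t" using cls_self[OF assms(2)] cls_iff[OF assms(1)] by auto
next
  assume a: "asymptotic G S s t"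
  note r = seqs_range
  have "u \<in> cls s \<longleftrightarrow> u \<in> cls t" for u
    using a assms cls_iff asymptotic_trans asymptotic_sym r by meson
  then show "cls s = cls t" by blast
qed

lemma translate_asymptotic:
  assumes h: "h \<in> carrier G" and r: "range s \<subseteq> carrier G" "range t \<subseteq> carrier G"
    and a: "asymptotic G S s t"
  shows "asymptotic G S (\<lambda>n. h \<otimes> s n) (\<lambda>n. h \<otimes> t n)"
  unfolding asymptotic_iff
proof
  fix C :: real
  obtain N where N: "\<And>i j. i \<ge> N \<Longrightarrow> j \<ge> N \<Longrightarrow> gp (s i) (t j) \<ge> C + len h"
    using a unfolding asymptotic_iff by blast
  have "gp (h \<otimes> s i) (h \<otimes> t j) \<ge> C" if "i \<ge> N" "j \<ge> N" for i j
    using gp_translate[OF h, of "s i" "t j"] N[OF that] r by (auto simp: range_subsetD)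
  then show "\<exists>N. \<forall>i\<ge>N. \<forall>j\<ge>N. gp (h \<otimes> s i) (h \<otimes> t j) \<ge> C" by blast
qed

lemma translate_seqs: "h \<in> carrier G \<Longrightarrow> s \<in> seqs \<Longrightarrow> (\<lambda>n. h \<otimes> s n) \<in> seqs"
  using translate_asymptotic[of h s s] by (auto simp: sequences_to_infinity_def)

text \<open>The image of a class is a full class and not merely part of one, because
  \<open>inv h\<close> carries every sequence asymptotic to the translate back into the original
  class.\<close>

lemma boundary_act_cls:
  assumes h: "h \<in> carrier G" and s: "s \<in> seqs"
  shows "boundary_act G h (cls s) = cls (\<lambda>n. h \<otimes> s n)"
proof (intro equalityI subsetI)
  fix t assume "t \<in> boundary_act G h (cls s)"
  then obtain u where u: "t = (\<lambda>n. h \<otimes> u n)" "u \<in> seqs" "asymptotic G S s u"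
    unfolding boundary_act_def using cls_iff[OF s] by auto
  then show "t \<in> cls (\<lambda>n. h \<otimes> s n)"
    using cls_iff[OF translate_seqs[OF h s]] translate_asymptotic[OF h] translate_seqs[OF h] s seqs_range
    by simp
next
  fix t assume "t \<in> cls (\<lambda>n. h \<otimes> s n)"
  then have t: "t \<in> seqs" "asymptotic G S (\<lambda>n. h \<otimes> s n) t"
    using cls_iff[OF translate_seqs[OF h s]] by auto
  define u where "u n = inv h \<otimes> t n" for n
  have c: "s n \<in> carrier G" "t n \<in> carrier G" for n using s t seqs_carrier by auto
  have u: "u \<in> seqs" unfolding u_def using translate_seqs[of "inv h" t] h t by simp
  have "asymptotic G S (\<lambda>n. inv h \<otimes> (h \<otimes> s n)) (\<lambda>n. inv h \<otimes> t n)"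
    using translate_asymptotic[of "inv h" "\<lambda>n. h \<otimes> s n" t] t h translate_seqs[OF h s] seqs_range by blast
  then have "asymptotic G S s u" using h c by (simp add: u_def[abs_def])
  then have "u \<in> cls s" using cls_iff[OF s] u by simp
  moreover have "t = (\<lambda>n. h \<otimes> u n)" using h c by (simp add: u_def)
  ultimately show "t \<in> boundary_act G h (cls s)" unfolding boundary_act_def by blast
qed

lemma boundary_act_bd: "h \<in> carrier G \<Longrightarrow> x \<in> bd \<Longrightarrow> boundary_act G h x \<in> bd"
  using bd_iff boundary_act_cls translate_seqs by metis

lemma boundary_act_mult:
  assumes "h \<in> carrier G" "k \<in> carrier G" "x \<in> bd"
  shows "boundary_act G (h \<otimes> k) x = boundary_act G h (boundary_act G k x)"
proof -
  obtain s where s: "s \<in> seqs" "x = cls s" using assms bd_iff by auto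
  have "(\<lambda>n. h \<otimes> k \<otimes> s n) = (\<lambda>n. h \<otimes> (k \<otimes> s n))" using assms s seqs_carrier by (simp add: m_assoc)
  then show ?thesis using s assms translate_seqs by (simp add: boundary_act_cls)
qed

lemma boundary_act_one: "x \<in> bd \<Longrightarrow> boundary_act G \<one> x = x"
  using bd_iff[of x] boundary_act_cls[of \<one>] seqs_carrier by fastforce

lemma boundary_act_eq_iff:
  assumes "h \<in> carrier G" "x \<in> bd" "y \<in> bd"
  shows "boundary_act G h x = y \<longleftrightarrow> x = boundary_act G (inv h) y"
  using assms boundary_act_mult[of h "inv h" y] boundary_act_mult[of "inv h" h x] boundary_act_one
  by auto

text \<open>This is the point \<open>g\<^sub>+\<close> of the overview, and
  \<open>endpoint (inv g)\<close> is \<open>g\<^sub>-\<close>. It is a boundary point when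
  \<open>f\<close> is \<open>good\<close>.\<close>

definition endpoint where "endpoint f = cls (\<lambda>n. f [^] (n::nat))"

lemma good_seqs:
  assumes "good f K"
  shows "(\<lambda>n. f [^] (n::nat)) \<in> seqs"
proof -
  have f: "f \<in> carrier G" using assms good_carrier by blast
  have "\<exists>N::nat. \<forall>i\<ge>N. \<forall>j\<ge>N. gp (f [^] i) (f [^] j) \<ge> C" for C
  proof -
    obtain N :: nat where N: "\<And>n. n \<ge> N \<Longrightarrow> real (len (f [^] n)) \<ge> C + K / 2"
      using good_len_tendsto[OF assms] by blast
    have "gp (f [^] i) (f [^] j) \<ge> C" if "i \<ge> N" "j \<ge> N" for i j
    proof (cases "i \<le> j")
      case True
      then show ?thesis using good_gp[OF assms, of i j] N[of i] that by simp
    next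
      case False
      then show ?thesis using good_gp[OF assms, of j i] N[of j] that gp_commute[of "f [^] i" "f [^] j"] f by simp
    qed
    then show ?thesis by blast
  qed
  then show ?thesis using f unfolding sequences_to_infinity_def asymptotic_iff by auto
qed

lemma endpoint_bd: "good f K \<Longrightarrow> endpoint f \<in> bd"
  using good_seqs bd_iff unfolding endpoint_def by blast

lemma endpoint_attractive: "good f K \<Longrightarrow> attractive_fixed_point G S f (endpoint f)"
  using good_seqs cls_self endpoint_bd unfolding endpoint_def attractive_fixed_point_def by blast

lemma boundary_act_endpoint_iff:
  assumes "good f K" "good g L" "h \<in> carrier G"
  shows "boundary_act G h (endpoint f) = endpoint g \<longleftrightarrow>
    (\<forall>C. \<exists>N::nat. \<forall>i\<ge>N. \<forall>j\<ge>N. gp (h \<otimes> f [^] i) (g [^] j) \<ge> C)"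
  unfolding endpoint_def boundary_act_cls[OF assms(3) good_seqs[OF assms(1)]]
    cls_eq_iff[OF translate_seqs[OF assms(3) good_seqs[OF assms(1)]] good_seqs[OF assms(2)]]
    asymptotic_iff ..

lemma boundary_act_self_endpoint:
  assumes "good f K"
  shows "boundary_act G f (endpoint f) = endpoint f"
proof -
  have f: "f \<in> carrier G" using assms good_carrier by blast
  have e: "f \<otimes> f [^] i = f [^] Suc i" for i :: nat
    using f by (metis nat_pow_Suc2)
  have "\<exists>N::nat. \<forall>i\<ge>N. \<forall>j\<ge>N. gp (f \<otimes> f [^] i) (f [^] j) \<ge> C" for C
  proof -
    have "\<forall>C. \<exists>N. \<forall>i\<ge>N. \<forall>j\<ge>N. gp (f [^] (i::nat)) (f [^] (j::nat)) \<ge> C"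
      using good_seqs[OF assms] by (simp add: sequences_to_infinity_def asymptotic_iff)
    then obtain N where N: "\<forall>i\<ge>N. \<forall>j\<ge>N. gp (f [^] (i::nat)) (f [^] (j::nat)) \<ge> C" by meson
    have "gp (f \<otimes> f [^] i) (f [^] j) \<ge> C" if "i \<ge> N" "j \<ge> N" for i j
      unfolding e using that N[rule_format, of "Suc i" j] by simp
    then show ?thesis by blast
  qed
  then show ?thesis using boundary_act_endpoint_iff[OF assms assms f] by blast
qed

lemma endpoint_inv_fixed:
  assumes "good f K"
  shows "boundary_act G f (endpoint (inv f)) = endpoint (inv f)"
proof -
  have "endpoint (inv f) = boundary_act G (inv f) (endpoint (inv f))"
    by (rule boundary_act_self_endpoint[OF good_inv[OF assms], symmetric])
  then show ?thesis
    using boundary_act_eq_iff endpoint_bd[OF good_inv[OF assms]] good_carrier[OF assms] by blast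
qed

lemma endpoint_ne_endpoint_inv:
  assumes "good f K"
  shows "endpoint f \<noteq> endpoint (inv f)"
proof
  assume "endpoint f = endpoint (inv f)"
  then have "asymptotic G S (\<lambda>n. inv f [^] n) (\<lambda>n. f [^] (n::nat))"
    using cls_eq_iff[OF good_seqs good_seqs] assms good_inv unfolding endpoint_def by metis
  then obtain N where "\<And>i j. i \<ge> N \<Longrightarrow> j \<ge> N \<Longrightarrow> gp (inv f [^] i) (f [^] (j::nat)) \<ge> K / 2 + 1"
    unfolding asymptotic_iff by blast
  from this[of N N] show False
    using good_opposite_gp[OF assms, of N N] good_carrier[OF assms] by (simp add: inv_nat_pow)
qed

text \<open>The value \<open>0\<close> of \<open>ord\<close> encodes infinite order, the condition
  under which \<open>limit_maps\<close> gives information. A finite order would bring the powers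
  back to \<open>\<one>\<close> arbitrarily late, although their lengths tend to infinity.\<close>

lemma good_ord:
  assumes "good f K"
  shows "ord f = 0"
proof (rule ccontr)
  have f: "f \<in> carrier G" using assms good_carrier by blast
  assume "ord f \<noteq> 0"
  obtain N :: nat where N: "\<And>n. n \<ge> N \<Longrightarrow> real (len (f [^] n)) \<ge> 1"
    using good_len_tendsto[OF assms] by blast
  have "f [^] (ord f * N) = \<one>" using f nat_pow_pow[OF f, of "ord f" N] pow_ord_eq_1[OF f] by simp
  moreover have "ord f * N \<ge> N" using \<open>ord f \<noteq> 0\<close> by simp
  ultimately show False using N[of "ord f * N"] by simp
qed

text \<open>Since \<open>h\<close> does not send \<open>endpoint f\<close> to
  \<open>endpoint (inv f)\<close>, the points \<open>h \<otimes> f [^] n\<close> and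
  \<open>inv (f [^] n)\<close> have uniformly bounded Gromov products. So the corner of the powers
  of \<open>h \<otimes> f [^] n\<close> stays bounded while its length tends to infinity, and
  \<open>good_local\<close> applies.\<close>

lemma good_mult_power:
  assumes "good f K" and h: "h \<in> carrier G" and ne: "boundary_act G h (endpoint f) \<noteq> endpoint (inv f)"
  shows "\<exists>N. \<forall>n\<ge>N. \<exists>K'. good (h \<otimes> f [^] (n::nat)) K'"
proof -
  have f: "f \<in> carrier G" using assms good_carrier by blast
  have K: "K \<ge> 0" using good_K_nonneg assms by blast
  obtain C where C: "\<And>N. \<exists>i\<ge>N. \<exists>j\<ge>N. gp (h \<otimes> f [^] i) (inv f [^] (j::nat)) < C"
    using ne boundary_act_endpoint_iff[OF assms(1) good_inv[OF assms(1)] h] not_le by metis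
  \<comment> \<open>Chosen so that a product above \<open>a\<close> forces
    \<open>len (f [^] n) - K / 2 - len h\<close> to be at least \<open>C + 2 * \<delta>\<close>.
    This leaves one \<open>\<delta>\<close> for each of the two four-point inequalities that lead to
    a product of at least \<open>C\<close> at the indices \<open>i\<close> and
    \<open>j\<close>.\<close>
  define a where "a = C + K / 2 + 2 * len h + 2 * \<delta>"
  have bdd: "gp (inv (f [^] n)) (h \<otimes> f [^] n) \<le> a" for n :: nat
  proof (rule ccontr)
    assume "\<not> gp (inv (f [^] n)) (h \<otimes> f [^] n) \<le> a"
    then have big: "gp (h \<otimes> f [^] n) (inv f [^] n) > a"
      using f h gp_commute[of "inv (f [^] n)" "h \<otimes> f [^] n"] by (simp add: inv_nat_pow)
    obtain i j where ij: "i \<ge> n" "j \<ge> n" "gp (h \<otimes> f [^] i) (inv f [^] (j::nat)) < C" using C by blast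
    have c: "h \<otimes> f [^] i \<in> carrier G" "h \<otimes> f [^] n \<in> carrier G" "inv f [^] j \<in> carrier G" "inv f [^] n \<in> carrier G"
      using f h by auto
    have "gp (h \<otimes> f [^] n) (h \<otimes> f [^] i) \<ge> gp (f [^] n) (f [^] i) - len h"
      using gp_translate f h by simp
    moreover have "gp (f [^] n) (f [^] i) \<ge> len (f [^] n) - K / 2" using good_gp assms(1) ij(1) by blast
    moreover have "real (len (h \<otimes> f [^] n)) \<le> len h + real (len (f [^] n))"
      using len_mult[of h "f [^] n"] h f by simp
    moreover have "gp (h \<otimes> f [^] n) (inv f [^] n) \<le> len (h \<otimes> f [^] n)"
      using gp_le(1)[OF c(2,4)] .
    ultimately have 1: "gp (h \<otimes> f [^] n) (h \<otimes> f [^] i) \<ge> C + 2 * \<delta>"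
      using big unfolding a_def by linarith
    have "gp (inv f [^] n) (inv f [^] j) \<ge> len (inv f [^] n) - K / 2"
      using good_gp[OF good_inv[OF assms(1)] ij(2)] .
    moreover have "gp (h \<otimes> f [^] n) (inv f [^] n) \<le> len (inv f [^] n)"
      using gp_le(2)[OF c(2,4)] .
    ultimately have 2: "gp (inv f [^] n) (inv f [^] j) \<ge> C + 2 * \<delta>"
      using big unfolding a_def by linarith
    have "min (gp (h \<otimes> f [^] n) (inv f [^] n)) (gp (inv f [^] n) (inv f [^] j)) \<ge> C + 2 * \<delta>"
      using 2 big K delta_nonneg unfolding a_def by simp
    then have 3: "gp (h \<otimes> f [^] n) (inv f [^] j) \<ge> C + \<delta>"
      using hyp[OF c(2,3,4)] by linarith
    have "min (gp (h \<otimes> f [^] i) (h \<otimes> f [^] n)) (gp (h \<otimes> f [^] n) (inv f [^] j)) \<ge> C + \<delta>"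
      using 1 3 gp_commute[OF c(1,2)] delta_nonneg by simp
    then show False using hyp[OF c(1,3,2)] ij(3) by linarith
  qed
  \<comment> \<open>\<open>inv (h \<otimes> f [^] n)\<close> is \<open>inv (f [^] n)\<close>
    followed by \<open>inv h\<close>, and this right factor raises the product by at most
    \<open>len h\<close>.\<close>
  define b where "b = a + len h"
  obtain N :: nat where N: "\<And>n. n \<ge> N \<Longrightarrow> real (len (f [^] n)) \<ge> 2 * b + 3 * \<delta> + len h + 1"
    using good_len_tendsto[OF assms(1)] by blast
  have "good (h \<otimes> f [^] n) (2 * b + 4 * \<delta>)" if "n \<ge> N" for n
  proof (rule good_local)
    show "h \<otimes> f [^] n \<in> carrier G" using f h by simp
    have "inv (h \<otimes> f [^] n) = inv (f [^] n) \<otimes> inv h" using f h by (simp add: inv_mult_group)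
    then show "gp (inv (h \<otimes> f [^] n)) (h \<otimes> f [^] n) \<le> b"
      using gp_mult_right_le[of "inv h" "inv (f [^] n)" "h \<otimes> f [^] n"] bdd[of n] f h by (simp add: b_def)
    have "len (f [^] n) \<le> len h + len (h \<otimes> f [^] n)"
      using len_mult[of "inv h" "h \<otimes> f [^] n"] f h by simp
    then show "real (len (h \<otimes> f [^] n)) > 2 * b + 3 * \<delta>" using N[OF that] by linarith
  qed
  then show ?thesis by blast
qed

text \<open>Only \<open>k0\<close> depends on \<open>h\<close>, the distance does not: this bounds the number of cosets below.\<close>

lemma stabilizer_ray_close:
  assumes "good f K" and h: "h \<in> carrier G" and fx: "boundary_act G h (endpoint f) = endpoint f"
  shows "\<exists>k0. \<forall>k\<ge>k0. \<exists>n. len (inv (f [^] (n::nat)) \<otimes> (h \<otimes> f [^] (k::nat))) \<le> real (len f) + K + 6 * \<delta>"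
proof -
  have f: "f \<in> carrier G" using assms good_carrier by blast
  have K: "K \<ge> 0" using good_K_nonneg assms by blast
  obtain k0 :: nat where k0: "\<And>k. k \<ge> k0 \<Longrightarrow> real (len (f [^] k)) \<ge> len h + \<delta> + K / 2 + 1"
    using good_len_tendsto[OF assms(1)] by blast
  have "\<exists>n. len (inv (f [^] (n::nat)) \<otimes> (h \<otimes> f [^] k)) \<le> real (len f) + K + 6 * \<delta>" if "k \<ge> k0" for k
  proof -
    define x where "x = h \<otimes> f [^] k"
    have xc: "x \<in> carrier G" using f h by (simp add: x_def)
    \<comment> \<open>\<open>n\<close> will be the first index with
      \<open>len (f [^] n) \<ge> len x\<close>. Minimality bounds the overshoot by
      \<open>len f\<close>, so \<open>f [^] n\<close> and \<open>x\<close> are at nearly the same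
      distance from \<open>\<one>\<close>.\<close>
    define P where "P n \<longleftrightarrow> len (f [^] (n::nat)) \<ge> len x" for n
    obtain n0 where "P n0" using good_len_tendsto[OF assms(1), of "len x"] unfolding P_def by auto
    define n where "n = (LEAST n. P n)"
    have n1: "len x \<le> len (f [^] n)" using LeastI[of P, OF \<open>P n0\<close>] by (simp add: n_def P_def)
    have n2: "len (f [^] n) \<le> len x + len f"
    proof (cases n)
      case (Suc m)
      then have "\<not> P m" unfolding n_def using not_less_Least by (metis lessI n_def)
      then show ?thesis using len_mult[of "f [^] m" f] f Suc by (simp add: P_def)
    qed simp
    obtain N where N: "\<And>i j. i \<ge> N \<Longrightarrow> j \<ge> N \<Longrightarrow> gp (h \<otimes> f [^] (i::nat)) (f [^] (j::nat)) \<ge> len x + len f"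
      using fx boundary_act_endpoint_iff[OF assms(1,1) h] by metis
    \<comment> \<open>Both rays are followed to the index \<open>J\<close>, where their Gromov
      product is at least \<open>len x + len f\<close>. Then \<open>f [^] n\<close> and
      \<open>x\<close> are compared along the chain \<open>f [^] n\<close>, \<open>f [^] J\<close>,
      \<open>h \<otimes> f [^] J\<close>, \<open>x\<close>.\<close>
    define J where "J = max N (max k n)"
    have J: "J \<ge> N" "J \<ge> k" "J \<ge> n" by (auto simp: J_def)
    have c: "f [^] J \<in> carrier G" "f [^] n \<in> carrier G" "h \<otimes> f [^] J \<in> carrier G" using f h by auto
    have 1: "gp (f [^] n) (f [^] J) \<ge> len x - K / 2"
      using good_gp[OF assms(1) J(3)] n1 by linarith
    have 2: "gp x (h \<otimes> f [^] J) \<ge> len x - K / 2 - \<delta>"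
    proof -
      \<comment> \<open>Seen from \<open>x\<close>, that is after translation by
        \<open>inv x\<close>, the points \<open>\<one>\<close>, \<open>h\<close> and
        \<open>h \<otimes> f [^] J\<close> become \<open>y\<close>, \<open>inv (f [^] k)\<close> and
        \<open>f [^] r\<close>. The corner at \<open>x\<close> is bounded for \<open>h\<close> in
        place of \<open>\<one>\<close>, and for \<open>k \<ge> k0\<close> the distance between
        \<open>h\<close> and \<open>\<one>\<close> no longer matters.\<close>
      define y where "y = inv (f [^] k) \<otimes> inv h"
      define r where "r = J - k"
      have yc: "y \<in> carrier G" using f h by (simp add: y_def)
      have iy: "inv y = x" using f h by (simp add: y_def x_def inv_mult_group)
      have Jr: "f [^] J = f [^] k \<otimes> f [^] r" using f J by (simp add: r_def nat_pow_mult)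
      have xJ: "inv x \<otimes> (h \<otimes> f [^] J) = f [^] r"
        using f h by (simp add: x_def Jr inv_mult_group m_assoc)
      have g1: "gp y (f [^] r) = (real (len x) + len (f [^] r) - len (h \<otimes> f [^] J)) / 2"
        using gp_eq[OF yc, of "f [^] r"] iy f h len_inv[OF yc] by (simp add: x_def Jr m_assoc)
      have g2: "gp x (h \<otimes> f [^] J) = (real (len x) + len (h \<otimes> f [^] J) - len (f [^] r)) / 2"
        using gp_eq[OF xc c(3)] xJ by simp
      have g3: "gp (inv (f [^] k)) (f [^] r) \<le> K / 2" using good_opposite_gp assms(1) by blast
      have g4: "gp (inv (f [^] k)) y \<ge> len (f [^] k) - real (len h)"
      proof -
        have "gp (inv (f [^] k)) y = (real (len (f [^] k)) + len x - len h) / 2"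
          using gp_eq[of "inv (f [^] k)" y] f h yc len_inv[OF yc, unfolded iy] by (simp add: y_def)
        moreover have "len (f [^] k) \<le> len h + len x"
          using len_mult[of "inv h" x] f h by (simp add: x_def)
        ultimately show ?thesis by (simp add: field_simps)
      qed
      have "gp (inv (f [^] k)) (f [^] r) \<ge> min (gp (inv (f [^] k)) y) (gp y (f [^] r)) - \<delta>"
        using f yc by (intro hyp) auto
      then have "gp y (f [^] r) \<le> K / 2 + \<delta>"
        using g3 g4 k0[OF that] by (simp add: min_def split: if_splits)
      then show ?thesis using g1 g2 by (simp add: field_simps)
    qed
    have 3: "gp (h \<otimes> f [^] J) (f [^] J) \<ge> len x + len f" using N J by blast
    have "gp x (f [^] J) \<ge> min (gp x (h \<otimes> f [^] J)) (gp (h \<otimes> f [^] J) (f [^] J)) - \<delta>"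
      using c xc by (intro hyp) auto
    then have 4: "gp x (f [^] J) \<ge> len x - K / 2 - 2 * \<delta>"
      using 2 3 K delta_nonneg by (simp add: min_def split: if_splits)
    have "gp (f [^] n) x \<ge> min (gp (f [^] n) (f [^] J)) (gp (f [^] J) x) - \<delta>"
      using c xc by (intro hyp) auto
    moreover have "gp (f [^] J) x = gp x (f [^] J)" using gp_commute c xc by blast
    ultimately have "gp (f [^] n) x \<ge> len x - K / 2 - 3 * \<delta>"
      using 1 4 delta_nonneg by (simp add: min_def split: if_splits)
    then have "real (len (inv (f [^] n) \<otimes> x)) \<le> real (len f) + K + 6 * \<delta>"
      using gp_eq[OF c(2) xc] n2 by (simp add: field_simps)
    then show ?thesis unfolding x_def by blast
  qed
  then show ?thesis by blast
qed

text \<open>Each coset of the powers of \<open>f\<close> in the stabilizer passes within distance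
  \<open>D\<close> of \<open>f [^] k\<close> for all large \<open>k\<close>. Finitely many cosets
  admit a common \<open>k\<close>, and then each occupies a different element of a ball of radius
  \<open>D\<close>; so their number is bounded by the size of that ball.\<close>

lemma stabilizer_cosets_finite:
  assumes good: "good f K"
  shows "\<exists>F. finite F \<and> F \<subseteq> carrier G \<and>
    (\<forall>h\<in>carrier G. boundary_act G h (endpoint f) = endpoint f \<longrightarrow> (\<exists>g\<in>F. \<exists>i::int. h = g \<otimes> f [^] i))"
proof -
  have f: "f \<in> carrier G" using good good_carrier by blast
  define D where "D = nat \<lceil>real (len f) + K + 6 * \<delta>\<rceil>"
  define B where "B = {g \<in> carrier G. len g \<le> D}"
  have finB: "finite B" unfolding B_def by (rule finite_ball)
  define St where "St = {h \<in> carrier G. boundary_act G h (endpoint f) = endpoint f}"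
  define coset where "coset h = range (\<lambda>i::int. h \<otimes> f [^] i)" for h
  define Cs where "Cs = coset ` St"
  have self: "h \<in> coset h" if "h \<in> carrier G" for h
    unfolding coset_def using that by (intro image_eqI[of _ _ 0]) auto
  have coset_eq: "coset h = coset h'" if c: "h \<in> carrier G" "h' \<in> carrier G" and e: "h \<otimes> f [^] i = h' \<otimes> f [^] j"
    for h h' and i j :: int
  proof -
    have h: "h = h' \<otimes> f [^] (j - i)"
    proof -
      have "h = h \<otimes> f [^] i \<otimes> f [^] (- i)" using c f by (simp add: m_assoc int_pow_mult[symmetric])
      also have "\<dots> = h' \<otimes> (f [^] j \<otimes> f [^] (- i))" unfolding e using c f by (simp add: m_assoc)
      also have "\<dots> = h' \<otimes> f [^] (j - i)" using f int_pow_mult[of f j "- i"] by simp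
      finally show ?thesis .
    qed
    have *: "h \<otimes> f [^] k = h' \<otimes> f [^] (j - i + k)" for k
      unfolding h using c f int_pow_mult[of f "j - i" k] by (simp add: m_assoc)
    show ?thesis
    proof (intro equalityI subsetI)
      fix z assume "z \<in> coset h"
      then show "z \<in> coset h'" unfolding coset_def using * by auto
    next
      fix z assume "z \<in> coset h'"
      then obtain k :: int where "z = h' \<otimes> f [^] k" unfolding coset_def by (rule rangeE)
      then have "z = h \<otimes> f [^] (k - (j - i))" using *[of "k - (j - i)"] by simp
      then show "z \<in> coset h" unfolding coset_def by auto
    qed
  qed
  have close: "\<exists>k0::nat. \<forall>k\<ge>k0. \<exists>n::nat. inv (f [^] k) \<otimes> (h \<otimes> f [^] n) \<in> B" if "h \<in> St" for h
  proof -
    have h: "h \<in> carrier G" "boundary_act G h (endpoint f) = endpoint f" using that by (auto simp: St_def)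
    \<comment> \<open>The estimate is applied to \<open>inv h\<close>, because inverting the short
      element puts the power of \<open>f\<close> to the right of \<open>h\<close> and thus produces
      an element of the coset of \<open>h\<close>.\<close>
    have "boundary_act G (inv h) (endpoint f) = endpoint f"
      using boundary_act_eq_iff[of h "endpoint f" "endpoint f"] h endpoint_bd[OF good] by simp
    then obtain k0 where k0: "\<And>k. k \<ge> k0 \<Longrightarrow> \<exists>n. len (inv (f [^] (n::nat)) \<otimes> (inv h \<otimes> f [^] (k::nat))) \<le> real (len f) + K + 6 * \<delta>"
      using stabilizer_ray_close[OF good, of "inv h"] h by blast
    have "\<exists>n::nat. inv (f [^] k) \<otimes> (h \<otimes> f [^] n) \<in> B" if k: "k \<ge> k0" for k
    proof -
      obtain n :: nat where n: "len (inv (f [^] n) \<otimes> (inv h \<otimes> f [^] k)) \<le> real (len f) + K + 6 * \<delta>" using k0[OF k] by blast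
      have "inv (inv (f [^] n) \<otimes> (inv h \<otimes> f [^] k)) = inv (f [^] k) \<otimes> (h \<otimes> f [^] n)"
        using f h by (simp add: inv_mult_group m_assoc)
      moreover have "len (inv (inv (f [^] n) \<otimes> (inv h \<otimes> f [^] k))) = len (inv (f [^] n) \<otimes> (inv h \<otimes> f [^] k))"
        using f h by (intro len_inv) auto
      ultimately have "real (len (inv (f [^] k) \<otimes> (h \<otimes> f [^] n))) \<le> real (len f) + K + 6 * \<delta>" using n by simp
      then have "len (inv (f [^] k) \<otimes> (h \<otimes> f [^] n)) \<le> D" unfolding D_def by linarith
      then show ?thesis using f h unfolding B_def by auto
    qed
    then show ?thesis by blast
  qed
  define rep where "rep c = (SOME h. h \<in> St \<and> c = coset h)" for c
  have some: "rep c \<in> St \<and> c = coset (rep c)" if c: "c \<in> Cs" for c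
  proof -
    obtain h where "c = coset h" "h \<in> St" using c unfolding Cs_def by (rule imageE)
    then have "h \<in> St \<and> c = coset h" by simp
    then show ?thesis unfolding rep_def by (rule someI)
  qed
  have "finite T \<and> card T \<le> card B" if T: "T \<subseteq> Cs" "finite T" for T
  proof -
    have rep: "rep c \<in> St \<and> c = coset (rep c)" if "c \<in> T" for c using some that T by auto
    have "\<forall>c\<in>T. \<exists>k0::nat. \<forall>k\<ge>k0. \<exists>n::nat. inv (f [^] k) \<otimes> (rep c \<otimes> f [^] n) \<in> B"
      using close rep by blast
    then obtain k0 :: "_ \<Rightarrow> nat" where k0:
      "\<forall>c\<in>T. \<forall>k\<ge>k0 c. \<exists>n::nat. inv (f [^] k) \<otimes> (rep c \<otimes> f [^] n) \<in> B"
      by (rule bchoice[THEN exE])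
    define k where "k = Max (insert 0 (k0 ` T))"
    have "k0 c \<le> k" if "c \<in> T" for c unfolding k_def using that T by auto
    then have "\<forall>c\<in>T. \<exists>n::nat. inv (f [^] k) \<otimes> (rep c \<otimes> f [^] n) \<in> B" using k0 by blast
    then obtain n :: "_ \<Rightarrow> nat" where n: "\<forall>c\<in>T. inv (f [^] k) \<otimes> (rep c \<otimes> f [^] n c) \<in> B"
      by (rule bchoice[THEN exE])
    have "inj_on (\<lambda>c. inv (f [^] k) \<otimes> (rep c \<otimes> f [^] n c)) T"
    proof (rule inj_onI)
      fix c c' assume c: "c \<in> T" "c' \<in> T" "inv (f [^] k) \<otimes> (rep c \<otimes> f [^] n c) = inv (f [^] k) \<otimes> (rep c' \<otimes> f [^] n c')"
      have rc: "rep c \<in> carrier G" "rep c' \<in> carrier G" using rep c by (auto simp: St_def)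
      then have "rep c \<otimes> f [^] n c = rep c' \<otimes> f [^] n c'" using c(3) f by simp
      then have "rep c \<otimes> f [^] int (n c) = rep c' \<otimes> f [^] int (n c')" by (simp add: int_pow_int)
      from coset_eq[OF rc this] show "c = c'" using rep c by auto
    qed
    then show ?thesis using card_inj_on_le[of _ T B] n finB T by blast
  qed
  then have fin: "finite Cs" using finite_if_finite_subsets_card_bdd[of Cs "card B"] by blast
  define F where "F = rep ` Cs"
  show ?thesis
  proof (intro exI[of _ F] conjI ballI impI)
    show "finite F" using fin by (simp add: F_def)
    show "F \<subseteq> carrier G" using some by (auto simp: F_def St_def)
    fix h assume h: "h \<in> carrier G" "boundary_act G h (endpoint f) = endpoint f"
    then have hS: "h \<in> St" by (simp add: St_def)
    have cC: "coset h \<in> Cs" using hS by (simp add: Cs_def)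
    then have "h \<in> coset (rep (coset h))" using some self[OF h(1)] by blast
    then obtain i :: int where "h = rep (coset h) \<otimes> f [^] i" unfolding coset_def by (rule rangeE)
    then show "\<exists>g\<in>F. \<exists>i::int. h = g \<otimes> f [^] i" using cC unfolding F_def by blast
  qed
qed

text \<open>If the orbit of \<open>endpoint f\<close> stayed inside the pair of fixed points of
  \<open>f\<close>, the stabilizer would have index at most two. Being covered by finitely many
  cosets of the powers of \<open>f\<close>, it would make \<open>G\<close> virtually cyclic.\<close>

lemma exists_moving_endpoint:
  assumes ne: "\<not> elementary_group G" and good: "good f K"
  shows "\<exists>h\<in>carrier G. boundary_act G h (endpoint f) \<noteq> endpoint f \<and> boundary_act G h (endpoint f) \<noteq> endpoint (inv f)"
proof (rule ccontr)
  assume "\<not> ?thesis"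
  then have all: "\<And>h. h \<in> carrier G \<Longrightarrow> boundary_act G h (endpoint f) = endpoint f \<or> boundary_act G h (endpoint f) = endpoint (inv f)"
    by blast
  have f: "f \<in> carrier G" using good good_carrier by blast
  obtain F where "finite F \<and> F \<subseteq> carrier G \<and>
    (\<forall>h\<in>carrier G. boundary_act G h (endpoint f) = endpoint f \<longrightarrow> (\<exists>g\<in>F. \<exists>i::int. h = g \<otimes> f [^] i))"
    using stabilizer_cosets_finite[OF good] by (rule exE)
  then have F: "finite F" "F \<subseteq> carrier G"
    "\<And>h. h \<in> carrier G \<Longrightarrow> boundary_act G h (endpoint f) = endpoint f \<Longrightarrow> \<exists>g\<in>F. \<exists>i::int. h = g \<otimes> f [^] i"
    by simp_all
  have "\<exists>F'. finite F' \<and> F' \<subseteq> carrier G \<and> (\<forall>h\<in>carrier G. \<exists>g\<in>F'. \<exists>i::int. h = g \<otimes> f [^] i)"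
  proof (cases "\<exists>h0\<in>carrier G. boundary_act G h0 (endpoint f) = endpoint (inv f)")
    case True
    then obtain h0 where h0: "h0 \<in> carrier G" "boundary_act G h0 (endpoint f) = endpoint (inv f)" by blast
    have "\<exists>g\<in>F \<union> (\<otimes>) h0 ` F. \<exists>i::int. h = g \<otimes> f [^] i" if h: "h \<in> carrier G" for h
    proof (cases "boundary_act G h (endpoint f) = endpoint f")
      case True
      then show ?thesis using F(3) h by blast
    next
      case False
      then have "boundary_act G h (endpoint f) = boundary_act G h0 (endpoint f)" using all h h0 by metis
      then have "boundary_act G (inv h0 \<otimes> h) (endpoint f) = boundary_act G (inv h0 \<otimes> h0) (endpoint f)"
        using h h0 endpoint_bd[OF good] by (simp only: boundary_act_mult inv_closed)
      then have "boundary_act G (inv h0 \<otimes> h) (endpoint f) = endpoint f"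
        using h0 boundary_act_one endpoint_bd[OF good] by simp
      then obtain g and i :: int where g: "g \<in> F" "inv h0 \<otimes> h = g \<otimes> f [^] i"
        using F(3)[of "inv h0 \<otimes> h"] h h0 by auto
      have "h = h0 \<otimes> (inv h0 \<otimes> h)" using h h0 by simp
      also have "\<dots> = h0 \<otimes> g \<otimes> f [^] i" unfolding g(2) using h0 g F f by (auto simp: m_assoc)
      finally show ?thesis using g(1) by blast
    qed
    moreover have "F \<union> (\<otimes>) h0 ` F \<subseteq> carrier G" using F h0 by auto
    ultimately show ?thesis using F(1) by (metis finite_UnI finite_imageI)
  next
    case False
    then show ?thesis using F all by metis
  qed
  then obtain F' where "finite F' \<and> F' \<subseteq> carrier G \<and> (\<forall>h\<in>carrier G. \<exists>g\<in>F'. \<exists>i::int. h = g \<otimes> f [^] i)"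
    by (rule exE)
  then have F': "finite F'" "F' \<subseteq> carrier G"
    "\<And>h. h \<in> carrier G \<Longrightarrow> \<exists>g\<in>F'. \<exists>i::int. h = g \<otimes> f [^] i" by simp_all
  \<comment> \<open>The covering is by left cosets, while \<open>elementary_group\<close> counts
    right cosets; inversion exchanges the two.\<close>
  have "rcosets (generate G {f}) \<subseteq> (\<lambda>g. generate G {f} #> inv g) ` F'"
  proof
    fix c assume "c \<in> rcosets (generate G {f})"
    then obtain a where a: "a \<in> carrier G" "c = generate G {f} #> a" unfolding RCOSETS_def by auto
    obtain g and i :: int where g: "g \<in> F'" "inv a = g \<otimes> f [^] i" using F'(3)[of "inv a"] a by auto
    have gc: "g \<in> carrier G" using g F' by auto
    have "a = inv (inv a)" using a by simp
    also have "\<dots> = f [^] (- i) \<otimes> inv g" unfolding g(2) using gc f by (simp add: inv_mult_group int_pow_neg)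
    finally have "a = f [^] (- i) \<otimes> inv g" .
    moreover have sub: "subgroup (generate G {f}) G" using generate_is_subgroup f by simp
    moreover have m: "f [^] (- i) \<in> generate G {f}" using generate_pow[OF f] by blast
    moreover have "generate G {f} #> f [^] (- i) = generate G {f}"
      using sub m f by (intro coset_join2) auto
    moreover have "generate G {f} \<subseteq> carrier G" using f by (intro generate_incl) auto
    ultimately have "c = generate G {f} #> inv g"
      unfolding a(2) using gc f coset_mult_assoc[of "generate G {f}" "f [^] (- i)" "inv g"] by (metis inv_closed int_pow_closed)
    then show "c \<in> (\<lambda>g. generate G {f} #> inv g) ` F'" using g by blast
  qed
  then have "finite (rcosets (generate G {f}))" using F'(1) finite_surj by blast
  then show False using ne f unfolding elementary_group_def by blast
qed

lemma nonelementary_infinite: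
  assumes "\<not> elementary_group G"
  shows "infinite (carrier G)"
proof
  assume fin: "finite (carrier G)"
  have "rcosets (generate G {\<one>}) \<subseteq> Pow (carrier G)"
    using r_coset_subset_G generate_incl[of "{\<one>}"] by (auto simp: RCOSETS_def)
  then have "finite (rcosets (generate G {\<one>}))" using fin finite_subset by blast
  then show False using assms unfolding elementary_group_def by blast
qed

lemma exists_good:
  assumes "\<not> elementary_group G"
  shows "\<exists>f. good f 0"
  using exists_periodic_geodesic[OF nonelementary_infinite[OF assms]] good_periodic_geodesic by blast

end


section \<open>Attracting eigenvectors\<close>

abbreviation iter :: "real^'n^'n \<Rightarrow> nat \<Rightarrow> real^'n \<Rightarrow> real^'n" where
  "iter A k \<equiv> ((*v) A) ^^ k"

lemma iter_add: "iter A k (v + w) = iter A k v + iter A k w"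
  by (induction k) (auto simp: matrix_vector_right_distrib)

lemma iter_scaleR: "iter A k (c *\<^sub>R w) = c *\<^sub>R iter A k w"
  by (induction k) (auto simp: matrix_vector_mult_scaleR)

lemma iter_eigenvector: "A *v v = m *\<^sub>R v \<Longrightarrow> iter A k v = m ^ k *\<^sub>R v"
  by (induction k) (auto simp: matrix_vector_mult_scaleR)

text \<open>The map \<open>w \<mapsto> (b \<bullet> w) v\<close> is the spectral projection to the
  dominant eigenvalue \<open>m\<close>: the repelling hyperplane is given by its normal vector
  \<open>b\<close>, scaled by \<open>b \<bullet> v = 1\<close>. Dominance is expressed by
  convergence of the rescaled iterates, which avoids complex eigenvalues.\<close>

definition attracts :: "real^'n^'n \<Rightarrow> real^'n \<Rightarrow> real^'n \<Rightarrow> real \<Rightarrow> bool" where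
  "attracts A v b m \<longleftrightarrow> b \<bullet> v = 1 \<and> A *v v = m *\<^sub>R v \<and> m \<noteq> 0 \<and> (\<forall>w. b \<bullet> (A *v w) = m * (b \<bullet> w)) \<and>
     (\<forall>w. (\<lambda>k. (1 / m ^ k) *\<^sub>R iter A k w) \<longlonglongrightarrow> (b \<bullet> w) *\<^sub>R v)"

lemma span_singleton_eq: "span {u :: 'a::real_vector} = span {u'} \<Longrightarrow> \<exists>c. u = c *\<^sub>R u'"
  using span_base[of u "{u}"] by (auto simp: span_singleton)

text \<open>The hypothesis only gives convergence of lines. For \<open>h\<close> in \<open>H\<close>
  it is applied to \<open>v + h\<close>, whose iterates have \<open>v\<close>-component exactly
  \<open>m ^ k\<close>; closeness of their lines to \<open>L\<close> then says that the iterates of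
  \<open>h\<close> are small compared with \<open>m ^ k\<close>.\<close>

lemma attracting_repelling_data:
  fixes A :: "real^'n^'n"
  assumes "attracting_repelling A L H"
  shows "\<exists>v b m. attracts A v b m \<and> L = span {v} \<and> H = {w. b \<bullet> w = 0}"
proof -
  have L: "L \<in> lines" and H: "subspace H" "dim H + 1 = CARD('n)" and LH: "L \<inter> H = {0}"
    and AL: "(*v) A ` L = L" and AH: "(*v) A ` H = H"
    and lim: "\<And>v. v \<notin> H \<Longrightarrow> limitin projective_topology (\<lambda>n. span {iter A n v}) L sequentially"
    using assms unfolding attracting_repelling_def hyperplanes_def by auto
  obtain v where v: "v \<noteq> 0" "L = span {v}" using L unfolding lines_def by auto
  have vL: "v \<in> L" using v span_base by auto
  have vH: "v \<notin> H" using vL v LH by auto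
  have "dim H = DIM(real^'n) - 1" using H by simp
  then obtain a where a: "a \<noteq> 0" "span H = {x. a \<bullet> x = 0}" using dim_eq_hyperplane by blast
  have Ha: "H = {x. a \<bullet> x = 0}" using a H span_eq_iff by blast
  have av: "a \<bullet> v \<noteq> 0" using vH Ha by auto
  define b where "b = (1 / (a \<bullet> v)) *\<^sub>R a"
  have bv: "b \<bullet> v = 1" using av by (simp add: b_def)
  have Hb: "H = {x. b \<bullet> x = 0}" using av Ha by (simp add: b_def)
  have "A *v v \<in> L" using vL AL by blast
  then obtain m where m: "A *v v = m *\<^sub>R v" using v by (auto simp: span_singleton)
  have m0: "m \<noteq> 0"
  proof
    assume "m = 0"
    then have "(*v) A ` L \<subseteq> {0}" using m v by (auto simp: span_singleton matrix_vector_mult_scaleR)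
    then show False using AL vL v by auto
  qed
  have hH: "w - (b \<bullet> w) *\<^sub>R v \<in> H" for w using bv by (simp add: Hb inner_diff_right)
  have bA: "b \<bullet> (A *v w) = m * (b \<bullet> w)" for w
  proof -
    define h where "h = w - (b \<bullet> w) *\<^sub>R v"
    have "A *v h \<in> H" using hH[of w] AH h_def by blast
    moreover have "w = (b \<bullet> w) *\<^sub>R v + h" by (simp add: h_def)
    then have "A *v w = (b \<bullet> w) *\<^sub>R m *\<^sub>R v + A *v h"
      using m by (metis matrix_vector_mult_scaleR matrix_vector_right_distrib)
    ultimately show ?thesis using bv Hb by (simp add: inner_add_right)
  qed
  have bI: "b \<bullet> iter A k w = m ^ k * (b \<bullet> w)" for k w
    using bA by (induction k) auto
  have small: "(\<lambda>k. (1 / m ^ k) *\<^sub>R iter A k h) \<longlonglongrightarrow> 0" if h: "h \<in> H" for h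
  proof (rule tendstoI)
    fix e :: real assume e: "e > 0"
    \<comment> \<open>An open double cone around \<open>L\<close> whose aperture shrinks with
      \<open>e\<close>. It is invariant under nonzero rescaling, so it is the full preimage of the
      set \<open>U\<close> of lines, as the quotient topology requires.\<close>
    define Q where "Q = {u. norm (u - (b \<bullet> u) *\<^sub>R v) < e * \<bar>b \<bullet> u\<bar>}"
    define U where "U = {span {u} | u. u \<noteq> 0 \<and> u \<in> Q}"
    have Qs: "u' \<in> Q" if "u \<in> Q" "u = c *\<^sub>R u'" for u u' c
    proof -
      have "u - (b \<bullet> u) *\<^sub>R v = c *\<^sub>R (u' - (b \<bullet> u') *\<^sub>R v)" using that by (simp add: scaleR_diff_right)
      then have "norm (u - (b \<bullet> u) *\<^sub>R v) = \<bar>c\<bar> * norm (u' - (b \<bullet> u') *\<^sub>R v)" by simp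
      moreover have "\<bar>b \<bullet> u\<bar> = \<bar>c\<bar> * \<bar>b \<bullet> u'\<bar>" using that by (simp add: abs_mult)
      ultimately have "\<bar>c\<bar> * norm (u' - (b \<bullet> u') *\<^sub>R v) < \<bar>c\<bar> * (e * \<bar>b \<bullet> u'\<bar>)"
        using that(1) by (simp add: Q_def mult.left_commute)
      then show ?thesis unfolding Q_def by (simp add: mult_less_cancel_left)
    qed
    have "{u. u \<noteq> 0 \<and> span {u} \<in> U} = Q \<inter> {u. u \<noteq> 0}"
      unfolding U_def using Qs span_singleton_eq by (auto; metis)
    moreover have "open Q" unfolding Q_def by (intro open_Collect_less continuous_intros)
    moreover have "open {u :: real^'n. u \<noteq> 0}" by (rule open_Collect_neq) auto
    ultimately have "openin projective_topology U"
      unfolding openin_projective_topology U_def lines_def by auto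
    moreover have "L \<in> U"
    proof -
      have "v \<in> Q" using e bv by (simp add: Q_def)
      then show ?thesis using v unfolding U_def by auto
    qed
    moreover have "v + h \<notin> H" using bv h Hb by (simp add: inner_add_right)
    ultimately have "\<forall>\<^sub>F k in sequentially. span {iter A k (v + h)} \<in> U"
      using lim[of "v + h"] unfolding limitin_def by blast
    then show "\<forall>\<^sub>F k in sequentially. dist ((1 / m ^ k) *\<^sub>R iter A k h) 0 < e"
    proof (rule eventually_mono)
      fix k assume "span {iter A k (v + h)} \<in> U"
      then have Q: "iter A k (v + h) \<in> Q" unfolding U_def using Qs span_singleton_eq by (auto; metis)
      have 1: "b \<bullet> iter A k (v + h) = m ^ k" using bI[of k "v + h"] bv h Hb by (simp add: inner_add_right)
      have "norm (iter A k h) < e * \<bar>m\<bar> ^ k"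
        using Q iter_eigenvector[OF m, of k] unfolding Q_def mem_Collect_eq 1
        by (simp add: iter_add power_abs)
      then show "dist ((1 / m ^ k) *\<^sub>R iter A k h) 0 < e" using m0
        by (simp add: power_abs field_simps)
    qed
  qed
  have "(\<lambda>k. (1 / m ^ k) *\<^sub>R iter A k w) \<longlonglongrightarrow> (b \<bullet> w) *\<^sub>R v" for w
  proof -
    define h where "h = w - (b \<bullet> w) *\<^sub>R v"
    have w: "w = (b \<bullet> w) *\<^sub>R v + h" by (simp add: h_def)
    have "(1 / m ^ k) *\<^sub>R iter A k w = (b \<bullet> w) *\<^sub>R v + (1 / m ^ k) *\<^sub>R iter A k h" for k
      using iter_eigenvector[OF m, of k] m0
      by (subst w) (simp add: iter_add iter_scaleR scaleR_add_right)
    moreover have "(\<lambda>k. (b \<bullet> w) *\<^sub>R v + (1 / m ^ k) *\<^sub>R iter A k h) \<longlonglongrightarrow> (b \<bullet> w) *\<^sub>R v + 0"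
      using small hH[of w] by (intro tendsto_add tendsto_const) (auto simp: h_def)
    ultimately show ?thesis by simp
  qed
  then have "attracts A v b m" using bv m m0 bA unfolding attracts_def by blast
  then show ?thesis using v Hb by blast
qed

definition mpow :: "real^'n^'n \<Rightarrow> nat \<Rightarrow> real^'n^'n" where
  "mpow A k = (((**) A) ^^ k) (mat 1)"

lemma mpow_0 [simp]: "mpow A 0 = mat 1" and mpow_Suc [simp]: "mpow A (Suc k) = A ** mpow A k"
  by (simp_all add: mpow_def)

lemma mpow_vector: "mpow A k *v w = iter A k w"
  by (induction k) (simp_all add: matrix_vector_mul_assoc[symmetric])

lemma det_mpow: "det (mpow A k) = det A ^ k"
  by (induction k) (simp_all add: det_mul)

lemma tendsto_det:
  fixes M :: "nat \<Rightarrow> real^'n^'n"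
  assumes "\<And>i j. (\<lambda>k. M k $ i $ j) \<longlonglongrightarrow> N $ i $ j"
  shows "(\<lambda>k. det (M k)) \<longlonglongrightarrow> det N"
  unfolding det_def by (intro tendsto_intros assms)

text \<open>The rescaled powers of \<open>A\<close> converge to a map of rank one, whose determinant
  vanishes in dimension at least two. Their determinants are powers of \<open>1 / m\<close>, so with
  \<open>\<bar>m\<bar> \<le> 1\<close> they could not tend to zero.\<close>

lemma attracts_eigenvalue_gt_1:
  fixes A :: "real^'n^'n"
  assumes A: "attracts A v b m" and det: "det A = 1" and d: "CARD('n) > 1"
  shows "\<bar>m\<bar> > 1"
proof (rule ccontr)
  assume "\<not> \<bar>m\<bar> > 1"
  have m0: "m \<noteq> 0" using A by (simp add: attracts_def)
  define N :: "real^'n^'n" where "N = (\<chi> i j. v $ i * b $ j)"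
  define M where "M k = (1 / m ^ k) *\<^sub>R mpow A k" for k
  have entry: "X $ i $ j = (X *v axis j 1) $ i" for X :: "real^'n^'n" and i j
    by (simp add: matrix_vector_mult_basis column_def)
  have "(\<lambda>k. M k $ i $ j) \<longlonglongrightarrow> N $ i $ j" for i j
  proof -
    have "(\<lambda>k. ((1 / m ^ k) *\<^sub>R iter A k (axis j 1)) $ i) \<longlonglongrightarrow> ((b \<bullet> axis j 1) *\<^sub>R v) $ i"
      using A unfolding attracts_def by (intro tendsto_vec_nth) blast
    then show ?thesis
      by (simp add: M_def N_def entry[of "mpow A _"] mpow_vector inner_axis mult.commute)
  qed
  then have "(\<lambda>k. det (M k)) \<longlonglongrightarrow> det N" by (rule tendsto_det)
  moreover have "det N = 0"
  proof -
    have "\<exists>x. x \<noteq> 0 \<and> b \<bullet> x = 0" 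
    proof -
      obtain x where "x \<noteq> 0" "orthogonal b x"
        using orthogonal_to_vector_exists[of b] d by auto
      then show ?thesis by (auto simp: orthogonal_def)
    qed
    then obtain x where x: "x \<noteq> 0" "b \<bullet> x = 0" by blast
    have "N *v x = (b \<bullet> x) *\<^sub>R v"
      by (simp add: N_def matrix_vector_mult_def vec_eq_iff inner_vec_def sum_distrib_left sum_distrib_right algebra_simps)
    then have "N *v x = 0" using x by simp
    then show ?thesis using x invertible_det_nz[of N] matrix_left_invertible_ker[of N] invertible_def by blast
  qed
  moreover have "\<bar>det (M k)\<bar> \<ge> 1" for k
  proof -
    have e: "M k = (\<chi> i. (1 / m ^ k) *s (mpow A k $ i))" by (simp add: M_def vec_eq_iff)
    have "det (M k) = (1 / m ^ k) ^ CARD('n) * det (mpow A k)"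
      unfolding e by (subst det_rows_mul) simp
    then have "det (M k) = (1 / m ^ k) ^ CARD('n)" by (simp add: det_mpow det)
    moreover have "\<bar>1 / m ^ k\<bar> \<ge> 1" using m0 \<open>\<not> \<bar>m\<bar> > 1\<close>
      by (simp add: power_abs power_le_one)
    ultimately show ?thesis by (simp only: power_abs one_le_power)
  qed
  ultimately have "(\<lambda>k. \<bar>det (M k)\<bar>) \<longlonglongrightarrow> 0" by (simp add: tendsto_rabs_zero)
  then have "\<bar>det (M k)\<bar> \<ge> 1 \<longrightarrow> False" for k
    using \<open>\<And>k. \<bar>det (M k)\<bar> \<ge> 1\<close> LIMSEQ_le_const[of "\<lambda>k. \<bar>det (M k)\<bar>" 0 1] by auto
  then show False using \<open>\<And>k. \<bar>det (M k)\<bar> \<ge> 1\<close> by blast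
qed

text \<open>The cone of all \<open>w\<close> with \<open>\<parallel>w\<parallel> \<le> M |b \<bullet> w|\<close> is invariant under \<open>X\<close> and contains a
  neighbourhood of \<open>u\<close>, hence it contains the attracting eigenvector of \<open>X\<close>.\<close>

lemma attracts_near_rank_one:
  fixes X :: "real^'n^'n"
  assumes X: "attracts X v' b' t" and near: "\<And>w. norm (X *v w - (b \<bullet> w) *\<^sub>R u) \<le> \<eta> * norm w"
    and c: "b \<bullet> u \<noteq> 0" and \<eta>: "\<eta> \<ge> 0" and M: "M = 2 * norm u / \<bar>b \<bullet> u\<bar> + 1"
    and small: "\<eta> * (M + norm b * M\<^sup>2) \<le> \<bar>b \<bullet> u\<bar>"
  shows "\<bar>t - b \<bullet> u\<bar> \<le> norm b * \<eta> * M"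
proof -
  define c where "c = b \<bullet> u"
  have c0: "\<bar>c\<bar> > 0" using c by (simp add: c_def)
  have M1: "M \<ge> 1" using c0 by (simp add: M c_def)
  \<comment> \<open>By the choice of \<open>M\<close> the product \<open>M * \<bar>c\<bar>\<close>
    exceeds \<open>norm u\<close> by at least \<open>\<bar>c\<bar>\<close>. This surplus pays both
    for the error \<open>\<eta>\<close> in the invariance of \<open>K\<close> and for moving
    \<open>u\<close> slightly in the choice of \<open>w\<close>.\<close>
  have Mc: "M * \<bar>c\<bar> = 2 * norm u + \<bar>c\<bar>" using c0 by (simp add: M c_def field_simps)
  define K where "K = {w. norm w \<le> M * \<bar>b \<bullet> w\<bar>}"
  have err: "norm (X *v w - (b \<bullet> w) *\<^sub>R u) \<le> \<eta> * M * \<bar>b \<bullet> w\<bar>" if "w \<in> K" for w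
  proof -
    have "\<eta> * norm w \<le> \<eta> * (M * \<bar>b \<bullet> w\<bar>)" using that \<eta> by (intro mult_left_mono) (auto simp: K_def)
    then show ?thesis using near[of w] by (simp add: mult.assoc)
  qed
  have errb: "\<bar>b \<bullet> (X *v w) - (b \<bullet> w) * c\<bar> \<le> norm b * \<eta> * M * \<bar>b \<bullet> w\<bar>" if "w \<in> K" for w
  proof -
    have "b \<bullet> (X *v w) - (b \<bullet> w) * c = b \<bullet> (X *v w - (b \<bullet> w) *\<^sub>R u)" by (simp add: c_def inner_diff_right)
    also have "\<bar>\<dots>\<bar> \<le> norm b * norm (X *v w - (b \<bullet> w) *\<^sub>R u)" by (rule Cauchy_Schwarz_ineq2)
    also have "\<dots> \<le> norm b * (\<eta> * M * \<bar>b \<bullet> w\<bar>)" using err[OF that] by (intro mult_left_mono) auto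
    finally show ?thesis by (simp add: mult.assoc)
  qed
  have step: "X *v w \<in> K" if w: "w \<in> K" for w
  proof -
    define r where "r = \<bar>b \<bullet> w\<bar>"
    have "norm (X *v w) \<le> norm (X *v w - (b \<bullet> w) *\<^sub>R u) + norm ((b \<bullet> w) *\<^sub>R u)"
      using norm_triangle_sub add.commute by metis
    then have 1: "norm (X *v w) \<le> r * (\<eta> * M + norm u)" using err[OF w] by (simp add: r_def algebra_simps)
    have "\<bar>(b \<bullet> w) * c\<bar> \<le> \<bar>b \<bullet> (X *v w)\<bar> + norm b * \<eta> * M * r" using errb[OF w] unfolding r_def by linarith
    then have 2: "r * (\<bar>c\<bar> - norm b * \<eta> * M) \<le> \<bar>b \<bullet> (X *v w)\<bar>" by (simp add: r_def abs_mult algebra_simps)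
    have "\<eta> * M + norm u \<le> M * (\<bar>c\<bar> - norm b * \<eta> * M)"
      using small Mc unfolding c_def[symmetric]
      by (simp add: algebra_simps power2_eq_square) (use norm_ge_zero[of u] in linarith)
    then have "r * (\<eta> * M + norm u) \<le> r * (M * (\<bar>c\<bar> - norm b * \<eta> * M))"
      by (intro mult_left_mono) (auto simp: r_def)
    also have "\<dots> \<le> M * \<bar>b \<bullet> (X *v w)\<bar>" using mult_left_mono[OF 2, of M] M1 by (simp add: algebra_simps)
    finally show ?thesis using 1 by (simp add: K_def)
  qed
  have iterK: "iter X k w \<in> K" if "w \<in> K" for k w using that step by (induction k) auto
  have scaleK: "s *\<^sub>R w \<in> K" if "w \<in> K" for s w
    using mult_left_mono[of "norm w" "M * \<bar>b \<bullet> w\<bar>" "\<bar>s\<bar>"] that by (simp add: K_def abs_mult algebra_simps)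
  have clK: "closed K" unfolding K_def by (intro closed_Collect_le continuous_intros)
  have bv': "b' \<bullet> v' = 1" using X by (simp add: attracts_def)
  \<comment> \<open>Iterates approach the attracting line only off the kernel of \<open>b'\<close>.
    If \<open>u\<close> lies in that kernel, a small multiple of \<open>v'\<close> is added without
    leaving \<open>K\<close>.\<close>
  obtain w where w: "w \<in> K" "b' \<bullet> w \<noteq> 0"
  proof (cases "b' \<bullet> u = 0")
    case False
    have "u \<in> K" using Mc c0 by (simp add: K_def c_def[symmetric])
    then show ?thesis using that False by blast
  next
    case True
    define q where "q = norm v' + M * norm b * norm v'"
    have q: "q \<ge> 0" using M1 by (simp add: q_def)
    define s where "s = \<bar>c\<bar> / (1 + q)"
    have s: "s > 0" using c0 q by (simp add: s_def)
    have sq: "s * q \<le> \<bar>c\<bar>" using q c0 by (simp add: s_def field_simps)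
    have "\<bar>b \<bullet> v'\<bar> \<le> norm b * norm v'" by (rule Cauchy_Schwarz_ineq2)
    then have "s * \<bar>b \<bullet> v'\<bar> \<le> s * (norm b * norm v')" using s by (intro mult_left_mono) auto
    moreover have "\<bar>c\<bar> \<le> \<bar>c + s * (b \<bullet> v')\<bar> + s * \<bar>b \<bullet> v'\<bar>"
      using s abs_triangle_ineq4[of "c + s * (b \<bullet> v')" "s * (b \<bullet> v')"] by (simp add: abs_mult)
    moreover have "b \<bullet> (u + s *\<^sub>R v') = c + s * (b \<bullet> v')" by (simp add: c_def inner_add_right)
    ultimately have "\<bar>c\<bar> - s * (norm b * norm v') \<le> \<bar>b \<bullet> (u + s *\<^sub>R v')\<bar>" by simp
    then have "M * (\<bar>c\<bar> - s * (norm b * norm v')) \<le> M * \<bar>b \<bullet> (u + s *\<^sub>R v')\<bar>" using M1 by (intro mult_left_mono) auto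
    moreover have "norm (u + s *\<^sub>R v') \<le> norm u + s * norm v'" using norm_triangle_ineq[of u "s *\<^sub>R v'"] s by simp
    ultimately have "u + s *\<^sub>R v' \<in> K" using Mc sq unfolding K_def q_def
      by (simp add: algebra_simps) (use norm_ge_zero[of u] in linarith)
    moreover have "b' \<bullet> (u + s *\<^sub>R v') \<noteq> 0" using True bv' s by (simp add: inner_add_right)
    ultimately show ?thesis using that by blast
  qed
  have "(\<lambda>k. (1 / t ^ k) *\<^sub>R iter X k w) \<longlonglongrightarrow> (b' \<bullet> w) *\<^sub>R v'" using X by (simp add: attracts_def)
  then have "(b' \<bullet> w) *\<^sub>R v' \<in> K"
    using clK iterK[OF w(1)] scaleK closed_sequentially[of K "\<lambda>k. (1 / t ^ k) *\<^sub>R iter X k w"] by blast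
  then have "(1 / (b' \<bullet> w)) *\<^sub>R (b' \<bullet> w) *\<^sub>R v' \<in> K" by (rule scaleK)
  then have vK: "v' \<in> K" using w(2) by simp
  have "v' \<noteq> 0" using bv' by auto
  then have pos: "\<bar>b \<bullet> v'\<bar> > 0" using vK by (auto simp: K_def)
  \<comment> \<open>Now \<open>v'\<close> lies in \<open>K\<close>, so the error estimate applies to
    it, and pairing \<open>X *v v'\<close> with \<open>b\<close> compares \<open>t\<close> with
    \<open>b \<bullet> u\<close>.\<close>
  have "X *v v' = t *\<^sub>R v'" using X by (simp add: attracts_def)
  then have "\<bar>b \<bullet> v'\<bar> * \<bar>t - c\<bar> \<le> \<bar>b \<bullet> v'\<bar> * (norm b * \<eta> * M)"
    using errb[OF vK] by (simp add: abs_mult[symmetric] algebra_simps)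
  then show ?thesis using pos by (simp add: c_def)
qed

text \<open>In finite dimension the error is a linear map, and its size is controlled by its values
  on the basis vectors.\<close>

lemma pointwise_limit_uniform:
  fixes X :: "nat \<Rightarrow> real^'n^'n"
  assumes lim: "\<And>w. (\<lambda>n. X n *v w) \<longlonglongrightarrow> (b \<bullet> w) *\<^sub>R u" and e: "\<eta> > 0"
  shows "\<forall>\<^sub>F n in sequentially. \<forall>w. norm (X n *v w - (b \<bullet> w) *\<^sub>R u) \<le> \<eta> * norm w"
proof -
  define E where "E n w = X n *v w - (b \<bullet> w) *\<^sub>R u" for n w
  have lin: "linear (E n)" for n
    unfolding E_def by (rule linearI) (auto simp: matrix_vector_right_distrib inner_add_right scaleR_add_left
        matrix_vector_mult_scaleR scaleR_diff_right)
  have "(\<lambda>n. \<Sum>i\<in>UNIV. norm (E n (axis i 1))) \<longlonglongrightarrow> (\<Sum>i\<in>(UNIV::'n set). 0)"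
  proof (intro tendsto_sum)
    fix i :: 'n
    have "(\<lambda>n. E n (axis i 1)) \<longlonglongrightarrow> 0" unfolding E_def using lim[of "axis i 1"] by (simp add: LIM_zero)
    then show "(\<lambda>n. norm (E n (axis i 1))) \<longlonglongrightarrow> 0" by (rule tendsto_norm_zero)
  qed
  then have "\<forall>\<^sub>F n in sequentially. (\<Sum>i\<in>UNIV. norm (E n (axis i 1))) < \<eta>"
    using e by (intro order_tendstoD) auto
  then show ?thesis
  proof (rule eventually_mono)
    fix n assume s: "(\<Sum>i\<in>UNIV. norm (E n (axis i 1))) < \<eta>"
    have "norm (E n w) \<le> \<eta> * norm w" for w
    proof -
      have w: "w = (\<Sum>i\<in>UNIV. (w $ i) *\<^sub>R axis i 1)" using basis_expansion[of w] by (simp add: scalar_mult_eq_scaleR)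
      have "E n w = (\<Sum>i\<in>UNIV. (w $ i) *\<^sub>R E n (axis i 1))"
        by (subst w) (simp add: linear_sum[OF lin] linear_cmul[OF lin])
      then have "norm (E n w) \<le> (\<Sum>i\<in>UNIV. \<bar>w $ i\<bar> * norm (E n (axis i 1)))"
        using norm_sum[of "\<lambda>i. (w $ i) *\<^sub>R E n (axis i 1)" UNIV] by simp
      also have "\<dots> \<le> (\<Sum>i\<in>UNIV. norm w * norm (E n (axis i 1)))"
        by (intro sum_mono mult_right_mono component_le_norm_cart) auto
      also have "\<dots> \<le> norm w * \<eta>" unfolding sum_distrib_left[symmetric] using s by (intro mult_left_mono) auto
      finally show ?thesis by (simp add: mult.commute)
    qed
    then show "\<forall>w. norm (X n *v w - (b \<bullet> w) *\<^sub>R u) \<le> \<eta> * norm w" by (simp add: E_def)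
  qed
qed

text \<open>The limit map \<open>w \<mapsto> (b \<bullet> w) u\<close> has
  \<open>b \<bullet> u\<close> as its only nonzero eigenvalue. The estimate for a single map near
  rank one gives the convergence however the eigenvectors vary with \<open>n\<close>.\<close>

lemma attracting_eigenvalue_tendsto:
  fixes X :: "nat \<Rightarrow> real^'n^'n"
  assumes lim: "\<And>w. (\<lambda>n. X n *v w) \<longlonglongrightarrow> (b \<bullet> w) *\<^sub>R u" and c: "b \<bullet> u \<noteq> 0"
    and X: "\<And>n. n \<ge> N \<Longrightarrow> attracts (X n) (v n) (b' n) (t n)"
  shows "t \<longlonglongrightarrow> b \<bullet> u"
proof (rule tendstoI)
  fix e :: real assume e: "e > 0"
  define M where "M = 2 * norm u / \<bar>b \<bullet> u\<bar> + 1"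
  have M1: "M \<ge> 1" by (simp add: M_def)
  define q where "q = M + norm b * M\<^sup>2"
  have q: "q > 0" using M1 by (simp add: q_def add_pos_nonneg)
  \<comment> \<open>The summand \<open>1\<close> makes the final inequality strict:
    \<open>norm b * \<eta> * M = \<eta> * p - \<eta> < e\<close>.\<close>
  define p where "p = norm b * M + 1"
  have p: "p > 0" using M1 by (simp add: p_def add_nonneg_pos)
  define \<eta> where "\<eta> = min (\<bar>b \<bullet> u\<bar> / q) (e / p)"
  have \<eta>: "\<eta> > 0" using c q p e by (simp add: \<eta>_def)
  have "\<eta> * q \<le> \<bar>b \<bullet> u\<bar> / q * q" using q by (intro mult_right_mono) (auto simp: \<eta>_def)
  then have s1: "\<eta> * (M + norm b * M\<^sup>2) \<le> \<bar>b \<bullet> u\<bar>" using q by (simp add: q_def[symmetric])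
  have "\<eta> * p \<le> e / p * p" using p by (intro mult_right_mono) (auto simp: \<eta>_def)
  then have "\<eta> * p \<le> e" using p by simp
  then have s2: "norm b * \<eta> * M < e" using \<eta> by (simp add: p_def algebra_simps)
  show "\<forall>\<^sub>F n in sequentially. dist (t n) (b \<bullet> u) < e"
    using pointwise_limit_uniform[OF lim \<eta>] eventually_ge_at_top[of N]
  proof eventually_elim
    case (elim n)
    then have "\<bar>t n - b \<bullet> u\<bar> \<le> norm b * \<eta> * M"
      using attracts_near_rank_one[OF X _ c _ M_def s1] \<eta> by simp
    then show ?case using s2 by (simp add: dist_real_def)
  qed
qed

text \<open>The span of a tail of the orbit of \<open>u\<close> is finite-dimensional and mapped injectively into itself
  by \<open>A\<close>, so it is also invariant under the inverse and contains the whole orbit.\<close>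

lemma orthogonal_backward_orbit:
  fixes A B :: "real^'n^'n"
  assumes BA: "\<And>w. B *v (A *v w) = r *\<^sub>R w" and r: "r \<noteq> 0"
    and orth: "\<And>n. n \<ge> N \<Longrightarrow> a \<bullet> iter A n u = 0"
  shows "a \<bullet> iter B n u = 0"
proof -
  define U where "U = span ((\<lambda>n. iter A n u) ` {N..})"
  have inj: "inj ((*v) A)"
  proof (rule injI)
    fix x y assume "A *v x = A *v y"
    then have "r *\<^sub>R x = r *\<^sub>R y" using BA by metis
    then show "x = y" using r by simp
  qed
  have sub: "(*v) A ` U \<subseteq> U"
  proof -
    have "(*v) A ` U = span ((*v) A ` (\<lambda>n. iter A n u) ` {N..})"
      unfolding U_def by (rule span_linear_image[symmetric]) (rule matrix_vector_mul_linear)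
    also have "\<dots> \<subseteq> U" unfolding U_def
    proof (rule span_mono)
      show "(*v) A ` (\<lambda>n. iter A n u) ` {N..} \<subseteq> (\<lambda>n. iter A n u) ` {N..}"
      proof clarify
        fix n assume "n \<ge> N"
        then show "A *v iter A n u \<in> (\<lambda>n. iter A n u) ` {N..}" by (intro image_eqI[of _ _ "Suc n"]) auto
      qed
    qed
    finally show ?thesis .
  qed
  have sU: "subspace U" unfolding U_def by (rule subspace_span)
  have "dim ((*v) A ` U) = dim U"
    using inj by (intro dim_image_eq matrix_vector_mul_linear inj_on_subset[OF inj]) auto
  then have eq: "(*v) A ` U = U"
    using sub sU by (intro subspace_dim_equal linear_subspace_image matrix_vector_mul_linear) auto
  have BU: "B *v w \<in> U" if "w \<in> U" for w
  proof -
    have "w \<in> (*v) A ` U" using eq that by simp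
    then obtain w' where "w = A *v w'" "w' \<in> U" by (rule imageE)
    then show ?thesis using BA sU subspace_scale by metis
  qed
  have tail: "iter A k u \<in> U \<Longrightarrow> u \<in> U" for k
  proof (induction k)
    case (Suc k)
    then have "r *\<^sub>R iter A k u \<in> U" using BU[OF Suc.prems] BA by simp
    then have "(1 / r) *\<^sub>R r *\<^sub>R iter A k u \<in> U" by (rule subspace_scale[OF sU])
    then show ?case using Suc r by simp
  qed simp
  have "iter A N u \<in> U" unfolding U_def by (intro span_base) auto
  then have "u \<in> U" using tail by blast
  then have "iter B n u \<in> U" using BU by (induction n) auto
  moreover have "a \<bullet> w = 0" if "w \<in> U" for w
    using that unfolding U_def
  proof (induction rule: span_induct)
    case base
    show ?case unfolding subspace_def by (auto simp: inner_add_right)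
  next
    case (step x)
    then show ?case using orth by auto
  qed
  ultimately show ?thesis by blast
qed

lemma convergent_multiples_eventually_const:
  fixes x :: "nat \<Rightarrow> real"
  assumes lim: "x \<longlonglongrightarrow> l" and a: "a > 0" and mult: "\<forall>\<^sub>F n in sequentially. \<exists>k::int. x n = of_int k * a"
  shows "\<forall>\<^sub>F n in sequentially. x n = l"
proof -
  have "\<forall>\<^sub>F n in sequentially. dist (x n) l < a / 2" using tendstoD[OF lim, of "a / 2"] a by simp
  from eventually_conj[OF this mult]
  obtain N where "\<forall>n\<ge>N. dist (x n) l < a / 2 \<and> (\<exists>k::int. x n = of_int k * a)"
    unfolding eventually_sequentially by (rule exE)
  then have N: "\<And>n. n \<ge> N \<Longrightarrow> dist (x n) l < a / 2 \<and> (\<exists>k::int. x n = of_int k * a)" by simp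
  have const: "x n = x N" if n: "n \<ge> N" for n
  proof -
    obtain k j :: int where k: "x n = of_int k * a" "x N = of_int j * a" using N n by blast
    have "\<bar>x n - x N\<bar> < a" using N[of n] N[of N] n unfolding dist_real_def by linarith
    moreover have "x n - x N = of_int (k - j) * a" using k by (simp add: algebra_simps)
    ultimately have "\<bar>real_of_int (k - j)\<bar> * a < 1 * a" using a by (simp add: abs_mult)
    then have "\<bar>real_of_int (k - j)\<bar> < 1" using a by (simp only: mult_less_cancel_right)
    then have "k = j" by linarith
    then show ?thesis using k by simp
  qed
  then have ev: "\<forall>\<^sub>F n in sequentially. x n = x N" unfolding eventually_sequentially by blast
  then have "x \<longlonglongrightarrow> x N" by (rule tendsto_eventually)
  then have "l = x N" using lim LIMSEQ_unique by blast
  then show ?thesis using ev by simp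
qed

lemma matrix_inv_both:
  assumes "det (A :: real^'n^'n) \<noteq> 0"
  shows "matrix_inv A ** A = mat 1" "A ** matrix_inv A = mat 1"
proof -
  have "\<exists>B. A ** B = mat 1 \<and> B ** A = mat 1"
    using assms invertible_det_nz[of A] unfolding invertible_def by blast
  then have "A ** matrix_inv A = mat 1 \<and> matrix_inv A ** A = mat 1"
    unfolding matrix_inv_def by (rule someI_ex)
  then show "matrix_inv A ** A = mat 1" "A ** matrix_inv A = mat 1" by auto
qed

lemma matrix_inv_vector:
  assumes "det (A :: real^'n^'n) \<noteq> 0"
  shows "matrix_inv A *v (A *v w) = w" "A *v (matrix_inv A *v w) = w"
  using matrix_inv_both[OF assms] by (simp_all add: matrix_vector_mul_assoc)

lemma uminus_matrix_vector: "(- A) *v w = - (A *v (w :: real^'n))"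
  by (simp add: matrix_vector_mult_def vec_eq_iff sum_negf)

lemma attracts_scale:
  assumes "attracts A v b m" "c \<noteq> 0"
  shows "attracts (c *\<^sub>R A) v b (c * m)"
proof -
  have e: "(c *\<^sub>R A) *v w = c *\<^sub>R (A *v w)" for w by (simp add: scaleR_matrix_vector_assoc)
  have i: "iter (c *\<^sub>R A) k w = c ^ k *\<^sub>R iter A k w" for k w
    by (induction k) (simp_all add: e matrix_vector_mult_scaleR)
  show ?thesis using assms unfolding attracts_def by (simp add: e i power_mult_distrib)
qed

lemma attracts_ne_0: "attracts A v b m \<Longrightarrow> v \<noteq> 0"
  by (auto simp: attracts_def)

lemma attracts_eigenvector:
  assumes A: "attracts A v b m" and v': "A *v v' = m' *\<^sub>R v'" "b \<bullet> v' \<noteq> 0"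
  shows "m' = m" "v' = (b \<bullet> v') *\<^sub>R v"
proof -
  have "b \<bullet> (A *v v') = m * (b \<bullet> v')" using A by (simp add: attracts_def)
  then show m: "m' = m" using v' by simp
  have "m \<noteq> 0" using A by (simp add: attracts_def)
  moreover have "(\<lambda>k. (1 / m ^ k) *\<^sub>R iter A k v') \<longlonglongrightarrow> (b \<bullet> v') *\<^sub>R v" using A by (simp add: attracts_def)
  ultimately have "(\<lambda>k::nat. v') \<longlonglongrightarrow> (b \<bullet> v') *\<^sub>R v" using iter_eigenvector[OF v'(1)] m by simp
  then show "v' = (b \<bullet> v') *\<^sub>R v" using LIMSEQ_const_iff by blast
qed

text \<open>Division with remainder: finiteness yields a least positive element \<open>T\<close> of
  \<open>P\<close>, which is a minimal period. The remainder of \<open>\<tau>\<close> modulo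
  \<open>T\<close> lies in \<open>P\<close> and is smaller than \<open>T\<close>, hence is
  zero.\<close>

lemma multiple_of_minimal_period:
  fixes P :: "real set"
  assumes diff: "\<And>s t. s \<in> P \<Longrightarrow> t \<in> P \<Longrightarrow> s - t \<in> P"
    and \<tau>: "\<tau> \<in> P" "\<tau> > 0" and fin: "finite (P \<inter> {0<..\<tau>})"
    and min: "\<And>T. T \<in> P \<Longrightarrow> T > 0 \<Longrightarrow> (\<And>s. 0 < s \<Longrightarrow> s < T \<Longrightarrow> s \<notin> P) \<Longrightarrow> \<exists>k::int. T = of_int k * a"
  shows "\<exists>k::int. \<tau> = of_int k * a"
proof -
  define T where "T = Min (P \<inter> {0<..\<tau>})"
  have ne: "P \<inter> {0<..\<tau>} \<noteq> {}" using \<tau> by auto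
  have T: "T \<in> P" "0 < T" "T \<le> \<tau>" using Min_in[OF fin ne] by (auto simp: T_def)
  have Tmin: "s \<notin> P" if s: "0 < s" "s < T" for s
  proof
    assume "s \<in> P"
    then have "T \<le> s" unfolding T_def using s T by (intro Min_le fin) auto
    then show False using s by simp
  qed
  obtain k :: int where k: "T = of_int k * a" using min[OF T(1,2) Tmin] by blast
  have sub: "\<tau> - of_nat n * T \<in> P" for n
  proof (induction n)
    case (Suc n)
    have "\<tau> - of_nat (Suc n) * T = (\<tau> - of_nat n * T) - T" by (simp add: algebra_simps)
    then show ?case using diff[OF Suc T(1)] by (simp only:)
  qed (simp add: \<tau>)
  define n where "n = nat \<lfloor>\<tau> / T\<rfloor>"
  have n: "real n = of_int \<lfloor>\<tau> / T\<rfloor>" using \<tau> T by (simp add: n_def)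
  have "real n \<le> \<tau> / T" "\<tau> / T < real n + 1" unfolding n by linarith+
  then have "0 \<le> \<tau> - real n * T" "\<tau> - real n * T < T" using T by (simp_all add: field_simps)
  then have "\<tau> - real n * T = 0" using Tmin[of "\<tau> - real n * T"] sub[of n] by force
  then have "\<tau> = of_int (int n * k) * a" using k by simp
  then show ?thesis by blast
qed

text \<open>For each \<open>f\<close> a half-open interval of length \<open>\<tau>\<close> contains
  exactly one translate of \<open>x f\<close>.\<close>

lemma finite_translates_in_interval:
  fixes \<tau> :: real
  assumes "finite F" "\<tau> > 0"
  shows "finite ({t. \<exists>f\<in>F. \<exists>k::int. t = x f + of_int k * \<tau>} \<inter> {0<..\<tau>})"
proof (rule finite_subset)
  show "finite ((\<lambda>f. x f + of_int \<lfloor>(\<tau> - x f) / \<tau>\<rfloor> * \<tau>) ` F)" using assms by simp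
  show "{t. \<exists>f\<in>F. \<exists>k::int. t = x f + of_int k * \<tau>} \<inter> {0<..\<tau>}
      \<subseteq> (\<lambda>f. x f + of_int \<lfloor>(\<tau> - x f) / \<tau>\<rfloor> * \<tau>) ` F"
  proof clarsimp
    fix f and k :: int assume f: "f \<in> F" "0 < x f + of_int k * \<tau>" "x f + of_int k * \<tau> \<le> \<tau>"
    have "\<lfloor>(\<tau> - x f) / \<tau>\<rfloor> = k"
      using f assms by (intro floor_unique) (simp_all add: field_simps)
    then show "x f + of_int k * \<tau> \<in> (\<lambda>f. x f + of_int \<lfloor>(\<tau> - x f) / \<tau>\<rfloor> * \<tau>) ` F" using f by auto
  qed
qed


section \<open>Periods of the geodesic flow\<close>

text \<open>The projective group enters only through facts on representing matrices. Their sign is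
  never normalized: it disappears in absolute values and in the classes of pairs on which the flow
  lives.\<close>

locale limit_map_group = hyperbolic_group +
  fixes \<rho> :: "'a \<Rightarrow> (real^'n^'n) set" and \<xi> \<eta>
  assumes dim: "CARD('n) > 1"
    and rep_nonempty: "g \<in> carrier G \<Longrightarrow> \<exists>A. A \<in> \<rho> g"
    and rep_det: "g \<in> carrier G \<Longrightarrow> A \<in> \<rho> g \<Longrightarrow> det A = 1"
    and rep_sign: "g \<in> carrier G \<Longrightarrow> A \<in> \<rho> g \<Longrightarrow> B \<in> \<rho> g \<Longrightarrow> B = A \<or> B = - A"
    and rep_mult: "g \<in> carrier G \<Longrightarrow> h \<in> carrier G \<Longrightarrow> A \<in> \<rho> g \<Longrightarrow> B \<in> \<rho> h \<Longrightarrow> A ** B \<in> \<rho> (g \<otimes> h)"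
    and rep_one: "mat 1 \<in> \<rho> \<one>"
    and limit_maps: "limit_maps G S \<rho> \<xi> \<eta>"
begin

section \<open>Eigenvectors and hyperplanes at the endpoints of good elements\<close>

lemma limit_maps_clauses:
  "\<forall>g\<in>carrier G. \<forall>A\<in>\<rho> g. \<forall>x\<in>bd. \<xi> (boundary_act G g x) = (*v) A ` \<xi> x \<and> \<eta> (boundary_act G g x) = (*v) A ` \<eta> x"
  "\<forall>x\<in>bd. \<forall>y\<in>bd. x \<noteq> y \<longrightarrow> \<xi> x \<inter> \<eta> y = {0} \<and> (\<forall>v. \<exists>u\<in>\<xi> x. \<exists>w\<in>\<eta> y. v = u + w)"
  "\<forall>g\<in>carrier G. ord g = 0 \<longrightarrow> (\<forall>x. attractive_fixed_point G S g x \<longrightarrow>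
    (\<forall>A\<in>\<rho> g. \<exists>H. attracting_repelling A (\<xi> x) H) \<and> (\<forall>B\<in>\<rho> (inv g). \<exists>L. attracting_repelling B L (\<eta> x)))"
  using limit_maps unfolding limit_maps_def by simp_all

lemma \<xi>_act: "g \<in> carrier G \<Longrightarrow> A \<in> \<rho> g \<Longrightarrow> x \<in> bd \<Longrightarrow> \<xi> (boundary_act G g x) = (*v) A ` \<xi> x"
  using limit_maps_clauses(1) by simp

lemma transversal: "x \<in> bd \<Longrightarrow> y \<in> bd \<Longrightarrow> x \<noteq> y \<Longrightarrow> \<xi> x \<inter> \<eta> y = {0}"
  using limit_maps_clauses(2) by simp

lemma rep_inj: "g \<in> carrier G \<Longrightarrow> A \<in> \<rho> g \<Longrightarrow> A *v w = 0 \<Longrightarrow> w = 0"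
  using rep_det[of g A] matrix_inv_vector(1)[of A w] by simp

lemma rep_pow:
  assumes g: "g \<in> carrier G" and A: "A \<in> \<rho> g"
  shows "mpow A n \<in> \<rho> (g [^] n)"
proof (induction n)
  case 0
  then show ?case using rep_one by simp
next
  case (Suc n)
  have "g [^] Suc n = g \<otimes> g [^] n" using g by (metis nat_pow_Suc2)
  then show ?case using rep_mult[OF g _ A Suc] g by simp
qed

lemma rep_inverse:
  assumes g: "g \<in> carrier G" and A: "A \<in> \<rho> g" and B: "B \<in> \<rho> (inv g)"
  shows "\<exists>r. (r = 1 \<or> r = - 1) \<and> (\<forall>w. B *v (A *v w) = r *\<^sub>R w) \<and> (\<forall>w. A *v (B *v w) = r *\<^sub>R w)"
proof -
  have "B ** A \<in> \<rho> \<one>" "A ** B \<in> \<rho> \<one>" using rep_mult[of "inv g" g B A] rep_mult[of g "inv g" A B] assms by auto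
  then have "B ** A = mat 1 \<or> B ** A = - mat 1" "A ** B = mat 1 \<or> A ** B = - mat 1"
    using rep_sign[OF one_closed rep_one] by blast+
  then obtain r where r: "r = 1 \<or> r = - 1" "B ** A = r *\<^sub>R mat 1" by (metis scaleR_minus1_left scaleR_one)
  have BA: "B *v (A *v w) = r *\<^sub>R w" for w
    using r(2) by (simp add: matrix_vector_mul_assoc scaleR_matrix_vector_assoc[symmetric])
  moreover have "A *v (B *v w) = r *\<^sub>R w" for w
  proof -
    have d: "det A \<noteq> 0" using rep_det[OF g A] by simp
    have "B *v w = B *v (A *v (matrix_inv A *v w))" by (simp add: matrix_inv_vector(2)[OF d])
    then have "B *v w = r *\<^sub>R (matrix_inv A *v w)" using BA by simp
    then show ?thesis by (simp add: matrix_vector_mult_scaleR matrix_inv_vector(2)[OF d])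
  qed
  ultimately show ?thesis using r by blast
qed

text \<open>\<open>limit_maps\<close> gives the attracting line and the repelling hyperplane in
  separate clauses, each with an unidentified partner. The clause for \<open>inv g\<close> provides
  \<open>v\<close>, \<open>b\<close> and the hyperplane, the one for \<open>g\<close> an eigenvector
  \<open>v'\<close> in \<open>\<xi> (endpoint g)\<close>. Transversality puts \<open>v'\<close> off
  that hyperplane, so \<open>v'\<close> is a multiple of \<open>v\<close>.\<close>

lemma good_data:
  assumes good: "good g K" and A: "A \<in> \<rho> g"
  shows "\<exists>v b m. attracts A v b m \<and> \<xi> (endpoint g) = span {v} \<and> \<eta> (endpoint (inv g)) = {w. b \<bullet> w = 0} \<and> \<bar>m\<bar> > 1"
proof -
  have g: "g \<in> carrier G" using good good_carrier by blast
  note last = limit_maps_clauses(3)[rule_format]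
  obtain L where "attracting_repelling A L (\<eta> (endpoint (inv g)))"
    using last[OF inv_closed[OF g] good_ord[OF good_inv[OF good]] endpoint_attractive[OF good_inv[OF good]]] A g by auto
  then obtain v b m where vbm: "attracts A v b m" "L = span {v}" "\<eta> (endpoint (inv g)) = {w. b \<bullet> w = 0}"
    using attracting_repelling_data by blast
  obtain H where "attracting_repelling A (\<xi> (endpoint g)) H"
    using last[OF g good_ord[OF good] endpoint_attractive[OF good]] A by auto
  then obtain v' b' m' where v': "attracts A v' b' m'" "\<xi> (endpoint g) = span {v'}"
    using attracting_repelling_data by blast
  have "v' \<in> \<xi> (endpoint g)" using v' by (simp add: span_base)
  moreover have "v' \<noteq> 0" using attracts_ne_0 v' by blast
  ultimately have "v' \<notin> \<eta> (endpoint (inv g))"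
    using transversal[OF endpoint_bd[OF good] endpoint_bd[OF good_inv[OF good]] endpoint_ne_endpoint_inv[OF good]] by blast
  then have bv: "b \<bullet> v' \<noteq> 0" using vbm by simp
  have "A *v v' = m' *\<^sub>R v'" using v' by (simp add: attracts_def)
  from attracts_eigenvector(2)[OF vbm(1) this bv]
  have "span {v'} = span {v}" using bv by (metis span_image_scale[of "{v}" "\<lambda>_. b \<bullet> v'"] finite.intros image_empty image_insert singletonD)
  then show ?thesis using vbm v' attracts_eigenvalue_gt_1[OF vbm(1) rep_det[OF g A] dim] by blast
qed

text \<open>This turns positions on the boundary into nonvanishing scalars: \<open>H\<close> carries
  \<open>v\<close> onto the line of the moved point, which is transversal to the hyperplane at
  \<open>y\<close>.\<close>

lemma not_in_hyperplane:
  assumes "h \<in> carrier G" "H \<in> \<rho> h" "x \<in> bd" "y \<in> bd" "boundary_act G h x \<noteq> y" "v \<in> \<xi> x" "v \<noteq> 0"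
  shows "H *v v \<notin> \<eta> y"
proof -
  have "H *v v \<in> \<xi> (boundary_act G h x)" using \<xi>_act assms by auto
  moreover have "H *v v \<noteq> 0" using rep_inj assms by blast
  ultimately show ?thesis using transversal[of "boundary_act G h x" y] boundary_act_bd assms by blast
qed

text \<open>That \<open>\<xi> x\<close> lies in \<open>\<eta> x\<close> is not a clause of
  \<open>limit_maps\<close>; at the repelling fixed point it follows from eigenvalues. If
  \<open>b\<close> did not vanish on \<open>v'\<close>, the product \<open>m * m'\<close> would be
  \<open>1\<close> or \<open>- 1\<close>, although both factors exceed \<open>1\<close> in absolute
  value.\<close>

lemma opposite_orthogonal:
  assumes good: "good g K" and A: "A \<in> \<rho> g" and B: "B \<in> \<rho> (inv g)"
    and a: "attracts A v b m" "\<bar>m\<bar> > 1" and a': "attracts B v' b' m'" "\<bar>m'\<bar> > 1"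
  shows "b \<bullet> v' = 0"
proof (rule ccontr)
  assume ne: "b \<bullet> v' \<noteq> 0"
  obtain r where r: "r = 1 \<or> r = - 1" "A *v (B *v v') = r *\<^sub>R v'"
    using rep_inverse[OF good_carrier[OF good] A B] by blast
  have "b \<bullet> (A *v (B *v v')) = m * (m' * (b \<bullet> v'))" using a a' by (simp add: attracts_def)
  then have "m * m' = r" using r ne by simp
  moreover have "\<bar>m * m'\<bar> > 1" using a a' by (simp add: abs_mult less_1_mult)
  ultimately show False using r by auto
qed

section \<open>The orbit of the flow attached to a good element\<close>

definition transport where
  "transport K \<theta> = Blinfun (\<lambda>w. blinfun_apply \<theta> (matrix_inv K *v w))"

lemma transport_apply: "blinfun_apply (transport K \<theta>) w = blinfun_apply \<theta> (matrix_inv K *v (w :: real^'n))"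
proof -
  have "bounded_linear (\<lambda>w. blinfun_apply \<theta> (matrix_inv K *v w))"
    by (rule bounded_linear_compose[OF blinfun.bounded_linear_right matrix_vector_mul_bounded_linear])
  then show ?thesis by (simp add: transport_def bounded_linear_Blinfun_apply)
qed

text \<open>Replacing \<open>K\<close> by \<open>- K\<close> changes the sign of both components and
  so only swaps the two pairs of the class; any representative computes the action.\<close>

lemma cover_act_eq:
  assumes k: "k \<in> carrier G" and K: "K \<in> \<rho> k"
  shows "cover_act G \<rho> k (x, y, {(\<theta>, v), (- \<theta>, - v)}) =
    (boundary_act G k x, boundary_act G k y, {(transport K \<theta>, K *v v), (- transport K \<theta>, - (K *v v))})"
proof -
  have inv_neg: "matrix_inv (- K) = - matrix_inv K"
  proof -
    have d: "det K \<noteq> 0" using rep_det[OF k K] by simp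
    have "(- K) ** (- matrix_inv K) = mat 1" using matrix_inv_both(2)[OF d]
      by (simp add: matrix_matrix_mult_def vec_eq_iff)
    then have dn: "det (- K) \<noteq> 0" by (metis det_I det_mul mult_zero_left zero_neq_one)
    have "matrix_inv (- K) = matrix_inv (- K) ** ((- K) ** (- matrix_inv K))"
      using \<open>(- K) ** (- matrix_inv K) = mat 1\<close> by simp
    then show ?thesis using matrix_inv_both(1)[OF dn] by (simp add: matrix_mul_assoc)
  qed
  have m: "transport K (- \<theta>) = - transport K \<theta>" "transport (- K) \<theta> = - transport K \<theta>"
    "transport (- K) (- \<theta>) = transport K \<theta>"
    by (auto intro!: blinfun_eqI simp: transport_apply inv_neg uminus_matrix_vector blinfun.minus_left blinfun.minus_right)
  have neg: "K *v (- v) = - (K *v v)" using matrix_vector_mult_scaleR[of K "- 1" v] by simp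
  have "{(transport A \<theta>', A *v v') | A \<theta>' v'. A \<in> \<rho> k \<and> (\<theta>', v') \<in> {(\<theta>, v), (- \<theta>, - v)}} =
      {(transport K \<theta>, K *v v), (- transport K \<theta>, - (K *v v))}" (is "?L = ?R")
  proof (intro equalityI subsetI)
    fix z assume "z \<in> ?L"
    then obtain A \<theta>' v' where z: "z = (transport A \<theta>', A *v v')" "A \<in> \<rho> k" "(\<theta>', v') = (\<theta>, v) \<or> (\<theta>', v') = (- \<theta>, - v)"
      by blast
    have "A = K \<or> A = - K" using rep_sign[OF k K z(2)] .
    then show "z \<in> ?R" using z m neg by (auto simp: uminus_matrix_vector)
  next
    fix z assume "z \<in> ?R"
    then have "z = (transport K \<theta>, K *v v) \<or> z = (transport K (- \<theta>), K *v (- v))" using m neg by simp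
    then show "z \<in> ?L" using K by blast
  qed
  then show ?thesis by (simp add: cover_act_def transport_def)
qed

lemma cover_flow_eq:
  "cover_flow t (x, y, {(\<theta>, v), (- \<theta>, - v)}) =
    (x, y, {(exp (- t) *\<^sub>R \<theta>, exp t *\<^sub>R v), (- (exp (- t) *\<^sub>R \<theta>), - (exp t *\<^sub>R v))})"
  by (simp add: cover_flow_def)

lemma cover_flow_add: "cover_flow (s + t) z = cover_flow s (cover_flow t z)"
proof -
  have "exp (- (s + t)) = exp (- s) * exp (- t)" by (simp add: exp_add[symmetric])
  then show ?thesis by (cases z) (simp add: cover_flow_def image_image exp_add split_beta)
qed

text \<open>Cosets of \<open>\<langle>g\<rangle>\<close> in the stabilizer of \<open>g\<^sub>+\<close> are finite in number, so the return times of the orbit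
  form a discrete group containing \<open>ln |m|\<close>; hence a minimal period exists and divides \<open>ln |m|\<close>.\<close>

lemma period_eigenvalue:
  assumes good: "good g K" and A: "A \<in> \<rho> g"
    and at: "attracts A v b m" "\<xi> (endpoint g) = span {v}" "\<eta> (endpoint (inv g)) = {w. b \<bullet> w = 0}" "\<bar>m\<bar> > 1"
    and periods: "\<And>T. is_orbit_period (flow_space G S \<rho> \<xi> \<eta>) geodesic_flow T \<Longrightarrow> \<exists>k::int. T = of_int k * a"
  shows "\<exists>k::int. ln \<bar>m\<bar> = of_int k * a"
proof -
  have g: "g \<in> carrier G" using good good_carrier by blast
  define x where "x = endpoint (inv g)"
  define y where "y = endpoint g"
  have xy: "x \<in> bd" "y \<in> bd" "x \<noteq> y"
    using endpoint_bd[OF good] endpoint_bd[OF good_inv[OF good]] endpoint_ne_endpoint_inv[OF good] by (auto simp: x_def y_def)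
  have bv: "b \<bullet> v = 1" and Av: "A *v v = m *\<^sub>R v" and bA: "\<And>w. b \<bullet> (A *v w) = m * (b \<bullet> w)" and m0: "m \<noteq> 0"
    using at by (auto simp: attracts_def)
  have v0: "v \<noteq> 0" using attracts_ne_0 at by blast
  define \<theta> where "\<theta> = blinfun_inner_right b"
  define z where "z = (x, y, {(\<theta>, v), (- \<theta>, - v)})"
  have "\<theta> \<in> annihilator (\<eta> x)" using at(3) by (simp add: \<theta>_def annihilator_def x_def)
  moreover have "v \<in> \<xi> y" using at(2) by (simp add: y_def span_base)
  moreover have "blinfun_apply \<theta> v = 1" using bv by (simp add: \<theta>_def)
  ultimately have z: "z \<in> flow_cover G S \<xi> \<eta>" using xy unfolding z_def flow_cover_def fibre_def by blast
  define u where "u = {z'. \<exists>k\<in>carrier G. z' = cover_act G \<rho> k z}"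
  have u: "u \<in> flow_space G S \<rho> \<xi> \<eta>"
  proof -
    have e: "u = {(z, z'). z \<in> flow_cover G S \<xi> \<eta> \<and> (\<exists>\<gamma>\<in>carrier G. z' = cover_act G \<rho> \<gamma> z)} `` {z}"
      using z by (auto simp: u_def)
    show ?thesis unfolding flow_space_def e by (rule quotientI[OF z])
  qed
  define P where "P = {t. geodesic_flow t u = u}"
  define \<tau> where "\<tau> = ln \<bar>m\<bar>"
  have \<tau>: "\<tau> > 0" using at(4) by (simp add: \<tau>_def)
  have exp\<tau>: "exp \<tau> = \<bar>m\<bar>" "exp (- \<tau>) = 1 / \<bar>m\<bar>" using m0 by (simp_all add: \<tau>_def exp_minus inverse_eq_divide)
  have diff: "s - t \<in> P" if "s \<in> P" "t \<in> P" for s t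
  proof -
    have st: "cover_flow s ` u = u" "cover_flow t ` u = u" using that by (auto simp: P_def geodesic_flow_def)
    have "cover_flow (s - t) ` u = cover_flow (s - t) ` cover_flow t ` u" using st by simp
    also have "\<dots> = cover_flow s ` u"
    proof -
      have "cover_flow (s - t) (cover_flow t p) = cover_flow s p" for p :: "('a, 'n) flow_point"
        using cover_flow_add[of "s - t" t p] by simp
      then show ?thesis by (simp add: image_image)
    qed
    finally show ?thesis using st by (simp add: P_def geodesic_flow_def)
  qed
  have \<tau>P: "\<tau> \<in> P"
  proof -
    \<comment> \<open>Right multiplication by \<open>g\<close> acts on the orbit of \<open>z\<close>
      as flowing for time \<open>\<tau>\<close>: \<open>g\<close> fixes \<open>x\<close> and
      \<open>y\<close>, multiplies \<open>v\<close> by \<open>m\<close> and divides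
      \<open>\<theta>\<close> by it. A negative \<open>m\<close> only swaps the two pairs of the
      class.\<close>
    have shift: "cover_flow \<tau> (cover_act G \<rho> k z) = cover_act G \<rho> (k \<otimes> g) z" if k: "k \<in> carrier G" for k
    proof -
      obtain Q where Q: "Q \<in> \<rho> k" using rep_nonempty[OF k] by blast
      have QA: "Q ** A \<in> \<rho> (k \<otimes> g)" using rep_mult[OF k g Q A] .
      have kg: "k \<otimes> g \<in> carrier G" using k g by simp
      have d: "det Q \<noteq> 0" "det A \<noteq> 0" "det (Q ** A) \<noteq> 0"
        using rep_det[OF k Q] rep_det[OF g A] by (simp_all add: det_mul)
      have tr: "transport (Q ** A) \<theta> = (1 / m) *\<^sub>R transport Q \<theta>"
      proof (rule blinfun_eqI)
        fix w
        define w' where "w' = matrix_inv (Q ** A) *v w"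
        have "w = Q *v (A *v w')" using matrix_inv_vector(2)[OF d(3), of w]
          by (simp add: w'_def matrix_vector_mul_assoc matrix_mul_assoc)
        then have "matrix_inv Q *v w = A *v w'" using matrix_inv_vector(1)[OF d(1)] by simp
        then show "blinfun_apply (transport (Q ** A) \<theta>) w = blinfun_apply ((1 / m) *\<^sub>R transport Q \<theta>) w"
          using bA[of w'] m0 by (simp add: transport_apply \<theta>_def w'_def[symmetric] blinfun.scaleR_left)
      qed
      have ev: "(Q ** A) *v v = m *\<^sub>R (Q *v v)"
        by (simp add: matrix_vector_mul_assoc[symmetric] Av matrix_vector_mult_scaleR)
      have bx: "boundary_act G (k \<otimes> g) x = boundary_act G k x" "boundary_act G (k \<otimes> g) y = boundary_act G k y"
        using boundary_act_mult[OF k g] xy endpoint_inv_fixed[OF good] boundary_act_self_endpoint[OF good]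
        by (simp_all add: x_def y_def)
      have "m = \<bar>m\<bar> \<or> m = - \<bar>m\<bar>" by auto
      then have sgn: "{((1 / \<bar>m\<bar>) *\<^sub>R transport Q \<theta>, \<bar>m\<bar> *\<^sub>R (Q *v v)), (- ((1 / \<bar>m\<bar>) *\<^sub>R transport Q \<theta>), - (\<bar>m\<bar> *\<^sub>R (Q *v v)))} =
        {((1 / m) *\<^sub>R transport Q \<theta>, m *\<^sub>R (Q *v v)), (- ((1 / m) *\<^sub>R transport Q \<theta>), - (m *\<^sub>R (Q *v v)))}"
      proof
        assume "m = - \<bar>m\<bar>"
        then have "(1 / m) *\<^sub>R p = - ((1 / \<bar>m\<bar>) *\<^sub>R p)" "m *\<^sub>R q = - (\<bar>m\<bar> *\<^sub>R q)"
          for p :: "(real^'n) \<Rightarrow>\<^sub>L real" and q :: "real^'n"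
          by (metis minus_divide_right scaleR_minus_left)+
        then show ?thesis by (simp add: insert_commute)
      qed simp
      then show ?thesis unfolding z_def cover_act_eq[OF k Q] cover_act_eq[OF kg QA] cover_flow_eq
        by (simp only: tr ev bx exp\<tau> sgn)
    qed
    have "cover_flow \<tau> ` u = u"
    proof (intro equalityI subsetI)
      fix p assume "p \<in> cover_flow \<tau> ` u"
      then obtain k where "k \<in> carrier G" "p = cover_flow \<tau> (cover_act G \<rho> k z)" unfolding u_def by auto
      then show "p \<in> u" using shift[of k] m_closed[of k g] g unfolding u_def by auto
    next
      fix p assume "p \<in> u"
      then obtain k where k: "k \<in> carrier G" "p = cover_act G \<rho> k z" unfolding u_def by auto
      then have "p = cover_flow \<tau> (cover_act G \<rho> (k \<otimes> inv g) z)"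
        using shift[of "k \<otimes> inv g"] g by (simp add: m_assoc)
      then show "p \<in> cover_flow \<tau> ` u" using k g unfolding u_def by auto
    qed
    then show ?thesis by (simp add: P_def geodesic_flow_def)
  qed
  obtain F where "finite F \<and> F \<subseteq> carrier G \<and>
    (\<forall>h\<in>carrier G. boundary_act G h (endpoint g) = endpoint g \<longrightarrow> (\<exists>f\<in>F. \<exists>i::int. h = f \<otimes> g [^] i))"
    using stabilizer_cosets_finite[OF good] by (rule exE)
  then have F: "finite F" "F \<subseteq> carrier G"
    "\<And>h. h \<in> carrier G \<Longrightarrow> boundary_act G h (endpoint g) = endpoint g \<Longrightarrow> \<exists>f\<in>F. \<exists>i::int. h = f \<otimes> g [^] i"
    by simp_all
  \<comment> \<open>The logarithm of the factor by which \<open>f\<close> stretches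
    \<open>v\<close>; taking norms makes the choice of representative immaterial. A return through
    \<open>f \<otimes> g [^] i\<close> takes time \<open>X f + i * \<tau>\<close>.\<close>
  define X where "X f = ln (norm ((SOME Q. Q \<in> \<rho> f) *v v) / norm v)" for f
  have int_eig: "\<exists>Q\<in>\<rho> (g [^] i). \<exists>\<mu>. Q *v v = \<mu> *\<^sub>R v \<and> ln \<bar>\<mu>\<bar> = of_int i * \<tau> \<and> \<mu> \<noteq> 0" for i :: int
  proof (cases "i \<ge> 0")
    case True
    then obtain n :: nat where n: "i = int n" using nonneg_int_cases by blast
    have "mpow A n *v v = m ^ n *\<^sub>R v" by (simp add: mpow_vector iter_eigenvector[OF Av])
    moreover have "mpow A n \<in> \<rho> (g [^] i)" using rep_pow[OF g A, of n] n by (simp add: int_pow_int)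
    moreover have "ln \<bar>m ^ n\<bar> = of_int i * \<tau>" using n m0 by (simp add: \<tau>_def power_abs ln_realpow)
    ultimately show ?thesis using m0 by (metis power_not_zero)
  next
    case False
    then obtain n :: nat where n: "i = - int n" by (metis int_cases4 linorder_not_le nle_le of_nat_0_le_iff)
    obtain B where B: "B \<in> \<rho> (inv g)" using rep_nonempty g by blast
    obtain r where r: "r = 1 \<or> r = - 1" "B *v (A *v v) = r *\<^sub>R v"
      using rep_inverse[OF g A B] by blast
    then have "m *\<^sub>R (B *v v) = r *\<^sub>R v" by (simp add: Av matrix_vector_mult_scaleR)
    then have "B *v v = (r / m) *\<^sub>R v" using m0 by (metis (no_types, lifting) divide_inverse_commute scaleR_left_imp_eq scaleR_scaleR nonzero_eq_divide_eq mult.commute)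
    then have "mpow B n *v v = (r / m) ^ n *\<^sub>R v" by (simp add: mpow_vector iter_eigenvector)
    moreover have "mpow B n \<in> \<rho> (g [^] i)"
      using rep_pow[OF inv_closed[OF g] B, of n] n g by (simp add: int_pow_neg int_pow_int inv_nat_pow)
    moreover have "\<bar>r / m\<bar> = 1 / \<bar>m\<bar>" using r by auto
    then have "ln \<bar>(r / m) ^ n\<bar> = of_int i * \<tau>" using n m0 by (simp add: \<tau>_def power_abs ln_realpow ln_div)
    moreover have "(r / m) ^ n \<noteq> 0" using r m0 by auto
    ultimately show ?thesis by blast
  qed
  have Psub: "P \<subseteq> {t. \<exists>f\<in>F. \<exists>k::int. t = X f + of_int k * \<tau>}"
  proof
    fix t assume "t \<in> P"
    then have tu: "cover_flow t ` u = u" by (simp add: P_def geodesic_flow_def)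
    have "cover_act G \<rho> \<one> z \<in> u" unfolding u_def by blast
    then have "cover_flow t (cover_act G \<rho> \<one> z) \<in> u" using tu by blast
    then obtain h where h: "h \<in> carrier G" "cover_flow t (cover_act G \<rho> \<one> z) = cover_act G \<rho> h z"
      unfolding u_def by blast
    \<comment> \<open>The element \<open>h\<close> that realizes the return fixes \<open>y\<close>,
      so it lies in one of the finitely many cosets. Comparing the norms of the vectors in the two
      classes recovers \<open>t\<close>.\<close>
    have hy: "boundary_act G h y = y"
      and hc: "\<And>Q. Q \<in> \<rho> h \<Longrightarrow> {(exp (- t) *\<^sub>R transport (mat 1) \<theta>, exp t *\<^sub>R v), (- (exp (- t) *\<^sub>R transport (mat 1) \<theta>), - (exp t *\<^sub>R v))}
        = {(transport Q \<theta>, Q *v v), (- transport Q \<theta>, - (Q *v v))}"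
      using h(2) cover_act_eq[OF one_closed rep_one, of x y \<theta> v] cover_act_eq[OF h(1), of _ x y \<theta> v] rep_nonempty[OF h(1)]
        boundary_act_one[OF xy(2)]
      by (auto simp: z_def cover_flow_eq)
    obtain f and i :: int where f: "f \<in> F" "h = f \<otimes> g [^] i" using F(3)[OF h(1)] hy by (auto simp: y_def)
    have fc: "f \<in> carrier G" using f F by auto
    define Q where "Q = (SOME Q. Q \<in> \<rho> f)"
    have Q: "Q \<in> \<rho> f" unfolding Q_def using rep_nonempty[OF fc] by (rule someI_ex)
    obtain R \<mu> where R: "R \<in> \<rho> (g [^] i)" "R *v v = \<mu> *\<^sub>R v" "ln \<bar>\<mu>\<bar> = of_int i * \<tau>" "\<mu> \<noteq> 0"
      using int_eig[of i] by blast
    have "Q ** R \<in> \<rho> h" using rep_mult[OF fc _ Q R(1)] g f by simp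
    from hc[OF this] have "exp t *\<^sub>R v = (Q ** R) *v v \<or> exp t *\<^sub>R v = - ((Q ** R) *v v)"
      by (metis (no_types, lifting) insertE insertI1 prod.inject singletonD)
    then have "norm (exp t *\<^sub>R v) = norm ((Q ** R) *v v)" by (metis norm_minus_cancel)
    moreover have "(Q ** R) *v v = \<mu> *\<^sub>R (Q *v v)"
      by (simp add: matrix_vector_mul_assoc[symmetric] R matrix_vector_mult_scaleR)
    ultimately have n: "exp t * norm v = \<bar>\<mu>\<bar> * norm (Q *v v)" by simp
    have Qv: "Q *v v \<noteq> 0" using rep_inj[OF fc Q] v0 by blast
    have "exp t = \<bar>\<mu>\<bar> * (norm (Q *v v) / norm v)" using n v0 by (simp add: field_simps)
    then have "t = ln (\<bar>\<mu>\<bar> * (norm (Q *v v) / norm v))" by (metis ln_exp)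
    also have "\<dots> = ln \<bar>\<mu>\<bar> + X f" using R Qv v0 by (simp add: ln_mult_pos ln_div X_def Q_def[symmetric])
    finally have "t = X f + of_int i * \<tau>" using R by simp
    then show "t \<in> {t. \<exists>f\<in>F. \<exists>k::int. t = X f + of_int k * \<tau>}" using f by blast
  qed
  have fin: "finite (P \<inter> {0<..\<tau>})"
    by (rule finite_subset[OF _ finite_translates_in_interval[OF F(1) \<tau>, of X]]) (use Psub in blast)
  have min: "\<exists>k::int. T = of_int k * a" if T: "T \<in> P" "T > 0" "\<And>s. 0 < s \<Longrightarrow> s < T \<Longrightarrow> s \<notin> P" for T
  proof (rule periods)
    have "\<forall>s. 0 < s \<and> s < T \<longrightarrow> geodesic_flow s u \<noteq> u" using T(3) by (simp add: P_def)
    then show "is_orbit_period (flow_space G S \<rho> \<xi> \<eta>) geodesic_flow T"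
      using u T(1,2) unfolding is_orbit_period_def P_def by blast
  qed
  have "\<exists>k::int. \<tau> = of_int k * a" by (rule multiple_of_minimal_period[OF diff \<tau>P \<tau> fin min])
  then show ?thesis by (simp add: \<tau>_def)
qed

text \<open>The logarithms of the rescaled eigenvalues \<open>t n\<close> are multiples of
  \<open>a\<close>, because those of the eigenvalues of \<open>H ** mpow A n\<close> and of
  \<open>m\<close> are. Convergence in a discrete set makes them eventually equal to their limit, so
  the limit is a multiple of \<open>a\<close> as well.\<close>

lemma period_coefficient:
  assumes good: "good g K" and A: "A \<in> \<rho> g"
    and at: "attracts A v b m" "\<xi> (endpoint g) = span {v}" "\<eta> (endpoint (inv g)) = {w. b \<bullet> w = 0}" "\<bar>m\<bar> > 1"
    and a: "a > 0"
    and periods: "\<And>T. is_orbit_period (flow_space G S \<rho> \<xi> \<eta>) geodesic_flow T \<Longrightarrow> \<exists>k::int. T = of_int k * a"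
    and h: "h \<in> carrier G" "H \<in> \<rho> h" and ne: "b \<bullet> (H *v v) \<noteq> 0"
  shows "\<exists>k::int. ln \<bar>b \<bullet> (H *v v)\<bar> = of_int k * a"
proof -
  have g: "g \<in> carrier G" using good good_carrier by blast
  have m0: "m \<noteq> 0" using at by (simp add: attracts_def)
  obtain B where B: "B \<in> \<rho> (inv g)" using rep_nonempty g by blast
  obtain v' b' m' where at': "attracts B v' b' m'" "\<xi> (endpoint (inv g)) = span {v'}" "\<bar>m'\<bar> > 1"
    using good_data[OF good_inv[OF good] B] by blast
  have bv': "b \<bullet> v' = 0" using opposite_orthogonal[OF good A B at(1,4) at'(1,3)] .
  \<comment> \<open>Otherwise \<open>H *v v\<close> would lie on the line of \<open>v'\<close>, on
    which \<open>b\<close> vanishes. This makes \<open>good_mult_power\<close> applicable.\<close>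
  have "boundary_act G h (endpoint g) \<noteq> endpoint (inv g)"
  proof
    assume "boundary_act G h (endpoint g) = endpoint (inv g)"
    then have "H *v v \<in> span {v'}" using \<xi>_act[OF h endpoint_bd[OF good]] at(2) at'(2) span_base[of v "{v}"] by auto
    then show False using ne bv' by (auto simp: span_singleton)
  qed
  then obtain N where N: "\<And>n. n \<ge> N \<Longrightarrow> \<exists>K'. good (h \<otimes> g [^] (n::nat)) K'"
    using good_mult_power[OF good h(1)] by blast
  define X where "X n = (1 / m ^ n) *\<^sub>R (H ** mpow A n)" for n
  have Xv: "X n *v w = H *v ((1 / m ^ n) *\<^sub>R iter A n w)" for n w
    by (simp add: X_def scaleR_matrix_vector_assoc[symmetric] matrix_vector_mul_assoc[symmetric] mpow_vector matrix_vector_mult_scaleR)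
  have "\<forall>n\<in>{N..}. \<exists>d. attracts (H ** mpow A n) (fst d) (fst (snd d)) (snd (snd d)) \<and> (\<exists>k::int. ln \<bar>snd (snd d)\<bar> = of_int k * a)"
  proof
    fix n assume "n \<in> {N..}"
    then obtain K' where K': "good (h \<otimes> g [^] n) K'" using N by auto
    have M: "H ** mpow A n \<in> \<rho> (h \<otimes> g [^] n)" using rep_mult[OF h(1) _ h(2) rep_pow[OF g A]] g by simp
    obtain v'' b'' m'' where d: "attracts (H ** mpow A n) v'' b'' m''" "\<xi> (endpoint (h \<otimes> g [^] n)) = span {v''}"
      "\<eta> (endpoint (inv (h \<otimes> g [^] n))) = {w. b'' \<bullet> w = 0}" "\<bar>m''\<bar> > 1"
      using good_data[OF K' M] by blast
    have "\<exists>k::int. ln \<bar>m''\<bar> = of_int k * a" using period_eigenvalue[OF K' M d periods] .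
    then show "\<exists>d. attracts (H ** mpow A n) (fst d) (fst (snd d)) (snd (snd d)) \<and> (\<exists>k::int. ln \<bar>snd (snd d)\<bar> = of_int k * a)"
      using d by (intro exI[of _ "(v'', b'', m'')"]) simp
  qed
  from bchoice[OF this] obtain d where d:
    "\<And>n. n \<ge> N \<Longrightarrow> attracts (H ** mpow A n) (fst (d n)) (fst (snd (d n))) (snd (snd (d n)))"
    "\<And>n. n \<ge> N \<Longrightarrow> \<exists>k::int. ln \<bar>snd (snd (d n))\<bar> = of_int k * a"
    by auto
  define t where "t n = (1 / m ^ n) * snd (snd (d n))" for n
  have tX: "attracts (X n) (fst (d n)) (fst (snd (d n))) (t n)" if "n \<ge> N" for n
    unfolding X_def t_def using attracts_scale[OF d(1)[OF that], of "1 / m ^ n"] m0 by simp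
  have limX: "(\<lambda>n. X n *v w) \<longlonglongrightarrow> (b \<bullet> w) *\<^sub>R (H *v v)" for w
  proof -
    have "(\<lambda>n. (1 / m ^ n) *\<^sub>R iter A n w) \<longlonglongrightarrow> (b \<bullet> w) *\<^sub>R v" using at by (simp add: attracts_def)
    then have "(\<lambda>n. H *v ((1 / m ^ n) *\<^sub>R iter A n w)) \<longlonglongrightarrow> H *v ((b \<bullet> w) *\<^sub>R v)"
      by (rule bounded_linear.tendsto[OF matrix_vector_mul_bounded_linear])
    then show ?thesis by (simp only: Xv matrix_vector_mult_scaleR)
  qed
  have "t \<longlonglongrightarrow> b \<bullet> (H *v v)" by (rule attracting_eigenvalue_tendsto[OF limX ne tX])
  then have "(\<lambda>n. ln \<bar>t n\<bar>) \<longlonglongrightarrow> ln \<bar>b \<bullet> (H *v v)\<bar>" using ne by (intro tendsto_intros) auto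
  moreover have mult: "\<exists>k::int. ln \<bar>t n\<bar> = of_int k * a" if n: "n \<ge> N" for n
  proof -
    obtain k :: int where k: "ln \<bar>snd (snd (d n))\<bar> = of_int k * a" using d(2)[OF n] by blast
    obtain j :: int where j: "ln \<bar>m\<bar> = of_int j * a" using period_eigenvalue[OF good A at periods] by blast
    have "snd (snd (d n)) \<noteq> 0" using d(1)[OF that] by (simp add: attracts_def)
    then have "ln \<bar>t n\<bar> = ln \<bar>snd (snd (d n))\<bar> - n * ln \<bar>m\<bar>"
      using m0 by (simp add: t_def abs_mult ln_div power_abs ln_realpow)
    then have "ln \<bar>t n\<bar> = of_int (k - int n * j) * a" using k j by (simp add: algebra_simps)
    then show ?thesis by blast
  qed
  then have "\<forall>\<^sub>F n in sequentially. \<exists>k::int. ln \<bar>t n\<bar> = of_int k * a"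
    unfolding eventually_sequentially by blast
  ultimately have "\<forall>\<^sub>F n in sequentially. ln \<bar>t n\<bar> = ln \<bar>b \<bullet> (H *v v)\<bar>"
    using a by (intro convergent_multiples_eventually_const) auto
  then obtain M where "\<forall>n\<ge>M. ln \<bar>t n\<bar> = ln \<bar>b \<bullet> (H *v v)\<bar>" unfolding eventually_sequentially by (rule exE)
  then show ?thesis using mult[of "max M N"] by auto
qed

theorem weakly_mixing:
  assumes ne: "\<not> elementary_group G"
  shows "topologically_weakly_mixing (flow_space G S \<rho> \<xi> \<eta>) geodesic_flow"
  unfolding topologically_weakly_mixing_def
proof
  assume "\<exists>a>0. \<forall>T. is_orbit_period (flow_space G S \<rho> \<xi> \<eta>) geodesic_flow T \<longrightarrow> (\<exists>k::int. T = of_int k * a)"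
  then obtain a where a: "a > 0" and
    periods: "\<And>T. is_orbit_period (flow_space G S \<rho> \<xi> \<eta>) geodesic_flow T \<Longrightarrow> \<exists>k::int. T = of_int k * a"
    by blast
  obtain g where good: "good g 0" using exists_good[OF ne] by blast
  have g: "g \<in> carrier G" using good good_carrier by blast
  note good' = good_inv[OF good]
  have ii: "inv (inv g) = g" using g by simp
  note bds = endpoint_bd[OF good] endpoint_bd[OF good']
  obtain h' where h': "h' \<in> carrier G" "boundary_act G h' (endpoint g) \<noteq> endpoint g" "boundary_act G h' (endpoint g) \<noteq> endpoint (inv g)"
    using exists_moving_endpoint[OF ne good] by blast
  \<comment> \<open>Applied to \<open>inv g\<close>, whose endpoints are exchanged. With
    \<open>h = inv k\<close> the two conditions say that \<open>h\<close> carries neither endpoint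
    of \<open>g\<close> to \<open>endpoint (inv g)\<close>.\<close>
  obtain k where k: "k \<in> carrier G" "boundary_act G k (endpoint (inv g)) \<noteq> endpoint (inv g)" "boundary_act G k (endpoint (inv g)) \<noteq> endpoint g"
    using exists_moving_endpoint[OF ne good'] ii by auto
  define h where "h = inv k"
  have h: "h \<in> carrier G" "boundary_act G h (endpoint g) \<noteq> endpoint (inv g)" "boundary_act G h (endpoint (inv g)) \<noteq> endpoint (inv g)"
    using k boundary_act_eq_iff[of h _ "endpoint (inv g)"] bds by (auto simp: h_def)
  obtain A where A: "A \<in> \<rho> g" using rep_nonempty g by blast
  obtain B where B: "B \<in> \<rho> (inv g)" using rep_nonempty g by blast
  obtain H where H: "H \<in> \<rho> h" using rep_nonempty h by blast
  obtain H' where H': "H' \<in> \<rho> h'" using rep_nonempty h' by blast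
  obtain v b m where at: "attracts A v b m" "\<xi> (endpoint g) = span {v}" "\<eta> (endpoint (inv g)) = {w. b \<bullet> w = 0}" "\<bar>m\<bar> > 1"
    using good_data[OF good A] by blast
  obtain v' b' m' where at': "attracts B v' b' m'" "\<xi> (endpoint (inv g)) = span {v'}" "\<eta> (endpoint g) = {w. b' \<bullet> w = 0}" "\<bar>m'\<bar> > 1"
    using good_data[OF good' B] ii by auto
  have m0: "m \<noteq> 0" "m' \<noteq> 0" using at at' by (auto simp: attracts_def)
  have vs: "v \<in> \<xi> (endpoint g)" "v \<noteq> 0" "v' \<in> \<xi> (endpoint (inv g))" "v' \<noteq> 0"
    using at(2) at'(2) attracts_ne_0[OF at(1)] attracts_ne_0[OF at'(1)] by (auto simp: span_base)
  have c: "b \<bullet> (H *v v) \<noteq> 0"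
    using not_in_hyperplane[OF h(1) H bds(1,2) h(2) vs(1,2)] at(3) by simp
  have c': "b \<bullet> (H' *v v) \<noteq> 0"
    using not_in_hyperplane[OF h'(1) H' bds(1,2) h'(3) vs(1,2)] at(3) by simp
  have d: "b \<bullet> (H *v v') \<noteq> 0"
    using not_in_hyperplane[OF h(1) H bds(2,2) h(3) vs(3,4)] at(3) by simp
  have d': "b' \<bullet> (H' *v v) \<noteq> 0"
    using not_in_hyperplane[OF h'(1) H' bds(1,1) h'(2) vs(1,2)] at'(3) by simp
  have b'v: "b' \<bullet> v = 0"
    using opposite_orthogonal[OF good' B _ at'(1,4) at(1,4)] A ii by simp
  define \<phi> where "\<phi> = transpose H *v b"
  have \<phi>: "\<phi> \<bullet> w = b \<bullet> (H *v w)" for w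
    by (simp add: \<phi>_def dot_lmul_matrix[symmetric])
  define s where "s n = \<phi> \<bullet> ((1 / m ^ n) *\<^sub>R iter A n (H' *v v))" for n
  define l where "l = (b \<bullet> (H' *v v)) * (b \<bullet> (H *v v))"
  have l0: "l \<noteq> 0" using c c' by (simp add: l_def)
  have sl: "s \<longlonglongrightarrow> l"
  proof -
    have "(\<lambda>n. (1 / m ^ n) *\<^sub>R iter A n (H' *v v)) \<longlonglongrightarrow> (b \<bullet> (H' *v v)) *\<^sub>R v" using at by (simp add: attracts_def)
    then have "s \<longlonglongrightarrow> \<phi> \<bullet> ((b \<bullet> (H' *v v)) *\<^sub>R v)" unfolding s_def by (intro tendsto_inner tendsto_const)
    then show ?thesis by (simp add: \<phi> l_def matrix_vector_mult_scaleR)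
  qed
  have close: "\<forall>\<^sub>F n in sequentially. dist (s n) l < \<bar>l\<bar>" using tendstoD[OF sl] l0 by simp
  have mult: "\<exists>k::int. ln \<bar>s n\<bar> = of_int k * a" if s: "s n \<noteq> 0" for n
  proof -
    have M: "(H ** mpow A n) ** H' \<in> \<rho> ((h \<otimes> g [^] n) \<otimes> h')"
      using rep_mult[OF _ h'(1) rep_mult[OF h(1) _ H rep_pow[OF g A]] H'] h g by simp
    have e: "b \<bullet> (((H ** mpow A n) ** H') *v v) = m ^ n * s n"
      using m0 by (simp add: s_def \<phi> matrix_vector_mul_assoc[symmetric] mpow_vector)
    then have "b \<bullet> (((H ** mpow A n) ** H') *v v) \<noteq> 0" using s m0 by simp
    from period_coefficient[OF good A at a periods _ M this]
    obtain k :: int where k: "ln \<bar>m ^ n * s n\<bar> = of_int k * a" using h h' g unfolding e by auto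
    obtain j :: int where j: "ln \<bar>m\<bar> = of_int j * a" using period_eigenvalue[OF good A at periods] by blast
    have "ln \<bar>m ^ n * s n\<bar> = n * ln \<bar>m\<bar> + ln \<bar>s n\<bar>"
      using s m0 by (simp add: abs_mult ln_mult_pos power_abs ln_realpow)
    then have "ln \<bar>s n\<bar> = of_int (k - int n * j) * a" using k j by (simp add: algebra_simps)
    then show ?thesis by blast
  qed
  have "(\<lambda>n. ln \<bar>s n\<bar>) \<longlonglongrightarrow> ln \<bar>l\<bar>" using sl l0 by (intro tendsto_intros) auto
  moreover have "\<forall>\<^sub>F n in sequentially. \<exists>k::int. ln \<bar>s n\<bar> = of_int k * a"
    using close by (rule eventually_mono) (rule mult, auto simp: dist_real_def)
  ultimately have "\<forall>\<^sub>F n in sequentially. ln \<bar>s n\<bar> = ln \<bar>l\<bar>"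
    using a by (intro convergent_multiples_eventually_const) auto
  \<comment> \<open>A number at distance less than \<open>\<bar>l\<bar>\<close> from
    \<open>l\<close> has the sign of \<open>l\<close>, so equality of absolute values
    suffices.\<close>
  with close have "\<forall>\<^sub>F n in sequentially. s n = l"
  proof eventually_elim
    case (elim n)
    then have "s n \<noteq> 0" by (auto simp: dist_real_def)
    then have "\<bar>s n\<bar> = \<bar>l\<bar>" using elim l0 by simp
    then show ?case using elim(1) by (auto simp: dist_real_def abs_if split: if_splits)
  qed
  then obtain N where "\<forall>n\<ge>N. s n = l" unfolding eventually_sequentially by (rule exE)
  then have N: "\<And>n. n \<ge> N \<Longrightarrow> s n = l" by simp
  \<comment> \<open>Subtracting the \<open>v\<close>-component removes the limit:
    \<open>\<phi> \<bullet> iter A n u = m ^ n * (s n - l)\<close>, which is zero for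
    \<open>n \<ge> N\<close>.\<close>
  define u where "u = H' *v v + (- (b \<bullet> (H' *v v))) *\<^sub>R v"
  have Av: "A *v v = m *\<^sub>R v" using at by (simp add: attracts_def)
  have orth: "\<phi> \<bullet> iter A n u = 0" if "n \<ge> N" for n
  proof -
    have "\<phi> \<bullet> iter A n (H' *v v) = m ^ n * s n" using m0 by (simp add: s_def)
    then have "\<phi> \<bullet> iter A n u = m ^ n * s n - m ^ n * l"
      using iter_eigenvector[OF Av, of n]
      by (simp add: u_def iter_add iter_scaleR inner_add_right \<phi>[of v] l_def algebra_simps del: scaleR_minus_left)
    then show ?thesis using N[OF that] by simp
  qed
  obtain r where r: "r = 1 \<or> r = - 1" "\<And>w. B *v (A *v w) = r *\<^sub>R w" using rep_inverse[OF g A B] by blast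
  then have "r \<noteq> 0" by auto
  have zero: "\<phi> \<bullet> iter B n u = 0" for n
    using orthogonal_backward_orbit[OF r(2) \<open>r \<noteq> 0\<close> orth] by blast
  have "(\<lambda>n. (1 / m' ^ n) *\<^sub>R iter B n u) \<longlonglongrightarrow> (b' \<bullet> u) *\<^sub>R v'" using at' by (simp add: attracts_def)
  then have "(\<lambda>n. \<phi> \<bullet> ((1 / m' ^ n) *\<^sub>R iter B n u)) \<longlonglongrightarrow> \<phi> \<bullet> ((b' \<bullet> u) *\<^sub>R v')" by (intro tendsto_inner tendsto_const)
  then have "(b' \<bullet> u) * (\<phi> \<bullet> v') = 0" using zero by (simp add: LIMSEQ_const_iff)
  \<comment> \<open>\<open>b'\<close> vanishes on \<open>v\<close>, so the correction term in
    \<open>u\<close> does not affect the backward limit.\<close>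
  moreover have "b' \<bullet> u = b' \<bullet> (H' *v v)" using b'v by (simp add: u_def inner_diff_right)
  ultimately show False using d d' by (simp add: \<phi>)
qed

end

section \<open>From cosets in the projective group to matrices\<close>

lemma SL_scalars_eq:
  assumes "B \<in> (SL_scalars :: (real^'n^'n) set)"
  shows "B = mat 1 \<or> B = - mat 1"
proof -
  obtain c where c: "B = mat c" "det (mat c :: real^'n^'n) = 1" using assms by (auto simp: SL_scalars_def SL_def)
  have "(mat c :: real^'n^'n) = c *\<^sub>R mat 1" by (simp add: mat_def vec_eq_iff)
  then have m: "(mat c :: real^'n^'n) = (\<chi> i. c *s ((mat 1 :: real^'n^'n) $ i))" by (simp add: vec_eq_iff)
  have "det (mat c :: real^'n^'n) = c ^ CARD('n) * det (mat 1 :: real^'n^'n)" unfolding m by (subst det_rows_mul) simp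
  then have "\<bar>c\<bar> ^ CARD('n) = 1" using c by (simp add: power_abs[symmetric])
  then have "\<bar>c\<bar> = 1" using power_eq_1_iff[of "\<bar>c\<bar>" "CARD('n)"] by simp
  then have "c = 1 \<or> c = - 1" by auto
  then show ?thesis using c by (auto simp: mat_def vec_eq_iff)
qed

lemma PSO_coset:
  assumes "x \<in> carrier (PSO :: (real^('p::finite + 'q::finite)^('p + 'q)) set monoid)"
  shows "\<exists>A. det A = 1 \<and> x = (\<lambda>c. c ** A) ` SL_scalars"
  using assms by (auto simp: PSO_def SL_def r_coset_def)

lemma limit_map_group_PSO:
  fixes G :: "('g, 'm) monoid_scheme"
    and \<rho> :: "'g \<Rightarrow> (real^('p::finite + 'q::finite)^('p + 'q)) set"
  assumes G: "group G" and S: "finite_symmetric_generating_set G S" and hyp: "word_hyperbolic G S"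
    and \<rho>: "\<rho> \<in> hom G PSO" and lim: "limit_maps G S \<rho> \<xi> \<eta>"
  shows "\<exists>\<delta>. limit_map_group G S \<delta> \<rho> \<xi> \<eta>"
proof -
  interpret word_metric_group G S using G S by (intro word_metric_group.intro word_metric_group_axioms.intro)
  obtain \<delta> where \<delta>: "\<And>x y z. x \<in> carrier G \<Longrightarrow> y \<in> carrier G \<Longrightarrow> z \<in> carrier G \<Longrightarrow>
      gp x y \<ge> min (gp x z) (gp z y) - \<delta>"
    using hyp unfolding word_hyperbolic_def by blast
  have coset: "\<exists>A. det A = 1 \<and> \<rho> g = (\<lambda>c. c ** A) ` SL_scalars" if "g \<in> carrier G" for g
    using PSO_coset hom_carrier[OF \<rho>] that by blast
  have one: "mat 1 \<in> (SL_scalars :: (real^('p + 'q)^('p + 'q)) set)" by (auto simp: SL_scalars_def SL_def)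
  have neg: "(- mat 1) ** A = - A" for A :: "real^('p + 'q)^('p + 'q)"
    by (simp add: matrix_eq matrix_vector_mul_assoc[symmetric] uminus_matrix_vector)
  have nonempty: "\<exists>A. A \<in> \<rho> g" if "g \<in> carrier G" for g using coset[OF that] one by blast
  have det: "det A = 1" if "g \<in> carrier G" "A \<in> \<rho> g" for g A
    using coset[OF that(1)] that(2) by (auto simp: det_mul SL_scalars_def SL_def)
  have sign: "B = A \<or> B = - A" if "g \<in> carrier G" "A \<in> \<rho> g" "B \<in> \<rho> g" for g A B
  proof -
    obtain C where C: "\<rho> g = (\<lambda>c. c ** C) ` SL_scalars" using coset \<open>g \<in> carrier G\<close> by blast
    have "X = C \<or> X = - C" if "X \<in> \<rho> g" for X
    proof -
      have "X \<in> (\<lambda>c. c ** C) ` SL_scalars" using that C by simp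
      then obtain c where "X = c ** C" "c \<in> SL_scalars" by (rule imageE)
      then show ?thesis using SL_scalars_eq[of c] neg by auto
    qed
    from this[OF that(2)] this[OF that(3)] show ?thesis by auto
  qed
  have mult: "A ** B \<in> \<rho> (g \<otimes>\<^bsub>G\<^esub> h)" if "g \<in> carrier G" "h \<in> carrier G" "A \<in> \<rho> g" "B \<in> \<rho> h" for g h A B
    using hom_mult[OF \<rho> that(1,2)] that(3,4) by (auto simp: PSO_def PSL_def FactGroup_def set_mult_def SL_def)
  \<comment> \<open>With \<open>A\<close> also \<open>A ** A\<close> represents the identity of
    \<open>G\<close>, so the sign rule gives \<open>A ** A = A\<close> or
    \<open>A ** A = - A\<close>. Hence \<open>A\<close> is the identity matrix up to sign, and in
    the negative case its square is the identity matrix.\<close>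
  have rone: "mat 1 \<in> \<rho> \<one>\<^bsub>G\<^esub>"
  proof -
    obtain A where A: "A \<in> \<rho> \<one>\<^bsub>G\<^esub>" using nonempty by blast
    have "A ** A \<in> \<rho> \<one>\<^bsub>G\<^esub>" using mult[OF _ _ A A] by simp
    then have s: "A ** A = A \<or> A ** A = - A" using sign A by blast
    have d: "det A \<noteq> 0" using det[OF _ A] by simp
    have "A = matrix_inv A ** (A ** A)" using matrix_inv_both[OF d] by (simp add: matrix_mul_assoc)
    moreover have "matrix_inv A ** (- A) = - (matrix_inv A ** A)"
      by (simp add: matrix_matrix_mult_def vec_eq_iff sum_negf)
    ultimately have "A = mat 1 \<or> A = - mat 1" using s matrix_inv_both(1)[OF d] by metis
    then show ?thesis
    proof
      assume "A = - mat 1"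
      then have "A ** A = mat 1" using neg[of "- mat 1"] by simp
      then show ?thesis using \<open>A ** A \<in> \<rho> \<one>\<^bsub>G\<^esub>\<close> by simp
    qed (use A in simp)
  qed
  have "CARD('p + 'q) > 1"
  proof -
    have "CARD('p) \<ge> 1" "CARD('q) \<ge> 1" by (simp_all add: Suc_leI)
    moreover have "CARD('p + 'q) = CARD('p) + CARD('q)" by (simp add: card_sum)
    ultimately show ?thesis by linarith
  qed
  \<comment> \<open>The four-point inequality weakens as its constant grows, so the constant may be
    raised to a nonnegative one.\<close>
  have "limit_map_group G S (max \<delta> 0) \<rho> \<xi> \<eta>"
  proof unfold_locales
    fix x y z assume "x \<in> carrier G" "y \<in> carrier G" "z \<in> carrier G"
    then show "gp x y \<ge> min (gp x z) (gp z y) - max \<delta> 0" using \<delta>[of x y z] by linarith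
  qed (use nonempty det sign mult rone lim \<open>CARD('p + 'q) > 1\<close> in auto)
  then show ?thesis by blast
qed

theorem propositionA2:
  fixes G :: "('g, 'm) monoid_scheme"
    and S :: "'g set"
    and \<rho> :: "'g \<Rightarrow> (real^('p::finite + 'q::finite)^('p + 'q)) set"
    and \<xi> \<eta> :: "(nat \<Rightarrow> 'g) set \<Rightarrow> (real^('p + 'q)) set"
  assumes "CARD('p) + CARD('q) > 2"
    and "group G"
    and "finite_symmetric_generating_set G S"
    and "word_hyperbolic G S"
    and "\<not> elementary_group G"
    and "\<rho> \<in> hom G PSO"
    and "projective_anosov G S \<rho>"
    and "limit_maps G S \<rho> \<xi> \<eta>"
  shows "topologically_weakly_mixing (flow_space G S \<rho> \<xi> \<eta>) geodesic_flow"
  using limit_map_group_PSO[OF assms(2,3,4,6,8)] limit_map_group.weakly_mixing[OF _ assms(5)] by blast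

end
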